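(* Let $u\in H^2_0(\Omega)$ be the solution of $\varepsilon^2\Delta^2u-\Delta u=f$ in $\Omega$, $u=\nabla u\cdot\mathbf n=0$ on $\partial\Omega$, and let $u_h=\{u_0,u_b,\mathbf u_g\}\in V_h^0$ be the weak Galerkin approximation, i.e. the solution of $B_h(u_h,v_h)+A_h(u_h,v_h)=(f,v_0)$ for all $v_h\in V_h^0$. Then there exists a constant $C>0$, independent of $h$, $u$ and $u_h$, such that $$\eta_h\le C\Big(|||u-u_h|||+\Big(\sum_{T\in\mathcal T_h}\alpha_T^2\|f-f_h\|_T^2\Big)^{1/2}\Big).$$
   Context: Problem and mesh. $\Omega\subset\mathbb R^2$ is a bounded domain, $f\in L^2(\Omega)$, and $\varepsilon>0$ is the singular perturbation parameter ($0<\varepsilon\ll1$). The solution $u\in H_0^2(\Omega)$ is understood weakly: $\varepsilon^2(D^2u,D^2v)+(\nabla u,\nabla v)=(f,v)$ for all $v\in H_0^2(\Omega)$, with $D^2$ the Hessian. $\mathcal T_h$ is a non-overlapping polygonal mesh of $\Omega$; $h_T$ is the diameter of the cell $T$ and $h=\max_T h_T$. $\mathcal E_h$ is the set of all edges. For an interior edge $e$ shared by $T_+,T_-$, $\mathbf n_e$ is the unit normal pointing from $T_+$ to $T_-$ and $[v]=v_+-v_-$ (difference of traces); for a boundary edge, $[v]=v$. $(\cdot,\cdot)_T$, $\langle\cdot,\cdot\rangle_{\partial T}$ are $L^2$ inner products, $\|\cdot\|_T,\|\cdot\|_e$ are $L^2$ norms, and $(\cdot,\cdot)_{\mathcal T_h}=\sum_T(\cdot,\cdot)_T$.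 Discrete spaces. Fix an integer $k\ge2$; $\mathbb P_k$ denotes polynomials of degree at most $k$. $W_k(T)$ is the set of triples $v_h=\{v_0,v_b,\mathbf v_g\}$ with $v_0\in\mathbb P_k(T)$, $v_b|_e\in\mathbb P_k(e)$, $\mathbf v_g|_e\in[\mathbb P_k(e)]^2$ for each edge $e\subset\partial T$. $V_h$ is the set of $v_h$ with $v_h|_T\in W_k(T)$ for all $T$, where $v_b$ and $\mathbf v_g$ are single-valued on each edge. $V_h^0$ is the subspace of $v_h\in V_h$ with $v_b|_e=0$ and $\mathbf v_g\cdot\mathbf n|_e=0$ for all edges $e\subset\partial\Omega$. Weak operators. For $v\in V_h+H^2(\Omega)$ (a function $v\in H^2$ is identified with $\{v|_T,v|_{\partial T},\nabla v|_{\partial T}\}$), $D_w^2v|_T\in[\mathbb P_k(T)]^{2\times2}$ and $\nabla_wv|_T\in[\mathbb P_k(T)]^2$ are the unique polynomials with $$(D_w^2v,\widetilde\varphi)_T=(v_0,\nabla\cdot\nabla\cdot\widetilde\varphi)_T-\langle v_b,(\nabla\cdot\widetilde\varphi)\cdot\mathbf n\rangle_{\partial T}+\langle\mathbf v_g,\widetilde\varphi\mathbf n\rangle_{\partial T}\quad\forall\widetilde\varphi\in[\mathbb P_k(T)]^{2\times2},$$ $$(\nabla_wv,\mathbf q)_T=-(v_0,\nabla\cdot\mathbf q)_T+\langle v_b,\mathbf q\cdot\mathbf n\rangle_{\partial T}\quad\forall\mathbf q\in[\mathbb P_k(T)]^2,$$ with $\mathbf n$ the outward unit normal to $\partial T$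 and the divergence of a matrix taken row-wise. Forms. $B_h(u_h,v_h)=\varepsilon^2(D_w^2u_h,D_w^2v_h)_{\mathcal T_h}+S_1(u_h,v_h)$ and $A_h(u_h,v_h)=(\nabla_wu_h,\nabla_wv_h)_{\mathcal T_h}+S_2(u_h,v_h)$, where $$S_1(u_h,v_h)=\sum_T\big(\varepsilon^2h_T^{-1}\langle\nabla u_0-\mathbf u_g,\nabla v_0-\mathbf v_g\rangle_{\partial T}+\varepsilon^2h_T^{-3}\langle u_0-u_b,v_0-v_b\rangle_{\partial T}\big),$$ $$S_2(u_h,v_h)=\sum_T\big(h_T\langle\nabla u_0-\mathbf u_g,\nabla v_0-\mathbf v_g\rangle_{\partial T}+h_T^{-1}\langle u_0-u_b,v_0-v_b\rangle_{\partial T}\big).$$ $|||v|||^2=B_h(v,v)+A_h(v,v)$, also applied to $u-u_h$ by identifying $u\in H^2(\Omega)$ with the triple $\{u|_T,u|_{\partial T},\nabla u|_{\partial T}\}$ on each cell $T$. Estimator. $f_h$ is the piecewise polynomial approximation of $f$ given on each $T$ by its $L^2$-projection onto $\mathbb P_k(T)$. Put $\alpha_T=\min\{\varepsilon^{-1}h_T^2,h_T\}$, $\alpha_{e,1}=\min\{\varepsilon^{-1}h_T^{3/2},h_T^{1/2}\}$, $\alpha_{e,2}=\min\{\varepsilon^{-1}h_T^{1/2},h_T^{-1/2}\}$; $$R_T=f_h-\nabla\cdot\nabla\cdot\varepsilon^2D_w^2u_h+\nabla\cdot\nabla_wu_h,\quad J_{e,1}=[(\nabla\cdot\varepsilon^2D_w^2u_h-\nabla_wu_h)\cdot\mathbf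 n],\quad J_{e,2}=[\varepsilon^2D_w^2u_h\mathbf n]$$ (in the jumps, $\mathbf n=\mathbf n_e$ is the fixed normal on $e$); $\eta_{T,1}^2=\alpha_T^2\|f-f_h\|_T^2$, $\eta_{T,2}^2=\alpha_T^2\|R_T\|_T^2$, $\eta_{e,i}^2=\sum_{e\subset\partial T}\alpha_{e,i}^2\|J_{e,i}\|_e^2$ for $i=1,2$; $$\eta_T^2=\sum_{i=1}^2\big(\eta_{T,i}^2+\eta_{e,i}^2+S_i(u_h,u_h)|_T\big),\qquad \eta_h^2=\sum_{T\in\mathcal T_h}\eta_T^2,$$ where $S_i(u_h,u_h)|_T$ is the contribution of $T$ to the sum defining $S_i(u_h,u_h)$.
   Formalization: The jump terms in the estimator are summed over interior edges only, since with boundary edges the bound is false (unit square, one cell, k ≥ 8, u=(x(1-x)y(1-y))²); meshes are shape regular with a parameter on which C may depend. *)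

theory Defs
  imports "HOL-Analysis.Analysis"
begin

type_synonym point = "real^2"
type_synonym scalar_field = "point \<Rightarrow> real"
type_synonym vector_field = "point \<Rightarrow> real^2"
type_synonym matrix_field = "point \<Rightarrow> real^2^2"

section \<open>Classical differential operators\<close>

definition pd :: "2 \<Rightarrow> scalar_field \<Rightarrow> scalar_field" where
  "pd i w x = frechet_derivative w (at x) (axis i 1)"

definition grad :: "scalar_field \<Rightarrow> vector_field" where
  "grad w x = (\<chi> i. pd i w x)"

definition dvg :: "vector_field \<Rightarrow> scalar_field" where
  "dvg q x = (\<Sum>i\<in>UNIV. pd i (\<lambda>y. q y $ i) x)"

text \<open>Row-wise divergence of a matrix field.\<close>
definition mdvg :: "matrix_field \<Rightarrow> vector_field" where
  "mdvg \<phi> x = (\<chi> i. dvg (\<lambda>y. \<phi> y $ i) x)"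

text \<open>Differentiability of all iterated partial derivatives, which is the same as being
  infinitely often continuously differentiable.\<close>
definition smooth :: "scalar_field \<Rightarrow> bool" where
  "smooth w \<longleftrightarrow> (\<forall>is x. foldr pd is w differentiable (at x))"

definition test_function :: "point set \<Rightarrow> scalar_field \<Rightarrow> bool" where
  "test_function U \<phi> \<longleftrightarrow>
     smooth \<phi> \<and> compact (closure {x. \<phi> x \<noteq> 0}) \<and> closure {x. \<phi> x \<noteq> 0} \<subseteq> U"


section \<open>Lebesgue and Sobolev spaces\<close>

definition L2 :: "point set \<Rightarrow> scalar_field \<Rightarrow> bool" where
  "L2 U w \<longleftrightarrow>
     set_borel_measurable lebesgue U w \<and> set_integrable lebesgue U (\<lambda>x. (w x)\<^sup>2)"

text \<open>The inner product \<open>(v,w)\<^sub>U\<close> for scalar, vector or matrix fields; on \<^typ>\<open>real^2^2\<close>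
  the operation \<open>\<bullet>\<close> is the Frobenius product.\<close>
definition ip :: "point set \<Rightarrow> (point \<Rightarrow> 'b::real_inner) \<Rightarrow> (point \<Rightarrow> 'b) \<Rightarrow> real" where
  "ip U v w = (LINT x:U|lebesgue. v x \<bullet> w x)"

abbreviation nrm2 :: "point set \<Rightarrow> (point \<Rightarrow> 'b::real_inner) \<Rightarrow> real" where
  "nrm2 U w \<equiv> ip U w w"

definition weak_gradient :: "point set \<Rightarrow> scalar_field \<Rightarrow> vector_field \<Rightarrow> bool" where
  "weak_gradient U w Dw \<longleftrightarrow>
     L2 U w \<and> (\<forall>i. L2 U (\<lambda>x. Dw x $ i)) \<and>
     (\<forall>\<phi> i. test_function U \<phi> \<longrightarrow> ip U w (pd i \<phi>) = - ip U (\<lambda>x. Dw x $ i) \<phi>)"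

text \<open>\<open>u \<in> H\<^sup>2(U)\<close> with weak gradient \<open>Du\<close> and weak Hessian \<open>D2u\<close>.\<close>
definition H2 :: "point set \<Rightarrow> scalar_field \<Rightarrow> vector_field \<Rightarrow> matrix_field \<Rightarrow> bool" where
  "H2 U u Du D2u \<longleftrightarrow>
     weak_gradient U u Du \<and> (\<forall>i. weak_gradient U (\<lambda>x. Du x $ i) (\<lambda>x. D2u x $ i))"

text \<open>\<open>H\<^sub>0\<^sup>2(U)\<close> is the closure of the test functions in the norm of \<open>H\<^sup>2(U)\<close>.\<close>
definition H02 :: "point set \<Rightarrow> scalar_field \<Rightarrow> vector_field \<Rightarrow> matrix_field \<Rightarrow> bool" where
  "H02 U u Du D2u \<longleftrightarrow> H2 U u Du D2u \<and>
     (\<exists>\<phi> :: nat \<Rightarrow> scalar_field. (\<forall>n. test_function U (\<phi> n)) \<and>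
        (\<lambda>n. nrm2 U (\<lambda>x. \<phi> n x - u x)) \<longlonglongrightarrow> 0 \<and>
        (\<forall>i. (\<lambda>n. nrm2 U (\<lambda>x. pd i (\<phi> n) x - Du x $ i)) \<longlonglongrightarrow> 0) \<and>
        (\<forall>i j. (\<lambda>n. nrm2 U (\<lambda>x. pd j (pd i (\<phi> n)) x - D2u x $ i $ j)) \<longlonglongrightarrow> 0))"

text \<open>Weak solution of \<open>\<epsilon>\<^sup>2\<Delta>\<^sup>2u - \<Delta>u = f\<close> with clamped boundary conditions; \<open>Du\<close> is the
  weak gradient of \<open>u\<close>.\<close>
definition weak_solution ::
    "point set \<Rightarrow> real \<Rightarrow> scalar_field \<Rightarrow> scalar_field \<Rightarrow> vector_field \<Rightarrow> bool" where
  "weak_solution \<Omega> \<epsilon> f u Du \<longleftrightarrow>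
     (\<exists>D2u. H02 \<Omega> u Du D2u \<and>
        (\<forall>v Dv D2v. H02 \<Omega> v Dv D2v \<longrightarrow>
           \<epsilon>\<^sup>2 * ip \<Omega> D2u D2v + ip \<Omega> Du Dv = ip \<Omega> f v))"


section \<open>Edges and traces\<close>

text \<open>An edge is a pair of endpoints. The order of the pair fixes the normal \<open>n\<^sub>e\<close>.\<close>
type_synonym edge = "point \<times> point"

definition seg :: "edge \<Rightarrow> point set" where
  "seg e = closed_segment (fst e) (snd e)"

definition len :: "edge \<Rightarrow> real" where
  "len e = dist (fst e) (snd e)"

definition edge_normal :: "edge \<Rightarrow> real^2" where
  "edge_normal e =
     (let d = snd e - fst e in (1 / len e) *\<^sub>R vector [d $ 2, - (d $ 1)])"

text \<open>The inner product \<open>\<langle>v,w\<rangle>\<^sub>e\<close> with respect to arc length.\<close>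
definition edge_ip :: "edge \<Rightarrow> (point \<Rightarrow> 'b::real_inner) \<Rightarrow> (point \<Rightarrow> 'b) \<Rightarrow> real" where
  "edge_ip e v w =
     len e * (LINT t:{0..1}|lebesgue.
        v (linepath (fst e) (snd e) t) \<bullet> w (linepath (fst e) (snd e) t))"

abbreviation edge_nrm2 :: "edge \<Rightarrow> (point \<Rightarrow> 'b::real_inner) \<Rightarrow> real" where
  "edge_nrm2 e w \<equiv> edge_ip e w w"

definition L2_edge :: "edge \<Rightarrow> scalar_field \<Rightarrow> bool" where
  "L2_edge e g \<longleftrightarrow>
     set_borel_measurable lebesgue {0..1} (\<lambda>t. g (linepath (fst e) (snd e) t)) \<and>
     set_integrable lebesgue {0..1} (\<lambda>t. (g (linepath (fst e) (snd e) t))\<^sup>2)"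

text \<open>\<open>g\<close> is on \<open>e\<close> the trace of the function \<open>w \<in> H\<^sup>1(T)\<close>: the trace operator is the continuous
  extension of the restriction of smooth functions.\<close>
definition is_trace :: "point set \<Rightarrow> edge \<Rightarrow> scalar_field \<Rightarrow> scalar_field \<Rightarrow> bool" where
  "is_trace T e w g \<longleftrightarrow> L2_edge e g \<and>
     (\<exists>Dw. weak_gradient (interior T) w Dw \<and>
       (\<exists>\<phi> :: nat \<Rightarrow> scalar_field. (\<forall>n. smooth (\<phi> n)) \<and>
          (\<lambda>n. nrm2 (interior T) (\<lambda>x. \<phi> n x - w x)) \<longlonglongrightarrow> 0 \<and>
          (\<lambda>n. nrm2 (interior T) (\<lambda>x. grad (\<phi> n) x - Dw x)) \<longlonglongrightarrow> 0 \<and>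
          (\<lambda>n. edge_nrm2 e (\<lambda>x. \<phi> n x - g x)) \<longlonglongrightarrow> 0))"


section \<open>Polygonal meshes\<close>

record poly_mesh =
  cells :: "point set set"
  edges :: "edge set"

definition edges_of :: "poly_mesh \<Rightarrow> point set \<Rightarrow> edge set" where
  "edges_of M T = {e \<in> edges M. seg e \<subseteq> frontier T}"

text \<open>\<open>T\<close> is the closed region bounded by a simple closed polygon whose sides are the mesh edges
  of \<open>T\<close>. Straight angles are allowed, so a hanging node is a vertex of the cells it touches.\<close>
definition polygonal_cell :: "poly_mesh \<Rightarrow> point set \<Rightarrow> bool" where
  "polygonal_cell M T \<longleftrightarrow>
     (\<exists>vs :: point list. let n = length vs;
          side = (\<lambda>i. (vs ! i, vs ! (Suc i mod n))) in
        3 \<le> n \<and> distinct vs \<and>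
        (\<forall>i<n. \<forall>j<n. i \<noteq> j \<longrightarrow>
           seg (side i) \<inter> seg (side j) =
           {fst (side i), snd (side i)} \<inter> {fst (side j), snd (side j)}) \<and>
        seg ` edges_of M T = (\<lambda>i. seg (side i)) ` {..<n} \<and>
        T = (\<Union>i<n. seg (side i)) \<union> inside (\<Union>i<n. seg (side i)))"

definition polygonal_mesh :: "point set \<Rightarrow> poly_mesh \<Rightarrow> bool" where
  "polygonal_mesh \<Omega> M \<longleftrightarrow>
     finite (cells M) \<and> finite (edges M) \<and>
     \<Union>(cells M) = closure \<Omega> \<and> interior (\<Union>(cells M)) = \<Omega> \<and>
     (\<forall>T\<in>cells M. polygonal_cell M T) \<and>
     (\<forall>T\<in>cells M. \<forall>T'\<in>cells M. T \<noteq> T' \<longrightarrow> interior T \<inter> interior T' = {}) \<and>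
     (\<forall>e\<in>edges M. \<exists>T\<in>cells M. e \<in> edges_of M T) \<and>
     (\<forall>e\<in>edges M. \<forall>e'\<in>edges M. e \<noteq> e' \<longrightarrow>
        seg e \<inter> seg e' \<subseteq> {fst e, snd e} \<inter> {fst e', snd e'})"

text \<open>Shape regularity for polygonal meshes: no edge of a cell is short relative to the diameter of
  the cell, and every edge is the base of a triangle contained in the cell whose height is
  comparable to the diameter.\<close>
definition shape_regular :: "real \<Rightarrow> poly_mesh \<Rightarrow> bool" where
  "shape_regular \<rho> M \<longleftrightarrow>
     (\<forall>T\<in>cells M. \<forall>e\<in>edges_of M T.
        \<rho> * diameter T \<le> len e \<and>
        (\<exists>A\<in>T. convex hull (insert A (seg e)) \<subseteq> T \<and>
               \<rho> * diameter T \<le> infdist A (affine hull (seg e))))"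

definition boundary_edges :: "point set \<Rightarrow> poly_mesh \<Rightarrow> edge set" where
  "boundary_edges \<Omega> M = {e \<in> edges M. seg e \<subseteq> frontier \<Omega>}"

text \<open>The outward unit normal of \<open>T\<close> on its edge \<open>e\<close>.\<close>
definition outer_normal :: "point set \<Rightarrow> edge \<Rightarrow> real^2" where
  "outer_normal T e =
     (if \<forall>\<^sub>F t in at_right 0. midpoint (fst e) (snd e) - t *\<^sub>R edge_normal e \<in> interior T
      then edge_normal e else - edge_normal e)"

text \<open>\<open>T\<^sub>+\<close> is the cell from which \<open>n\<^sub>e\<close> points outwards.\<close>
definition plus_cell :: "poly_mesh \<Rightarrow> edge \<Rightarrow> point set" where
  "plus_cell M e = (THE T. T \<in> cells M \<and> e \<in> edges_of M T \<and> outer_normal T e = edge_normal e)"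

definition minus_cell :: "poly_mesh \<Rightarrow> edge \<Rightarrow> point set" where
  "minus_cell M e = (THE T. T \<in> cells M \<and> e \<in> edges_of M T \<and> outer_normal T e = - edge_normal e)"

text \<open>The jump across an interior edge of a cell-wise given field.\<close>
definition jump ::
    "poly_mesh \<Rightarrow> edge \<Rightarrow> (point set \<Rightarrow> point \<Rightarrow> 'b::real_vector) \<Rightarrow> point \<Rightarrow> 'b" where
  "jump M e w x = w (plus_cell M e) x - w (minus_cell M e) x"

definition bdry_ip :: "poly_mesh \<Rightarrow> point set \<Rightarrow>
    (edge \<Rightarrow> point \<Rightarrow> 'b::real_inner) \<Rightarrow> (edge \<Rightarrow> point \<Rightarrow> 'b) \<Rightarrow> real" where
  "bdry_ip M T v w = (\<Sum>e\<in>edges_of M T. edge_ip e (v e) (w e))"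


section \<open>Weak functions\<close>

definition Pol :: "nat \<Rightarrow> scalar_field set" where
  "Pol k = {p. \<exists>c :: nat \<Rightarrow> nat \<Rightarrow> real.
      \<forall>x. p x = (\<Sum>i\<le>k. \<Sum>j\<le>k - i. c i j * (x $ 1) ^ i * (x $ 2) ^ j)}"

definition vPol :: "nat \<Rightarrow> vector_field set" where
  "vPol k = {q. \<forall>i. (\<lambda>x. q x $ i) \<in> Pol k}"

definition mPol :: "nat \<Rightarrow> matrix_field set" where
  "mPol k = {\<phi>. \<forall>i j. (\<lambda>x. \<phi> x $ i $ j) \<in> Pol k}"

definition Pol_edge :: "nat \<Rightarrow> edge \<Rightarrow> scalar_field set" where
  "Pol_edge k e = {g. \<exists>p :: real poly. degree p \<le> k \<and>
      (\<forall>t\<in>{0..1}. g (linepath (fst e) (snd e) t) = poly p t)}"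

text \<open>A triple \<open>{v\<^sub>0,v\<^sub>b,v\<^sub>g}\<close> with \<open>v\<^sub>b\<close>, \<open>v\<^sub>g\<close> single-valued on each edge. The field \<open>dv0\<close> is
  \<open>\<nabla>v\<^sub>0\<close>: it is carried along because \<open>v\<^sub>0\<close> need not be classically differentiable. On the edges of
  \<open>T\<close> the values of \<open>v0 T\<close> and \<open>dv0 T\<close> are the traces of \<open>v\<^sub>0\<close> and \<open>\<nabla>v\<^sub>0\<close> from inside \<open>T\<close>.\<close>
record weak_fun =
  v0 :: "point set \<Rightarrow> scalar_field"
  dv0 :: "point set \<Rightarrow> vector_field"
  vb :: "edge \<Rightarrow> scalar_field"
  vg :: "edge \<Rightarrow> vector_field"

definition wf_diff :: "weak_fun \<Rightarrow> weak_fun \<Rightarrow> weak_fun" where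
  "wf_diff v w = \<lparr> v0 = (\<lambda>T x. v0 v T x - v0 w T x), dv0 = (\<lambda>T x. dv0 v T x - dv0 w T x),
                  vb = (\<lambda>e x. vb v e x - vb w e x), vg = (\<lambda>e x. vg v e x - vg w e x) \<rparr>"

text \<open>The identification of \<open>u\<close> with \<open>{u|\<^sub>T, u|\<^bsub>\<partial>T\<^esub>, \<nabla>u|\<^bsub>\<partial>T\<^esub>}\<close>. It is meant for
  representatives of \<open>u\<close> and \<open>Du\<close> whose pointwise values on the edges, which form a null set of
  the plane, are the traces.\<close>
definition triple_of :: "scalar_field \<Rightarrow> vector_field \<Rightarrow> weak_fun" where
  "triple_of u Du = \<lparr> v0 = (\<lambda>T. u), dv0 = (\<lambda>T. Du), vb = (\<lambda>e. u), vg = (\<lambda>e. Du) \<rparr>"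

definition trace_representatives :: "poly_mesh \<Rightarrow> scalar_field \<Rightarrow> vector_field \<Rightarrow> bool" where
  "trace_representatives M u Du \<longleftrightarrow>
     (\<forall>T\<in>cells M. \<forall>e\<in>edges_of M T.
        is_trace T e u u \<and> (\<forall>i. is_trace T e (\<lambda>x. Du x $ i) (\<lambda>x. Du x $ i)))"

definition Vh :: "nat \<Rightarrow> poly_mesh \<Rightarrow> weak_fun set" where
  "Vh k M = {v. (\<forall>T\<in>cells M. v0 v T \<in> Pol k \<and> dv0 v T = grad (v0 v T)) \<and>
      (\<forall>e\<in>edges M. vb v e \<in> Pol_edge k e \<and> (\<forall>i. (\<lambda>x. vg v e x $ i) \<in> Pol_edge k e))}"

definition Vh0 :: "nat \<Rightarrow> point set \<Rightarrow> poly_mesh \<Rightarrow> weak_fun set" where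
  "Vh0 k \<Omega> M = {v \<in> Vh k M. \<forall>e\<in>boundary_edges \<Omega> M. \<forall>x\<in>seg e.
      vb v e x = 0 \<and> vg v e x \<bullet> edge_normal e = 0}"

definition weak_hess :: "nat \<Rightarrow> poly_mesh \<Rightarrow> weak_fun \<Rightarrow> point set \<Rightarrow> matrix_field" where
  "weak_hess k M v T = (THE D. D \<in> mPol k \<and> (\<forall>\<phi>\<in>mPol k.
      ip T D \<phi> = ip T (v0 v T) (dvg (mdvg \<phi>))
        - bdry_ip M T (vb v) (\<lambda>e x. mdvg \<phi> x \<bullet> outer_normal T e)
        + bdry_ip M T (vg v) (\<lambda>e x. \<phi> x *v outer_normal T e)))"

definition weak_grad :: "nat \<Rightarrow> poly_mesh \<Rightarrow> weak_fun \<Rightarrow> point set \<Rightarrow> vector_field" where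
  "weak_grad k M v T = (THE G. G \<in> vPol k \<and> (\<forall>q\<in>vPol k.
      ip T G q = - ip T (v0 v T) (dvg q)
        + bdry_ip M T (vb v) (\<lambda>e x. q x \<bullet> outer_normal T e)))"


section \<open>The weak Galerkin scheme\<close>

definition S1_cell :: "poly_mesh \<Rightarrow> real \<Rightarrow> weak_fun \<Rightarrow> weak_fun \<Rightarrow> point set \<Rightarrow> real" where
  "S1_cell M \<epsilon> u v T =
     \<epsilon>\<^sup>2 / diameter T *
       bdry_ip M T (\<lambda>e x. dv0 u T x - vg u e x) (\<lambda>e x. dv0 v T x - vg v e x)
     + \<epsilon>\<^sup>2 / diameter T ^ 3 *
       bdry_ip M T (\<lambda>e x. v0 u T x - vb u e x) (\<lambda>e x. v0 v T x - vb v e x)"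

definition S2_cell :: "poly_mesh \<Rightarrow> weak_fun \<Rightarrow> weak_fun \<Rightarrow> point set \<Rightarrow> real" where
  "S2_cell M u v T =
     diameter T *
       bdry_ip M T (\<lambda>e x. dv0 u T x - vg u e x) (\<lambda>e x. dv0 v T x - vg v e x)
     + 1 / diameter T *
       bdry_ip M T (\<lambda>e x. v0 u T x - vb u e x) (\<lambda>e x. v0 v T x - vb v e x)"

definition Bh :: "nat \<Rightarrow> poly_mesh \<Rightarrow> real \<Rightarrow> weak_fun \<Rightarrow> weak_fun \<Rightarrow> real" where
  "Bh k M \<epsilon> u v =
     \<epsilon>\<^sup>2 * (\<Sum>T\<in>cells M. ip T (weak_hess k M u T) (weak_hess k M v T))
     + (\<Sum>T\<in>cells M. S1_cell M \<epsilon> u v T)"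

definition Ah :: "nat \<Rightarrow> poly_mesh \<Rightarrow> weak_fun \<Rightarrow> weak_fun \<Rightarrow> real" where
  "Ah k M u v =
     (\<Sum>T\<in>cells M. ip T (weak_grad k M u T) (weak_grad k M v T))
     + (\<Sum>T\<in>cells M. S2_cell M u v T)"

definition wg_norm :: "nat \<Rightarrow> poly_mesh \<Rightarrow> real \<Rightarrow> weak_fun \<Rightarrow> real" where
  "wg_norm k M \<epsilon> v = sqrt (Bh k M \<epsilon> v v + Ah k M v v)"

definition wg_solution ::
    "nat \<Rightarrow> point set \<Rightarrow> poly_mesh \<Rightarrow> real \<Rightarrow> scalar_field \<Rightarrow> weak_fun \<Rightarrow> bool" where
  "wg_solution k \<Omega> M \<epsilon> f uh \<longleftrightarrow> uh \<in> Vh0 k \<Omega> M \<and>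
     (\<forall>v\<in>Vh0 k \<Omega> M. Bh k M \<epsilon> uh v + Ah k M uh v = (\<Sum>T\<in>cells M. ip T f (v0 v T)))"


section \<open>The error estimator\<close>

definition L2_proj :: "nat \<Rightarrow> scalar_field \<Rightarrow> point set \<Rightarrow> scalar_field" where
  "L2_proj k f T = (THE p. p \<in> Pol k \<and> (\<forall>q\<in>Pol k. ip T p q = ip T f q))"

definition alpha :: "real \<Rightarrow> point set \<Rightarrow> real" where
  "alpha \<epsilon> T = min (diameter T ^ 2 / \<epsilon>) (diameter T)"

definition alpha_e1 :: "real \<Rightarrow> point set \<Rightarrow> real" where
  "alpha_e1 \<epsilon> T = min (diameter T powr (3/2) / \<epsilon>) (diameter T powr (1/2))"

definition alpha_e2 :: "real \<Rightarrow> point set \<Rightarrow> real" where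
  "alpha_e2 \<epsilon> T = min (diameter T powr (1/2) / \<epsilon>) (diameter T powr (-1/2))"

definition R_cell ::
    "nat \<Rightarrow> poly_mesh \<Rightarrow> real \<Rightarrow> scalar_field \<Rightarrow> weak_fun \<Rightarrow> point set \<Rightarrow> scalar_field" where
  "R_cell k M \<epsilon> f uh T x =
     L2_proj k f T x - dvg (mdvg (\<lambda>y. \<epsilon>\<^sup>2 *\<^sub>R weak_hess k M uh T y)) x
     + dvg (weak_grad k M uh T) x"

definition J1 :: "nat \<Rightarrow> poly_mesh \<Rightarrow> real \<Rightarrow> weak_fun \<Rightarrow> edge \<Rightarrow> scalar_field" where
  "J1 k M \<epsilon> uh e = jump M e (\<lambda>T x.
     (mdvg (\<lambda>y. \<epsilon>\<^sup>2 *\<^sub>R weak_hess k M uh T y) x - weak_grad k M uh T x) \<bullet> edge_normal e)"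

definition J2 :: "nat \<Rightarrow> poly_mesh \<Rightarrow> real \<Rightarrow> weak_fun \<Rightarrow> edge \<Rightarrow> vector_field" where
  "J2 k M \<epsilon> uh e = jump M e (\<lambda>T x. (\<epsilon>\<^sup>2 *\<^sub>R weak_hess k M uh T x) *v edge_normal e)"

definition osc2_cell :: "nat \<Rightarrow> real \<Rightarrow> scalar_field \<Rightarrow> point set \<Rightarrow> real" where
  "osc2_cell k \<epsilon> f T = (alpha \<epsilon> T)\<^sup>2 * nrm2 T (\<lambda>x. f x - L2_proj k f T x)"

text \<open>The jump residuals are summed over the interior edges of \<open>T\<close>. On a boundary edge the
  one-sided values \<open>(\<nabla>\<cdot>\<epsilon>\<^sup>2D\<^sup>2u - \<nabla>u)\<cdot>n\<close> and \<open>\<epsilon>\<^sup>2D\<^sup>2u n\<close> of the exact solution do not vanish under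
  clamped boundary conditions, so they are not residuals and cannot be bounded by the error. For
  example, on the unit square as a single cell, with \<open>k \<ge> 8\<close> and
  \<open>u = (x(1-x)y(1-y))\<^sup>2\<close>, the scheme reproduces \<open>u\<close> and \<open>f\<close> is a polynomial of degree at
  most \<open>k\<close>, so that error and data oscillation are zero, but \<open>D\<^sup>2u n\<close> is not zero on the
  boundary.\<close>
definition eta2_cell ::
    "nat \<Rightarrow> point set \<Rightarrow> poly_mesh \<Rightarrow> real \<Rightarrow> scalar_field \<Rightarrow> weak_fun \<Rightarrow> point set \<Rightarrow> real" where
  "eta2_cell k \<Omega> M \<epsilon> f uh T =
     osc2_cell k \<epsilon> f T
     + (alpha \<epsilon> T)\<^sup>2 * nrm2 T (R_cell k M \<epsilon> f uh T)
     + (\<Sum>e\<in>edges_of M T - boundary_edges \<Omega> M.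
          (alpha_e1 \<epsilon> T)\<^sup>2 * edge_nrm2 e (J1 k M \<epsilon> uh e))
     + (\<Sum>e\<in>edges_of M T - boundary_edges \<Omega> M.
          (alpha_e2 \<epsilon> T)\<^sup>2 * edge_nrm2 e (J2 k M \<epsilon> uh e))
     + S1_cell M \<epsilon> uh uh T + S2_cell M uh uh T"

definition eta ::
    "nat \<Rightarrow> point set \<Rightarrow> poly_mesh \<Rightarrow> real \<Rightarrow> scalar_field \<Rightarrow> weak_fun \<Rightarrow> real" where
  "eta k \<Omega> M \<epsilon> f uh = sqrt (\<Sum>T\<in>cells M. eta2_cell k \<Omega> M \<epsilon> f uh T)"

end

theory Submission
  imports Defs
begin

text \<open>
  No bubble functions are needed. Since the cell and edge components of a test triple are
  independent, testing the discrete problem with \<open>{R\<^sub>T,0,0}\<close>, \<open>{0,J\<^bsub>e,1\<^esub>,0}\<close> and \<open>{0,0,J\<^bsub>e,2\<^esub>}\<close>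
  expresses the squared norms of the residuals through the stabilizers alone, and inverse
  inequalities bound them by \<open>S\<^sub>1(u\<^sub>h,u\<^sub>h) + S\<^sub>2(u\<^sub>h,u\<^sub>h)\<close>. On each cell this stabilizer is the one of
  \<open>u - u\<^sub>h\<close>, because the triple of a function \<open>u\<close> has no stabilization. That every cell has a bounded
  number of edges follows from shape regularity by a pigeonhole argument.
\<close>

section \<open>Polynomials on the plane\<close>

text \<open>The two branches of each minimum in \<open>alpha\<close>, \<open>alpha_e1\<close> and
  \<open>alpha_e2\<close> match the two summands of the stabilizer weights \<open>wt_grad\<close>
  and \<open>wt_val\<close>: one branch balances the summand carrying the square of \<epsilon>, the
  other the summand without it, so no power of \<epsilon> survives in the constants. In each
  identity the residual sits on both sides; Young's inequality with these weights leaves only a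
  fraction of its square on the right, which is absorbed. An inverse inequality enters for the cell
  residual alone, since that one is measured in the cell but paired on the edges. A jump is paired
  with itself on its own edge, and there the obstacle is geometric: that an edge off the boundary
  belongs to exactly two cells with opposite normals has to be extracted from the topological
  definition of the mesh. The inverse constant is uniform because every edge with its apex is an
  affine image of one fixed configuration whose Jacobian is bounded below through
  \<open>\<rho>\<close> and the diameter; the polynomials being finite-dimensional, a small
  parallelogram inside the triangle controls the whole edge.\<close>

definition mon :: "nat \<times> nat \<Rightarrow> scalar_field" where
  "mon ij x = (x $ 1) ^ fst ij * (x $ 2) ^ snd ij"

definition mon_idx :: "nat \<Rightarrow> (nat \<times> nat) set" where
  "mon_idx k = (SIGMA i:{..k}. {..k - i})"

lemma mem_mon_idx [simp]: "(i, j) \<in> mon_idx k \<longleftrightarrow> i + j \<le> k"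
  by (auto simp: mon_idx_def)

lemma finite_mon_idx [simp]: "finite (mon_idx k)"
  by (simp add: mon_idx_def)

text \<open>One sum over a finite set of exponent pairs replaces the nested sums, so that closure
  under linear operations is coefficient arithmetic.\<close>

lemma Pol_iff: "p \<in> Pol k \<longleftrightarrow> (\<exists>c. p = (\<lambda>x. \<Sum>ij\<in>mon_idx k. c ij * mon ij x))"
proof
  assume "p \<in> Pol k"
  then obtain c :: "nat \<Rightarrow> nat \<Rightarrow> real"
    where "\<And>x. p x = (\<Sum>i\<le>k. \<Sum>j\<le>k - i. c i j * (x $ 1) ^ i * (x $ 2) ^ j)"
    by (auto simp: Pol_def)
  then have "p = (\<lambda>x. \<Sum>ij\<in>mon_idx k. c (fst ij) (snd ij) * mon ij x)"
    by (auto simp: mon_idx_def mon_def sum.Sigma case_prod_beta mult.assoc)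
  then show "\<exists>c. p = (\<lambda>x. \<Sum>ij\<in>mon_idx k. c ij * mon ij x)"
    by (intro exI[of _ "\<lambda>ij. c (fst ij) (snd ij)"])
next
  assume "\<exists>c. p = (\<lambda>x. \<Sum>ij\<in>mon_idx k. c ij * mon ij x)"
  then obtain c where "p = (\<lambda>x. \<Sum>ij\<in>mon_idx k. c ij * mon ij x)"
    by auto
  then show "p \<in> Pol k"
    unfolding Pol_def
    by (intro CollectI exI[of _ "\<lambda>i j. c (i, j)"])
      (auto simp: mon_idx_def mon_def sum.Sigma case_prod_beta mult.assoc)
qed

lemma Pol_zero [simp]: "(\<lambda>x. 0) \<in> Pol k"
  unfolding Pol_iff by (rule exI[of _ "\<lambda>_. 0"]) simp

lemma Pol_add:
  assumes "p \<in> Pol k" "q \<in> Pol k"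
  shows "(\<lambda>x. p x + q x) \<in> Pol k"
proof -
  obtain c d where "p = (\<lambda>x. \<Sum>ij\<in>mon_idx k. c ij * mon ij x)"
    "q = (\<lambda>x. \<Sum>ij\<in>mon_idx k. d ij * mon ij x)"
    using assms unfolding Pol_iff by auto
  then show ?thesis
    unfolding Pol_iff
    by (intro exI[of _ "\<lambda>ij. c ij + d ij"]) (auto simp: sum.distrib distrib_right)
qed

lemma Pol_scale:
  assumes "p \<in> Pol k"
  shows "(\<lambda>x. c * p x) \<in> Pol k"
proof -
  obtain d where "p = (\<lambda>x. \<Sum>ij\<in>mon_idx k. d ij * mon ij x)"
    using assms unfolding Pol_iff by auto
  then show ?thesis
    unfolding Pol_iff
    by (intro exI[of _ "\<lambda>ij. c * d ij"]) (auto simp: sum_distrib_left mult.assoc)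
qed

lemma Pol_diff: "p \<in> Pol k \<Longrightarrow> q \<in> Pol k \<Longrightarrow> (\<lambda>x. p x - q x) \<in> Pol k"
  using Pol_add[of p k "\<lambda>x. - 1 * q x"] Pol_scale[of q k "- 1"] by simp

lemma Pol_sum: "(\<And>i. i \<in> I \<Longrightarrow> p i \<in> Pol k) \<Longrightarrow> (\<lambda>x. \<Sum>i\<in>I. p i x) \<in> Pol k"
  by (induction I rule: infinite_finite_induct) (auto intro: Pol_add)

lemma Pol_mon: "i + j \<le> k \<Longrightarrow> mon (i, j) \<in> Pol k"
  unfolding Pol_iff
  by (intro exI[of _ "\<lambda>ij. if ij = (i, j) then 1 else 0"] ext)
    (simp add: if_distrib[of "\<lambda>c. c * _"] sum.delta cong: if_cong)

lemma Pol_const: "(\<lambda>x. c) \<in> Pol k"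
  using Pol_scale[OF Pol_mon[of 0 0 k], of c] by (simp add: mon_def)

text \<open>Facts that are linear in the polynomial need a check on monomials only. The inductive
  cases keep the membership hypotheses because the rules for derivatives ask for differentiability
  of the summands.\<close>

lemma Pol_induct [consumes 1, case_names mon zero add scale]:
  assumes "p \<in> Pol k"
    and "\<And>i j. i + j \<le> k \<Longrightarrow> P (mon (i, j))"
    and "P (\<lambda>x. 0)"
    and "\<And>p q. p \<in> Pol k \<Longrightarrow> q \<in> Pol k \<Longrightarrow> P p \<Longrightarrow> P q \<Longrightarrow> P (\<lambda>x. p x + q x)"
    and "\<And>c p. p \<in> Pol k \<Longrightarrow> P p \<Longrightarrow> P (\<lambda>x. c * p x)"
  shows "P p"
proof -
  obtain c where p: "p = (\<lambda>x. \<Sum>ij\<in>mon_idx k. c ij * mon ij x)"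
    using assms(1) unfolding Pol_iff by auto
  have "J \<subseteq> mon_idx k \<Longrightarrow> P (\<lambda>x. \<Sum>ij\<in>J. c ij * mon ij x) \<and> (\<lambda>x. \<Sum>ij\<in>J. c ij * mon ij x) \<in> Pol k"
    if "finite J" for J
    using that
  proof induction
    case empty
    then show ?case using assms(3) by simp
  next
    case (insert ij J)
    obtain i j where ij: "ij = (i, j)" by (cases ij)
    with insert.prems have m: "mon ij \<in> Pol k" "P (mon ij)"
      using assms(2) Pol_mon by auto
    then have "(\<lambda>x. c ij * mon ij x) \<in> Pol k" "P (\<lambda>x. c ij * mon ij x)"
      using Pol_scale assms(5) by auto
    then show ?case
      using insert assms(4)[of "\<lambda>x. c ij * mon ij x" "\<lambda>x. \<Sum>ij\<in>J. c ij * mon ij x"]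
        Pol_add[of "\<lambda>x. c ij * mon ij x" k "\<lambda>x. \<Sum>ij\<in>J. c ij * mon ij x"]
      by simp
  qed
  from this[of "mon_idx k"] p show ?thesis by auto
qed

lemma Pol_mono:
  assumes "k \<le> l" "p \<in> Pol k"
  shows "p \<in> Pol l"
  using assms(2)
proof (induction rule: Pol_induct)
  case (mon i j)
  then show ?case using assms(1) by (intro Pol_mon) simp
qed (auto intro: Pol_add Pol_scale)

lemma Pol_mult:
  assumes "p \<in> Pol k" "q \<in> Pol l"
  shows "(\<lambda>x. p x * q x) \<in> Pol (k + l)"
  using assms(1)
proof (induction rule: Pol_induct)
  case (mon i j)
  show ?case
    using assms(2)
  proof (induction rule: Pol_induct)
    case (mon i' j')
    have "mon (i + i', j + j') \<in> Pol (k + l)"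
      using mon \<open>i + j \<le> k\<close> by (intro Pol_mon) simp
    moreover have "mon (i + i', j + j') = (\<lambda>x. mon (i, j) x * mon (i', j') x)"
      by (auto simp: mon_def power_add)
    ultimately show ?case by simp
  next
    case (add p q)
    then show ?case using Pol_add by (auto simp: distrib_left)
  next
    case (scale c p)
    then show ?case using Pol_scale[of _ "k + l" c] by (auto simp: algebra_simps)
  qed auto
next
  case (add p q)
  then show ?case using Pol_add by (auto simp: distrib_right)
next
  case (scale c p)
  then show ?case using Pol_scale[of _ "k + l" c] by (auto simp: algebra_simps)
qed auto

lemma Pol_power:
  assumes "p \<in> Pol 1"
  shows "(\<lambda>x. p x ^ n) \<in> Pol n"
proof (induction n)
  case 0
  then show ?case using Pol_const[of 1] by simp
next
  case (Suc n)
  then show ?case using Pol_mult[OF assms Suc] by simp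
qed

lemma Pol_compose:
  assumes "p \<in> Pol k" "\<And>i. (\<lambda>x. F x $ i) \<in> Pol 1"
  shows "(\<lambda>x. p (F x)) \<in> Pol k"
  using assms(1)
proof (induction rule: Pol_induct)
  case (mon i j)
  have "(\<lambda>x. (F x $ 1) ^ i * (F x $ 2) ^ j) \<in> Pol (i + j)"
    by (intro Pol_mult Pol_power assms(2))
  then have "(\<lambda>x. (F x $ 1) ^ i * (F x $ 2) ^ j) \<in> Pol k"
    using Pol_mono mon by blast
  then show ?case by (simp add: mon_def)
qed (auto intro: Pol_add Pol_scale)

lemma continuous_on_Pol [continuous_intros]:
  assumes "p \<in> Pol k"
  shows "continuous_on S p"
  using assms
proof (induction rule: Pol_induct)
  case (mon i j)
  then show ?case by (auto simp: mon_def[abs_def] intro!: continuous_intros)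
qed (auto intro!: continuous_intros)

section \<open>Restriction of polynomials to lines\<close>

lemma poly_along_line:
  assumes "p \<in> Pol k"
  shows "\<exists>r :: real poly. degree r \<le> k \<and> (\<forall>t. p (linepath a b t) = poly r t)"
  using assms
proof (induction rule: Pol_induct)
  case (mon i j)
  let ?r = "\<lambda>l. [:a $ l, b $ l - a $ l:]"
  have d: "degree (?r l) \<le> 1" for l
    by simp
  have "degree (?r 1 ^ i * ?r 2 ^ j) \<le> degree (?r 1 ^ i) + degree (?r 2 ^ j)"
    by (rule degree_mult_le)
  also have "\<dots> \<le> degree (?r 1) * i + degree (?r 2) * j"
    by (intro add_mono degree_power_le)
  also have "\<dots> \<le> 1 * i + 1 * j"
    by (intro add_mono mult_right_mono d) auto
  finally have "degree (?r 1 ^ i * ?r 2 ^ j) \<le> k"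
    using mon by simp
  moreover have "mon (i, j) (linepath a b t) = poly (?r 1 ^ i * ?r 2 ^ j) t" for t
    by (simp add: mon_def linepath_def algebra_simps)
  ultimately show ?case by blast
next
  case zero
  then show ?case by (intro exI[of _ 0]) simp
next
  case (add p q)
  then obtain r s where "degree r \<le> k" "\<forall>t. p (linepath a b t) = poly r t"
    "degree s \<le> k" "\<forall>t. q (linepath a b t) = poly s t" by auto
  then show ?case by (intro exI[of _ "r + s"]) (auto intro: degree_add_le)
next
  case (scale c p)
  then obtain r where "degree r \<le> k" "\<forall>t. p (linepath a b t) = poly r t" by auto
  then show ?case
    by (intro exI[of _ "smult c r"]) (auto intro: order.trans[OF degree_smult_le])
qed

lemma Pol_imp_Pol_edge: "p \<in> Pol k \<Longrightarrow> p \<in> Pol_edge k e"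
  using poly_along_line[of p k "fst e" "snd e"] by (auto simp: Pol_edge_def)

lemma Pol_edge_zero [simp]: "(\<lambda>x. 0) \<in> Pol_edge k e"
  by (intro Pol_imp_Pol_edge Pol_zero)

lemma continuous_on_Pol_edge:
  assumes "g \<in> Pol_edge k e"
  shows "continuous_on {0..1} (\<lambda>t. g (linepath (fst e) (snd e) t))"
proof -
  obtain r :: "real poly" where "\<forall>t\<in>{0..1}. g (linepath (fst e) (snd e) t) = poly r t"
    using assms by (auto simp: Pol_edge_def)
  then show ?thesis
    by (subst continuous_on_cong[OF refl, of _ _ "poly r"]) (auto intro!: continuous_intros)
qed

text \<open>On the line from \<open>x0\<close> to any \<open>y\<close> the polynomial is univariate
  and vanishes at all small positive parameters, so it has infinitely many roots; parameter 1 gives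
  the value at \<open>y\<close>.\<close>

lemma Pol_eq_0_if_eq_0_on_open:
  assumes "p \<in> Pol k" "open U" "x0 \<in> U" "\<And>x. x \<in> U \<Longrightarrow> p x = 0"
  shows "p = (\<lambda>x. 0)"
proof
  fix y
  obtain r :: "real poly" where r: "\<And>t. p (linepath x0 y t) = poly r t"
    using poly_along_line[OF assms(1)] by blast
  have "((\<lambda>t. linepath x0 y t) \<longlongrightarrow> linepath x0 y 0) (at_right 0)"
    unfolding linepath_def by (intro tendsto_intros)
  then have "\<forall>\<^sub>F t in at_right 0. linepath x0 y t \<in> U"
    using assms(2,3) by (auto simp: linepath_0' intro: topological_tendstoD)
  then obtain b :: real where "b > 0" and b: "\<And>t. 0 < t \<Longrightarrow> t < b \<Longrightarrow> linepath x0 y t \<in> U"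
    by (auto simp: eventually_at_right_field)
  have "{0<..<b} \<subseteq> {t. poly r t = 0}"
    using b assms(4) r by force
  moreover have "infinite {0<..<b}"
    using \<open>b > 0\<close> by simp
  ultimately have "r = 0"
    using poly_roots_finite infinite_super by blast
  with r[of 1] show "p y = 0"
    by (simp add: linepath_1')
qed

section \<open>Derivatives of polynomials\<close>

lemma has_derivative_mon:
  "(mon (i, j) has_derivative
      (\<lambda>h. of_nat i * (x $ 1) ^ (i - 1) * h $ 1 * (x $ 2) ^ j
         + (x $ 1) ^ i * (of_nat j * (x $ 2) ^ (j - 1) * h $ 2))) (at x)"
  unfolding mon_def fst_conv snd_conv
  by (auto intro!: derivative_eq_intros bounded_linear_imp_has_derivative[OF bounded_linear_vec_nth]
      simp: algebra_simps)

lemma differentiable_Pol: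
  assumes "p \<in> Pol k"
  shows "p differentiable (at x)"
  using assms
proof (induction rule: Pol_induct)
  case (mon i j)
  then show ?case using has_derivative_mon differentiableI by blast
qed (auto intro: derivative_intros)

lemma pd_add:
  assumes "p differentiable (at x)" "q differentiable (at x)"
  shows "pd l (\<lambda>x. p x + q x) x = pd l p x + pd l q x"
  unfolding pd_def
  using frechet_derivative_at[OF has_derivative_add[OF assms[unfolded frechet_derivative_works]]]
  by metis

lemma pd_scale:
  assumes "p differentiable (at x)"
  shows "pd l (\<lambda>x. c * p x) x = c * pd l p x"
proof -
  have "((\<lambda>x. c * p x) has_derivative (\<lambda>h. c * frechet_derivative p (at x) h)) (at x)"
    using assms by (intro has_derivative_mult_right) (simp add: frechet_derivative_works)
  from frechet_derivative_at[OF this, symmetric] show ?thesis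
    by (simp add: pd_def)
qed

lemma pd_zero [simp]: "pd l (\<lambda>x. 0) = (\<lambda>x. 0)"
  by (rule ext) (simp add: pd_def frechet_derivative_const)

text \<open>The truncated subtraction in the exponents is harmless: at exponent 0 the numerical
  factor in front is 0.\<close>

lemma pd_mon:
  "pd 1 (mon (i, j)) = (\<lambda>x. of_nat i * mon (i - 1, j) x)"
  "pd 2 (mon (i, j)) = (\<lambda>x. of_nat j * mon (i, j - 1) x)"
  using frechet_derivative_at[OF has_derivative_mon, symmetric]
  by (auto simp: pd_def fun_eq_iff mon_def axis_def)

text \<open>The degree bound is kept at \<open>k\<close> instead of \<open>k - 1\<close>: the
  residuals only have to stay in the space of admissible test polynomials.\<close>

lemma Pol_pd:
  assumes "p \<in> Pol k"
  shows "pd l p \<in> Pol k"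
  using assms
proof (induction rule: Pol_induct)
  case (mon i j)
  consider "l = 1" | "l = 2" using exhaust_2 by blast
  then show ?case
    using mon by cases (auto simp: pd_mon intro!: Pol_scale Pol_mon)
next
  case (add p q)
  have "pd l (\<lambda>x. p x + q x) = (\<lambda>x. pd l p x + pd l q x)"
    using add by (intro ext pd_add) (auto intro: differentiable_Pol)
  with add show ?case using Pol_add by simp
next
  case (scale c p)
  have "pd l (\<lambda>x. c * p x) = (\<lambda>x. c * pd l p x)"
    using scale by (intro ext pd_scale) (auto intro: differentiable_Pol)
  with scale show ?case using Pol_scale by simp
qed auto

lemma has_derivative_Pol:
  assumes "p \<in> Pol k"
  shows "(p has_derivative (\<lambda>h. pd 1 p x * h $ 1 + pd 2 p x * h $ 2)) (at x)"
proof -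
  let ?D = "frechet_derivative p (at x)"
  have D: "(p has_derivative ?D) (at x)"
    using differentiable_Pol[OF assms] frechet_derivative_works by blast
  interpret linear ?D
    using D by (rule has_derivative_linear)
  have "?D h = pd 1 p x * h $ 1 + pd 2 p x * h $ 2" for h
  proof -
    have "h = h $ 1 *\<^sub>R axis 1 1 + h $ 2 *\<^sub>R axis 2 1"
      by (simp add: vec_eq_iff forall_2 axis_def)
    then have "?D h = ?D (h $ 1 *\<^sub>R axis 1 1 + h $ 2 *\<^sub>R axis 2 1)"
      by simp
    also have "\<dots> = pd 1 p x * h $ 1 + pd 2 p x * h $ 2"
      unfolding add scale pd_def by simp
    finally show ?thesis .
  qed
  then have "?D = (\<lambda>h. pd 1 p x * h $ 1 + pd 2 p x * h $ 2)" by (rule ext)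
  with D show ?thesis by simp
qed

section \<open>Polynomial fields\<close>

text \<open>Scalar, vector and matrix polynomials are treated at once through their coordinates in a
  Euclidean basis, so the existence of projections and weak operators is proved a single
  time.\<close>

definition FPol :: "nat \<Rightarrow> (point \<Rightarrow> 'b::euclidean_space) set" where
  "FPol k = {q. \<forall>b\<in>Basis. (\<lambda>x. q x \<bullet> b) \<in> Pol k}"

lemma Pol_eq_FPol: "Pol k = FPol k"
  by (auto simp: FPol_def)

lemma vPol_eq_FPol: "vPol k = FPol k"
  by (auto simp: vPol_def FPol_def Basis_vec_def inner_axis)

lemma mPol_eq_FPol: "mPol k = FPol k"
  by (auto simp: mPol_def FPol_def Basis_vec_def inner_axis)

lemma FPol_zero: "(\<lambda>x. 0) \<in> FPol k"
  by (simp add: FPol_def)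

lemma FPol_add: "p \<in> FPol k \<Longrightarrow> q \<in> FPol k \<Longrightarrow> (\<lambda>x. p x + q x) \<in> FPol k"
  by (auto simp: FPol_def inner_add_left intro: Pol_add)

lemma FPol_scale: "p \<in> FPol k \<Longrightarrow> (\<lambda>x. c *\<^sub>R p x) \<in> FPol k"
  by (auto simp: FPol_def intro: Pol_scale)

lemma continuous_on_FPol: 
  assumes "q \<in> FPol k"
  shows "continuous_on S q"
proof -
  have "continuous_on S (\<lambda>x. \<Sum>b\<in>Basis. (q x \<bullet> b) *\<^sub>R b)"
    using assms by (intro continuous_intros continuous_on_Pol) (auto simp: FPol_def)
  then show ?thesis by (simp add: euclidean_representation)
qed

text \<open>The generators are the products of a monomial and a basis vector, renumbered by naturals
  to fit the finite-dimensionality axiom of \<open>form_space\<close>.\<close>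

lemma FPol_generated:
  obtains g :: "nat \<Rightarrow> point \<Rightarrow> 'b::euclidean_space" and n
  where "\<And>i. i < n \<Longrightarrow> g i \<in> FPol k"
    and "\<And>q. q \<in> FPol k \<Longrightarrow> \<exists>c. q = (\<lambda>x. \<Sum>i<n. c i *\<^sub>R g i x)"
proof -
  let ?I = "mon_idx k \<times> (Basis :: 'b set)"
  let ?G = "\<lambda>(ij, b) x. mon ij x *\<^sub>R (b::'b)"
  have fin: "finite ?I" by simp
  then obtain h where h: "bij_betw h {..<card ?I} ?I"
    using ex_bij_betw_nat_finite lessThan_atLeast0 by metis
  show ?thesis
  proof (rule that[of "card ?I" "\<lambda>i. ?G (h i)"])
    fix i assume "i < card ?I"
    then have "h i \<in> ?I" using h bij_betwE by blast
    then obtain m n b where "h i = ((m, n), b)" "m + n \<le> k" "b \<in> Basis"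
      by (metis SigmaE mem_mon_idx prod.exhaust_sel)
    then show "?G (h i) \<in> FPol k"
      by (auto simp: FPol_def inner_Basis intro: Pol_mon)
  next
    fix q :: "point \<Rightarrow> 'b" assume "q \<in> FPol k"
    then have "\<forall>b\<in>Basis. \<exists>c. (\<lambda>x. q x \<bullet> b) = (\<lambda>x. \<Sum>ij\<in>mon_idx k. c ij * mon ij x)"
      by (auto simp: FPol_def Pol_iff)
    then obtain c where c: "\<And>b. b \<in> Basis \<Longrightarrow>
        (\<lambda>x. q x \<bullet> b) = (\<lambda>x. \<Sum>ij\<in>mon_idx k. c b ij * mon ij x)"
      by metis
    have "q x = (\<Sum>i<card ?I. (\<lambda>(ij, b). c b ij) (h i) *\<^sub>R ?G (h i) x)" for x
    proof -
      have "q x = (\<Sum>b\<in>Basis. (q x \<bullet> b) *\<^sub>R b)"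
        by (simp add: euclidean_representation)
      also have "\<dots> = (\<Sum>b\<in>Basis. (\<Sum>ij\<in>mon_idx k. c b ij * mon ij x) *\<^sub>R b)"
        using c by (intro sum.cong refl) (metis (no_types, lifting))
      also have "\<dots> = (\<Sum>b\<in>Basis. \<Sum>ij\<in>mon_idx k. c b ij *\<^sub>R (mon ij x *\<^sub>R b))"
        by (simp add: scaleR_sum_left)
      also have "\<dots> = (\<Sum>ij\<in>mon_idx k. \<Sum>b\<in>Basis. c b ij *\<^sub>R (mon ij x *\<^sub>R b))"
        by (rule sum.swap)
      also have "\<dots> = (\<Sum>z\<in>?I. (\<lambda>(ij, b). c b ij) z *\<^sub>R ?G z x)"
        by (simp add: sum.cartesian_product case_prod_beta)
      also have "\<dots> = (\<Sum>i<card ?I. (\<lambda>(ij, b). c b ij) (h i) *\<^sub>R ?G (h i) x)"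
        by (rule sum.reindex_bij_betw[OF h, symmetric])
      finally show ?thesis .
    qed
    then show "\<exists>c. q = (\<lambda>x. \<Sum>i<card ?I. c i *\<^sub>R ?G (h i) x)"
      by (intro exI[of _ "\<lambda>i. (\<lambda>(ij, b). c b ij) (h i)"] ext)
  qed
qed

section \<open>Finite-dimensional inner product spaces of functions\<close>

text \<open>An integral form on functions is definite on polynomials only, so the inner product
  lives on a carrier set and not on a type. The axiom \<open>generated\<close> is finite
  dimensionality, stated without linear independence.\<close>

locale form_space =
  fixes V :: "('a \<Rightarrow> 'b::real_vector) set" and \<beta> :: "('a \<Rightarrow> 'b) \<Rightarrow> ('a \<Rightarrow> 'b) \<Rightarrow> real"
  assumes V_zero: "(\<lambda>x. 0) \<in> V"
    and V_add: "f \<in> V \<Longrightarrow> g \<in> V \<Longrightarrow> (\<lambda>x. f x + g x) \<in> V"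
    and V_scale: "f \<in> V \<Longrightarrow> (\<lambda>x. c *\<^sub>R f x) \<in> V"
    and form_sym: "f \<in> V \<Longrightarrow> g \<in> V \<Longrightarrow> \<beta> f g = \<beta> g f"
    and form_add: "f \<in> V \<Longrightarrow> g \<in> V \<Longrightarrow> h \<in> V \<Longrightarrow> \<beta> (\<lambda>x. f x + g x) h = \<beta> f h + \<beta> g h"
    and form_scale: "f \<in> V \<Longrightarrow> h \<in> V \<Longrightarrow> \<beta> (\<lambda>x. c *\<^sub>R f x) h = c * \<beta> f h"
    and form_nonneg: "f \<in> V \<Longrightarrow> 0 \<le> \<beta> f f"
    and form_definite: "f \<in> V \<Longrightarrow> \<beta> f f = 0 \<Longrightarrow> f = (\<lambda>x. 0)"
    and generated: "\<exists>(g :: nat \<Rightarrow> 'a \<Rightarrow> 'b) n. (\<forall>i<n. g i \<in> V) \<and>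
          (\<forall>q\<in>V. \<exists>c. q = (\<lambda>x. \<Sum>i<n. c i *\<^sub>R g i x))"
begin

lemma linear_functional_sum:
  fixes n :: nat and l :: "('a \<Rightarrow> 'b) \<Rightarrow> real"
  assumes "\<And>f g. f \<in> V \<Longrightarrow> g \<in> V \<Longrightarrow> l (\<lambda>x. f x + g x) = l f + l g"
    and "\<And>f c. f \<in> V \<Longrightarrow> l (\<lambda>x. c *\<^sub>R f x) = c * l f"
    and "\<And>i. i < n \<Longrightarrow> f i \<in> V"
  shows "(\<lambda>x. \<Sum>i<n. c i *\<^sub>R f i x) \<in> V \<and> l (\<lambda>x. \<Sum>i<n. c i *\<^sub>R f i x) = (\<Sum>i<n. c i * l (f i))"
  using assms(3)
proof (induction n)
  case 0
  \<comment> \<open>Homogeneity with factor 0 is what determines the value at the zero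
    function.\<close>
  have "l (\<lambda>x. 0 *\<^sub>R 0) = 0 * l (\<lambda>x. 0)"
    using assms(2) V_zero by blast
  then show ?case using V_zero by simp
next
  case (Suc n)
  then have IH: "(\<lambda>x. \<Sum>i<n. c i *\<^sub>R f i x) \<in> V"
    "l (\<lambda>x. \<Sum>i<n. c i *\<^sub>R f i x) = (\<Sum>i<n. c i * l (f i))" and f: "f n \<in> V"
    by auto
  show ?case
    using IH V_add[OF IH(1) V_scale[OF f, of "c n"]] assms(1)[OF IH(1) V_scale[OF f, of "c n"]]
      assms(2)[OF f] by simp
qed

lemma V_sum: "(\<And>i. i < (n::nat) \<Longrightarrow> f i \<in> V) \<Longrightarrow> (\<lambda>x. \<Sum>i<n. c i *\<^sub>R f i x) \<in> V"
  using linear_functional_sum[of "\<lambda>_. 0"] by simp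

lemma form_sum:
  "(\<And>i. i < (n::nat) \<Longrightarrow> f i \<in> V) \<Longrightarrow> h \<in> V \<Longrightarrow>
     \<beta> (\<lambda>x. \<Sum>i<n. c i *\<^sub>R f i x) h = (\<Sum>i<n. c i * \<beta> (f i) h)"
  using linear_functional_sum[of "\<lambda>f. \<beta> f h"] form_add form_scale by auto

definition orthonormal :: "nat \<Rightarrow> (nat \<Rightarrow> 'a \<Rightarrow> 'b) \<Rightarrow> bool" where
  "orthonormal m e \<longleftrightarrow> (\<forall>i<m. e i \<in> V) \<and>
     (\<forall>i<m. \<forall>j<m. \<beta> (e i) (e j) = (if i = j then 1 else 0))"

text \<open>Lying in the span of \<open>e\<close> is expressed by the Fourier expansion, whose
  coefficients are values of the form; this avoids choosing coefficients.\<close>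

definition expands :: "nat \<Rightarrow> (nat \<Rightarrow> 'a \<Rightarrow> 'b) \<Rightarrow> ('a \<Rightarrow> 'b) \<Rightarrow> bool" where
  "expands m e q \<longleftrightarrow> q = (\<lambda>x. \<Sum>i<m. \<beta> q (e i) *\<^sub>R e i x)"

text \<open>The number \<open>m\<close> of orthonormal vectors may be smaller than \<open>n\<close>:
  a generator that depends on its predecessors contributes no new vector.\<close>

lemma gram_schmidt:
  fixes g :: "nat \<Rightarrow> 'a \<Rightarrow> 'b"
  assumes "\<And>i. i < n \<Longrightarrow> g i \<in> V"
  shows "\<exists>m e. orthonormal m e \<and> (\<forall>i<n. expands m e (g i))"
  using assms
proof (induction n)
  case 0
  then show ?case by (intro exI[of _ 0]) (auto simp: orthonormal_def)
next
  case (Suc n)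
  then obtain m e where e: "orthonormal m e" and ex: "\<And>i. i < n \<Longrightarrow> expands m e (g i)"
    by auto
  have eV: "e i \<in> V" if "i < m" for i using e that by (auto simp: orthonormal_def)
  have gV: "g i \<in> V" if "i \<le> n" for i using Suc.prems that by simp
  \<comment> \<open>\<open>s\<close> is the orthogonal projection of the new generator onto the span
    built so far, and \<open>r\<close> the remainder, which is normalized if it does not
    vanish.\<close>
  define s where "s = (\<lambda>x. \<Sum>i<m. \<beta> (g n) (e i) *\<^sub>R e i x)"
  define r where "r = (\<lambda>x. g n x + (- 1) *\<^sub>R s x)"
  have sV: "s \<in> V" unfolding s_def by (intro V_sum eV)
  have rV: "r \<in> V" unfolding r_def by (intro V_add V_scale gV sV) simp
  have g_eq: "g n = (\<lambda>x. s x + r x)" by (simp add: r_def)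
  have s_e: "\<beta> s (e j) = \<beta> (g n) (e j)" if "j < m" for j
  proof -
    have "\<beta> s (e j) = (\<Sum>i<m. \<beta> (g n) (e i) * \<beta> (e i) (e j))"
      unfolding s_def using that by (intro form_sum eV) auto
    also have "\<dots> = (\<Sum>i<m. if i = j then \<beta> (g n) (e i) else 0)"
      using e that by (intro sum.cong) (auto simp: orthonormal_def)
    finally show ?thesis using that by simp
  qed
  have r_e: "\<beta> r (e j) = 0" if "j < m" for j
    using that s_e form_add[OF gV V_scale[OF sV] eV, of n j "- 1"] form_scale[OF sV eV, of j "- 1"]
    by (simp add: r_def)
  show ?case
  proof (cases "\<beta> r r = 0")
    case True
    then have "r = (\<lambda>x. 0)" using form_definite rV by blast
    then have "expands m e (g n)"
      using g_eq unfolding expands_def s_def by simp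
    then show ?thesis using e ex less_Suc_eq by auto
  next
    case False
    define c where "c = sqrt (\<beta> r r)"
    have c: "c > 0" "c * c = \<beta> r r"
      using False form_nonneg[OF rV] by (auto simp: c_def)
    define e' where "e' = e(m := (\<lambda>x. (1 / c) *\<^sub>R r x))"
    have e'V: "e' i \<in> V" if "i < Suc m" for i
      using that eV V_scale[OF rV] by (auto simp: e'_def less_Suc_eq)
    have \<beta>r: "\<beta> (e' m) h = \<beta> r h / c" if "h \<in> V" for h
      using form_scale[OF rV that, of "1 / c"] by (simp add: e'_def)
    have \<beta>r': "\<beta> h (e' m) = \<beta> h r / c" if "h \<in> V" for h
      using \<beta>r[OF that] form_sym[OF that rV] form_sym[OF that e'V[of m]] by simp
    have "orthonormal (Suc m) e'"
      unfolding orthonormal_def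
    proof (intro conjI allI impI e'V)
      fix i j assume ij: "i < Suc m" "j < Suc m"
      have lt: "e' l = e l" if "l < m" for l using that by (simp add: e'_def)
      consider "i < m" "j < m" | "i = m" "j < m" | "i < m" "j = m" | "i = m" "j = m"
        using ij by linarith
      then show "\<beta> (e' i) (e' j) = (if i = j then 1 else 0)"
      proof cases
        case 1 then show ?thesis using e lt by (simp add: orthonormal_def)
      next
        case 2 then show ?thesis using lt \<beta>r[OF eV] r_e by simp
      next
        case 3 then show ?thesis using lt \<beta>r'[OF eV] r_e form_sym[OF rV eV] by simp
      next
        case 4 then show ?thesis
          using \<beta>r[OF e'V[of m]] \<beta>r'[OF rV] c False by (simp add: field_simps)
      qed
    qed
    \<comment> \<open>The earlier generators are orthogonal to the new vector, so their expansions
      only gain a zero coefficient.\<close>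
    moreover have "expands (Suc m) e' (g i)" if i: "i < n" for i
    proof -
      have "\<beta> (g i) r = (\<Sum>j<m. \<beta> (g i) (e j) * \<beta> (e j) r)"
        using ex[OF i] form_sum[of m e r "\<lambda>j. \<beta> (g i) (e j)"] eV rV
        unfolding expands_def by metis
      also have "\<dots> = 0" using r_e form_sym[OF rV eV] by (intro sum.neutral) simp
      finally have "\<beta> (g i) (e' m) = 0" using \<beta>r'[of "g i"] gV i by simp
      then show ?thesis
        using ex[OF i] unfolding expands_def by (simp add: e'_def)
    qed
    moreover have "expands (Suc m) e' (g n)"
    proof -
      have "\<beta> s r = (\<Sum>j<m. \<beta> (g n) (e j) * \<beta> (e j) r)"
        unfolding s_def using eV rV by (intro form_sum) auto
      also have "\<dots> = 0" using r_e form_sym[OF rV eV] by (intro sum.neutral) simp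
      finally have "\<beta> (g n) r = \<beta> r r"
        using g_eq form_add[OF sV rV rV] by simp
      then have "\<beta> (g n) (e' m) = c"
        using \<beta>r'[of "g n"] gV[of n] c(1) c(2)[symmetric] by simp
      moreover have "(\<Sum>i<m. \<beta> (g n) (e' i) *\<^sub>R e' i x) = s x" for x
        unfolding s_def by (intro sum.cong) (auto simp: e'_def)
      moreover have "c *\<^sub>R e' m x = r x" for x
        using c(1) by (simp add: e'_def)
      ultimately have "(\<Sum>i<Suc m. \<beta> (g n) (e' i) *\<^sub>R e' i x) = g n x" for x
        by (simp add: r_def)
      then show ?thesis
        unfolding expands_def by (intro ext) (rule sym)
    qed
    ultimately show ?thesis using less_Suc_eq by blast
  qed
qed

lemma orthonormal_basis:
  obtains m e where "orthonormal m e" "\<And>q. q \<in> V \<Longrightarrow> expands m e q"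
proof -
  obtain g :: "nat \<Rightarrow> 'a \<Rightarrow> 'b" and n where gV: "\<And>i. i < n \<Longrightarrow> g i \<in> V"
    and gen: "\<And>q. q \<in> V \<Longrightarrow> \<exists>c. q = (\<lambda>x. \<Sum>i<n. c i *\<^sub>R g i x)"
    using generated by blast
  obtain m e where e: "orthonormal m e" and ex: "\<And>i. i < n \<Longrightarrow> expands m e (g i)"
    using gram_schmidt gV by blast
  have "expands m e q" if qV: "q \<in> V" for q
  proof -
    obtain c where q: "q = (\<lambda>x. \<Sum>i<n. c i *\<^sub>R g i x)" using gen[OF qV] by (elim exE)
    have c: "\<beta> q (e j) = (\<Sum>i<n. c i * \<beta> (g i) (e j))" if "j < m" for j
      unfolding q using gV e that by (intro form_sum) (auto simp: orthonormal_def)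
    have "(\<Sum>j<m. \<beta> q (e j) *\<^sub>R e j x) = q x" for x
    proof -
      have "(\<Sum>j<m. \<beta> q (e j) *\<^sub>R e j x) = (\<Sum>j<m. \<Sum>i<n. c i *\<^sub>R \<beta> (g i) (e j) *\<^sub>R e j x)"
        by (rule sum.cong) (simp_all add: c scaleR_sum_left)
      also have "\<dots> = (\<Sum>i<n. \<Sum>j<m. c i *\<^sub>R \<beta> (g i) (e j) *\<^sub>R e j x)"
        by (rule sum.swap)
      also have "\<dots> = (\<Sum>i<n. c i *\<^sub>R (\<Sum>j<m. \<beta> (g i) (e j) *\<^sub>R e j x))"
        by (simp only: scaleR_sum_right)
      also have "\<dots> = (\<Sum>i<n. c i *\<^sub>R g i x)"
      proof (rule sum.cong[OF refl])
        fix i assume "i \<in> {..<n}"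
        then have "expands m e (g i)" using ex by simp
        then have "g i x = (\<Sum>j<m. \<beta> (g i) (e j) *\<^sub>R e j x)"
          unfolding expands_def by (rule fun_cong)
        then show "c i *\<^sub>R (\<Sum>j<m. \<beta> (g i) (e j) *\<^sub>R e j x) = c i *\<^sub>R g i x"
          by (simp only:)
      qed
      finally show ?thesis unfolding q .
    qed
    then show ?thesis unfolding expands_def by (intro ext) (rule sym)
  qed
  with e that show ?thesis by blast
qed

lemma functional_expansion:
  assumes "orthonormal m e" "expands m e q" "q \<in> V"
    and "\<And>f g. f \<in> V \<Longrightarrow> g \<in> V \<Longrightarrow> l (\<lambda>x. f x + g x) = l f + l g"
    and "\<And>f c. f \<in> V \<Longrightarrow> l (\<lambda>x. c *\<^sub>R f x) = c * l f"
  shows "(l q :: real) = (\<Sum>i<m. \<beta> q (e i) * l (e i))"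
proof -
  have "l (\<lambda>x. \<Sum>i<m. \<beta> q (e i) *\<^sub>R e i x) = (\<Sum>i<m. \<beta> q (e i) * l (e i))"
    using linear_functional_sum[of l m e "\<lambda>i. \<beta> q (e i)"] assms(1,4,5) by (auto simp: orthonormal_def)
  with assms(2) show ?thesis unfolding expands_def by metis
qed

text \<open>The representer has the values of \<open>l\<close> on an orthonormal basis as
  coefficients; the difference of two representers is orthogonal to itself. This gives meaning to
  the definite descriptions in \<open>weak_hess\<close>, \<open>weak_grad\<close> and
  \<open>L2_proj\<close>.\<close>

lemma riesz:
  assumes "\<And>f g. f \<in> V \<Longrightarrow> g \<in> V \<Longrightarrow> l (\<lambda>x. f x + g x) = l f + l g"
    and "\<And>f c. f \<in> V \<Longrightarrow> l (\<lambda>x. c *\<^sub>R f x) = c * l f"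
  shows "\<exists>!D. D \<in> V \<and> (\<forall>q\<in>V. \<beta> D q = l q)"
proof -
  obtain m e where e: "orthonormal m e" and ex: "\<And>q. q \<in> V \<Longrightarrow> expands m e q"
    using orthonormal_basis by blast
  have eV: "e i \<in> V" if "i < m" for i using e that by (auto simp: orthonormal_def)
  define D where "D = (\<lambda>x. \<Sum>i<m. l (e i) *\<^sub>R e i x)"
  have DV: "D \<in> V" unfolding D_def by (intro V_sum eV)
  have D: "\<beta> D q = l q" if q: "q \<in> V" for q
  proof -
    have "\<beta> D q = (\<Sum>i<m. l (e i) * \<beta> (e i) q)"
      unfolding D_def using q by (intro form_sum eV)
    also have "\<dots> = (\<Sum>i<m. \<beta> q (e i) * l (e i))"
      using form_sym[OF q eV] by (intro sum.cong) auto
    also have "\<dots> = l q"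
      using functional_expansion[OF e ex[OF q] q] assms by simp
    finally show ?thesis .
  qed
  have "D' = D" if D'V: "D' \<in> V" and D': "\<forall>q\<in>V. \<beta> D' q = l q" for D'
  proof -
    define d where "d = (\<lambda>x. D' x + (- 1) *\<^sub>R D x)"
    have dV: "d \<in> V" unfolding d_def by (intro V_add V_scale DV D'V)
    have "\<beta> d d = \<beta> D' d + (- 1) * \<beta> D d"
      using form_add[OF D'V V_scale[OF DV] dV, of "- 1"] form_scale[OF DV dV, of "- 1"]
      by (simp add: d_def)
    also have "\<dots> = 0" using D D' dV by simp
    finally have "d = (\<lambda>x. 0)" using form_definite dV by blast
    then show ?thesis by (auto simp: d_def fun_eq_iff)
  qed
  then show ?thesis using DV D by blast
qed

text \<open>Cauchy-Schwarz for the coefficients, combined with Parseval's identity. For point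
  evaluation the last factor is the Christoffel function, the source of the constants in the inverse
  inequalities.\<close>

lemma functional_bound:
  assumes "orthonormal m e" "expands m e q" "q \<in> V"
    and "\<And>f g. f \<in> V \<Longrightarrow> g \<in> V \<Longrightarrow> l (\<lambda>x. f x + g x) = l f + l g"
    and "\<And>f c. f \<in> V \<Longrightarrow> l (\<lambda>x. c *\<^sub>R f x) = c * l f"
  shows "(l q)\<^sup>2 \<le> \<beta> q q * (\<Sum>i<m. (l (e i))\<^sup>2)"
proof -
  have eV: "e i \<in> V" if "i < m" for i using assms(1) that by (auto simp: orthonormal_def)
  have "\<beta> q q = (\<Sum>i<m. \<beta> q (e i) * \<beta> (e i) q)"
  proof (rule functional_expansion[of m e q "\<lambda>f. \<beta> f q", OF assms(1-3)])
    show "\<beta> (\<lambda>x. f x + g x) q = \<beta> f q + \<beta> g q" if "f \<in> V" "g \<in> V" for f g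
      using form_add[OF that assms(3)] .
    show "\<beta> (\<lambda>x. c *\<^sub>R f x) q = c * \<beta> f q" if "f \<in> V" for f c
      using form_scale[OF that assms(3)] .
  qed
  also have "\<dots> = (\<Sum>i<m. (\<beta> q (e i))\<^sup>2)"
    using form_sym[OF assms(3) eV] by (intro sum.cong) (auto simp: power2_eq_square)
  finally have qq: "\<beta> q q = (\<Sum>i<m. (\<beta> q (e i))\<^sup>2)" .
  show ?thesis
    using Cauchy_Schwarz_ineq_sum[of "\<lambda>i. \<beta> q (e i)" "\<lambda>i. l (e i)" "{..<m}"]
    by (simp only: qq functional_expansion[of m e q l, OF assms])
qed

end

section \<open>The inner products on cells and edges\<close>

lemma set_integrable_compact:
  fixes g :: "point \<Rightarrow> real"
  assumes "compact T" "continuous_on T g"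
  shows "set_integrable lebesgue T g"
  using borel_integrable_compact[OF assms] unfolding set_integrable_def
  by (simp add: integrable_completion borel_measurable_integrable)

lemma ip_sym: "ip T v w = ip T w v"
  by (simp add: ip_def inner_commute)

lemma ip_add_left:
  assumes "compact T" "continuous_on T u" "continuous_on T v" "continuous_on T w"
  shows "ip T (\<lambda>x. u x + v x) w = ip T u w + ip T v w"
  unfolding ip_def inner_add_left using assms
  by (intro set_integral_add set_integrable_compact continuous_intros)

lemma ip_scale_left: "ip T (\<lambda>x. c *\<^sub>R v x) w = c * ip T v w"
  by (simp add: ip_def)

lemma ip_zero_left [simp]: "ip T (\<lambda>x. 0) w = 0"
  by (simp add: ip_def)

lemma ip_zero_right [simp]: "ip T w (\<lambda>x. 0) = 0"
  by (simp add: ip_def)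

lemma ip_self_nonneg: "0 \<le> ip T v v"
  unfolding ip_def set_lebesgue_integral_def by (intro integral_nonneg_AE) auto

lemma ip_self_mono:
  assumes "compact T" "continuous_on T v" "S \<subseteq> T"
  shows "ip S v v \<le> ip T v v"
proof -
  have "set_integrable lebesgue T (\<lambda>x. v x \<bullet> v x)"
    using assms by (intro set_integrable_compact continuous_intros)
  then show ?thesis
    unfolding ip_def set_lebesgue_integral_def set_integrable_def
    by (rule integral_mono_AE') (use assms(3) in \<open>auto simp: indicator_def\<close>)
qed

text \<open>A continuous nonnegative function with integral zero vanishes on a box inside
  \<open>T\<close>, and a polynomial that vanishes on an open box is zero everywhere.\<close>

lemma ip_definite:
  assumes "compact T" "interior T \<noteq> {}" "q \<in> FPol k" "ip T q q = 0"
  shows "q = (\<lambda>x. 0)"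
proof -
  obtain x0 where "x0 \<in> interior T" using assms(2) by auto
  then obtain a b where ab: "x0 \<in> box a b" "cbox a b \<subseteq> interior T"
    by (meson open_contains_cbox open_interior)
  have cont: "continuous_on S (\<lambda>x. q x \<bullet> q x)" for S
    by (intro continuous_intros continuous_on_FPol[OF assms(3)])
  have "ip (cbox a b) q q \<le> ip T q q"
    using ab interior_subset by (intro ip_self_mono assms(1) continuous_on_FPol[OF assms(3)]) auto
  then have "ip (cbox a b) q q = 0"
    using assms(4) ip_self_nonneg by (metis order_antisym)
  moreover have int: "set_integrable lebesgue (cbox a b) (\<lambda>x. q x \<bullet> q x)"
    by (intro set_integrable_compact cont) simp
  ultimately have "((\<lambda>x. q x \<bullet> q x) has_integral 0) (cbox a b)"
    unfolding ip_def by (metis has_integral_set_lebesgue)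
  then have "q x \<bullet> q x = 0" if "x \<in> cbox a b" for x
    using has_integral_0_cbox_imp_0[OF cont, of a b x] ab that by auto
  then have q0: "q x = 0" if "x \<in> box a b" for x
    using that by (metis box_subset_cbox inner_eq_zero_iff subsetD)
  have "(\<lambda>x. q x \<bullet> b') = (\<lambda>x. 0)" if "b' \<in> Basis" for b'
  proof (rule Pol_eq_0_if_eq_0_on_open[OF _ open_box ab(1)])
    show "(\<lambda>x. q x \<bullet> b') \<in> Pol k" using assms(3) that by (auto simp: FPol_def)
    show "q x \<bullet> b' = 0" if "x \<in> box a b" for x using q0[OF that] by simp
  qed
  then have *: "q x \<bullet> b' = 0" if "b' \<in> Basis" for b' x
    using that by meson
  show ?thesis
  proof
    fix x
    show "q x = 0" by (rule euclidean_eqI) (simp add: *)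
  qed
qed

lemma form_space_FPol:
  assumes "compact T" "interior T \<noteq> {}"
  shows "form_space (FPol k :: (point \<Rightarrow> 'b::euclidean_space) set) (ip T)"
proof
  show "\<exists>(g :: nat \<Rightarrow> point \<Rightarrow> 'b) n. (\<forall>i<n. g i \<in> FPol k) \<and>
          (\<forall>q\<in>FPol k. \<exists>c. q = (\<lambda>x. \<Sum>i<n. c i *\<^sub>R g i x))"
    by (rule FPol_generated) blast
qed (auto intro: FPol_zero FPol_add FPol_scale ip_sym ip_add_left ip_scale_left ip_self_nonneg
      ip_definite[OF assms] assms(1) continuous_on_FPol)

section \<open>Inner products along edges\<close>

abbreviation edge_param :: "edge \<Rightarrow> real \<Rightarrow> point" where
  "edge_param e \<equiv> linepath (fst e) (snd e)"

text \<open>Continuity is demanded of the pullback to the unit interval because a member of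
  \<open>Pol_edge\<close> is prescribed on the segment alone and arbitrary off it.\<close>

definition edge_cont :: "edge \<Rightarrow> (point \<Rightarrow> 'b::real_normed_vector) \<Rightarrow> bool" where
  "edge_cont e g \<longleftrightarrow> continuous_on {0..1} (\<lambda>t. g (edge_param e t))"

lemma edge_cont_add: "edge_cont e v \<Longrightarrow> edge_cont e w \<Longrightarrow> edge_cont e (\<lambda>x. v x + w x)"
  and edge_cont_diff: "edge_cont e v \<Longrightarrow> edge_cont e w \<Longrightarrow> edge_cont e (\<lambda>x. v x - w x)"
  and edge_cont_scale: "edge_cont e v \<Longrightarrow> edge_cont e (\<lambda>x. c *\<^sub>R v x)"
  unfolding edge_cont_def by (auto intro!: continuous_intros)

lemma edge_cont_inner: "edge_cont e v \<Longrightarrow> edge_cont e w \<Longrightarrow> edge_cont e (\<lambda>x. v x \<bullet> w x)"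
  unfolding edge_cont_def by (auto intro!: continuous_intros)

lemma edge_cont_Pol_edge: "g \<in> Pol_edge k e \<Longrightarrow> edge_cont e g"
  unfolding edge_cont_def by (rule continuous_on_Pol_edge)

lemma edge_cont_continuous: 
  assumes "continuous_on UNIV v"
  shows "edge_cont e v"
  unfolding edge_cont_def
  by (rule continuous_on_compose2[OF assms]) (auto intro!: continuous_intros)

lemma edge_cont_components:
  fixes v :: "point \<Rightarrow> real^'n"
  assumes "\<And>i. edge_cont e (\<lambda>x. v x $ i)"
  shows "edge_cont e v"
  using continuous_on_vec_lambda[of "{0..1}" "\<lambda>i t. v (edge_param e t) $ i"] assms
  unfolding edge_cont_def vec_nth_inverse by simp

lemma edge_ip_sym: "edge_ip e v w = edge_ip e w v"
  by (simp add: edge_ip_def inner_commute)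

lemma len_nonneg: "0 \<le> len e"
  by (simp add: len_def)

lemma edge_integrable:
  fixes g :: scalar_field
  assumes "edge_cont e g"
  shows "set_integrable lebesgue {0..1} (\<lambda>t. g (edge_param e t))"
  using assms unfolding edge_cont_def by (rule absolutely_integrable_continuous_real)

lemma edge_ip_add_left:
  assumes "edge_cont e u" "edge_cont e v" "edge_cont e w"
  shows "edge_ip e (\<lambda>x. u x + v x) w = edge_ip e u w + edge_ip e v w"
proof -
  have "(LINT t:{0..1}|lebesgue. u (edge_param e t) \<bullet> w (edge_param e t) + v (edge_param e t) \<bullet> w (edge_param e t))
      = (LINT t:{0..1}|lebesgue. u (edge_param e t) \<bullet> w (edge_param e t))
        + (LINT t:{0..1}|lebesgue. v (edge_param e t) \<bullet> w (edge_param e t))"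
    using edge_integrable[OF edge_cont_inner[OF assms(1,3)]]
      edge_integrable[OF edge_cont_inner[OF assms(2,3)]] by (rule set_integral_add)
  then show ?thesis
    by (simp add: edge_ip_def inner_add_left distrib_left)
qed

lemma edge_ip_scale_left: "edge_ip e (\<lambda>x. c *\<^sub>R v x) w = c * edge_ip e v w"
  by (simp add: edge_ip_def)

lemma edge_ip_zero [simp]: "edge_ip e (\<lambda>x. 0) w = 0" "edge_ip e w (\<lambda>x. 0) = 0"
  by (simp_all add: edge_ip_def)

lemma edge_ip_self_nonneg: "0 \<le> edge_ip e v v"
  unfolding edge_ip_def set_lebesgue_integral_def
  by (intro mult_nonneg_nonneg len_nonneg integral_nonneg_AE) auto

text \<open>Expand the square of the norm of \<open>l v - w\<close>, which is nonnegative.\<close>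

lemma edge_ip_young:
  assumes "edge_cont e v" "edge_cont e w" "0 < l"
  shows "edge_ip e v w \<le> l / 2 * edge_ip e v v + 1 / (2 * l) * edge_ip e w w"
proof -
  define u where "u = (\<lambda>x. l *\<^sub>R v x + (- 1) *\<^sub>R w x)"
  have c: "edge_cont e (\<lambda>x. l *\<^sub>R v x)" "edge_cont e (\<lambda>x. (- 1) *\<^sub>R w x)"
    using assms by (auto intro!: edge_cont_scale[of _ _ "- 1", simplified] edge_cont_scale)
  then have cu: "edge_cont e u" unfolding u_def by (rule edge_cont_add)
  have 1: "edge_ip e u z = l * edge_ip e v z - edge_ip e w z" if "edge_cont e z" for z
    unfolding u_def edge_ip_add_left[OF c that] edge_ip_scale_left by simp
  have "0 \<le> edge_ip e u u" by (rule edge_ip_self_nonneg)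
  also have "edge_ip e u u = l * edge_ip e u v - edge_ip e u w"
    using 1[OF cu] by (simp add: edge_ip_sym)
  also have "\<dots> = l\<^sup>2 * edge_ip e v v - 2 * l * edge_ip e v w + edge_ip e w w"
    unfolding edge_ip_sym[of e u v] edge_ip_sym[of e u w]
    using 1[OF assms(1)] 1[OF assms(2)] edge_ip_sym[of e w v] edge_ip_sym[of e u v] edge_ip_sym[of e u w]
    by (simp add: right_diff_distrib power2_eq_square)
  finally have "2 * l * edge_ip e v w \<le> l\<^sup>2 * edge_ip e v v + edge_ip e w w" by simp
  then show ?thesis using \<open>0 < l\<close> by (simp add: field_simps power2_eq_square)
qed

lemma edge_ip_self_le:
  assumes "edge_cont e v" "\<And>x. x \<in> seg e \<Longrightarrow> v x \<bullet> v x \<le> B"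
  shows "edge_ip e v v \<le> len e * B"
proof -
  have "(LINT t:{0..1}|lebesgue. v (edge_param e t) \<bullet> v (edge_param e t)) \<le> (LINT t:{0..1::real}|lebesgue. B)"
    (is "_ \<le> ?R")
    using assms(2) edge_integrable[OF edge_cont_inner[OF assms(1,1)]]
    by (intro set_integral_mono) (auto simp: seg_def linepath_in_path)
  also have "?R = B" by (simp add: set_lebesgue_integral_def)
  finally show ?thesis
    unfolding edge_ip_def by (intro mult_left_mono len_nonneg)
qed

section \<open>Divergence of polynomial fields\<close>

lemma dvg_add:
  assumes "p \<in> vPol k" "q \<in> vPol k"
  shows "dvg (\<lambda>x. p x + q x) = (\<lambda>x. dvg p x + dvg q x)"
proof
  fix x
  have "pd i (\<lambda>y. p y $ i + q y $ i) x = pd i (\<lambda>y. p y $ i) x + pd i (\<lambda>y. q y $ i) x" for i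
    using assms by (intro pd_add differentiable_Pol[of _ k]) (auto simp: vPol_def)
  then show "dvg (\<lambda>x. p x + q x) x = dvg p x + dvg q x"
    by (simp add: dvg_def sum.distrib)
qed

lemma dvg_scale:
  assumes "p \<in> vPol k"
  shows "dvg (\<lambda>x. c *\<^sub>R p x) = (\<lambda>x. c * dvg p x)"
proof
  fix x
  have "pd i (\<lambda>y. c * p y $ i) x = c * pd i (\<lambda>y. p y $ i) x" for i
    using assms by (intro pd_scale differentiable_Pol[of _ k]) (auto simp: vPol_def)
  then show "dvg (\<lambda>x. c *\<^sub>R p x) x = c * dvg p x"
    by (simp add: dvg_def sum_distrib_left)
qed

lemma dvg_Pol: "q \<in> vPol k \<Longrightarrow> dvg q \<in> Pol k"
  unfolding dvg_def[abs_def] by (intro Pol_sum Pol_pd) (auto simp: vPol_def)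

lemma mPol_row: "\<phi> \<in> mPol k \<Longrightarrow> (\<lambda>x. \<phi> x $ i) \<in> vPol k"
  by (auto simp: vPol_def mPol_def)

lemma mdvg_add:
  assumes "\<phi> \<in> mPol k" "\<psi> \<in> mPol k"
  shows "mdvg (\<lambda>x. \<phi> x + \<psi> x) = (\<lambda>x. mdvg \<phi> x + mdvg \<psi> x)"
  using dvg_add[OF mPol_row mPol_row, OF assms] by (auto simp: mdvg_def vec_eq_iff fun_eq_iff)

lemma mdvg_scale:
  assumes "\<phi> \<in> mPol k"
  shows "mdvg (\<lambda>x. c *\<^sub>R \<phi> x) = (\<lambda>x. c *\<^sub>R mdvg \<phi> x)"
  using dvg_scale[OF mPol_row, OF assms] by (auto simp: mdvg_def vec_eq_iff fun_eq_iff)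

lemma mdvg_vPol: "\<phi> \<in> mPol k \<Longrightarrow> mdvg \<phi> \<in> vPol k"
  by (auto simp: mdvg_def[abs_def] vPol_def intro: dvg_Pol mPol_row)

lemma vPol_add: "p \<in> vPol k \<Longrightarrow> q \<in> vPol k \<Longrightarrow> (\<lambda>x. p x + q x) \<in> vPol k"
  and vPol_scale: "p \<in> vPol k \<Longrightarrow> (\<lambda>x. c *\<^sub>R p x) \<in> vPol k"
  unfolding vPol_eq_FPol by (rule FPol_add FPol_scale; assumption)+

lemma mPol_scale: "\<phi> \<in> mPol k \<Longrightarrow> (\<lambda>x. c *\<^sub>R \<phi> x) \<in> mPol k"
  unfolding mPol_eq_FPol by (rule FPol_scale)

lemma continuous_on_vPol: "q \<in> vPol k \<Longrightarrow> continuous_on S q"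
  unfolding vPol_eq_FPol by (rule continuous_on_FPol)

lemma grad_vPol: "p \<in> Pol k \<Longrightarrow> grad p \<in> vPol k"
  by (auto simp: grad_def[abs_def] vPol_def intro: Pol_pd)

lemma vPol_inner: "q \<in> vPol k \<Longrightarrow> (\<lambda>x. q x \<bullet> n) \<in> Pol k"
  unfolding inner_vec_def inner_real_def using Pol_scale
  by (subst mult.commute) (auto simp: vPol_def intro!: Pol_sum Pol_scale)

lemma mPol_mult_vec: "\<phi> \<in> mPol k \<Longrightarrow> (\<lambda>x. \<phi> x *v n) \<in> vPol k"
  unfolding vPol_def matrix_vector_mult_def
  by (auto simp: mPol_def mult.commute[of _ "n $ _"] intro!: Pol_sum Pol_scale)

section \<open>Triangles on the edges of a cell\<close>

text \<open>The determinant of the matrix with columns \<open>u\<close> and \<open>v\<close>, that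
  is, the signed area of their parallelogram; its sign tells on which side of the direction
  \<open>u\<close> the vector \<open>v\<close> lies.\<close>

definition cross2 :: "real^2 \<Rightarrow> real^2 \<Rightarrow> real" where
  "cross2 u v = u $ 1 * v $ 2 - u $ 2 * v $ 1"

lemma cross2_simps:
  "cross2 (u + v) w = cross2 u w + cross2 v w" "cross2 w (u + v) = cross2 w u + cross2 w v"
  "cross2 (u - v) w = cross2 u w - cross2 v w" "cross2 w (u - v) = cross2 w u - cross2 w v"
  "cross2 (c *\<^sub>R u) v = c * cross2 u v" "cross2 u (c *\<^sub>R v) = c * cross2 u v"
  "cross2 u u = 0" "cross2 0 u = 0" "cross2 u 0 = 0"
  by (simp_all add: cross2_def algebra_simps)

text \<open>Cramer's rule for the coordinates of \<open>x\<close> in the basis formed by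
  \<open>d\<close> and \<open>w\<close>.\<close>

lemma cross2_coords:
  assumes "cross2 d w \<noteq> 0"
  shows "x = (cross2 x w / cross2 d w) *\<^sub>R d + (cross2 d x / cross2 d w) *\<^sub>R w"
proof -
  have "cross2 d w *\<^sub>R x = cross2 x w *\<^sub>R d + cross2 d x *\<^sub>R w"
    by (simp add: vec_eq_iff forall_2 cross2_def algebra_simps)
  then have "x = (1 / cross2 d w) *\<^sub>R (cross2 x w *\<^sub>R d + cross2 d x *\<^sub>R w)"
    using assms by (metis (no_types) divide_self_if scaleR_one scaleR_scaleR times_divide_eq_left mult_1)
  then show ?thesis by (simp add: scaleR_add_right)
qed

lemma continuous_on_cross2:
  "continuous_on S f \<Longrightarrow> continuous_on S g \<Longrightarrow> continuous_on S (\<lambda>x. cross2 (f x) (g x))"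
  unfolding cross2_def by (intro continuous_intros)

lemma norm_real2: "norm (u :: real^2) ^ 2 = (u $ 1)\<^sup>2 + (u $ 2)\<^sup>2"
  by (simp add: norm_eq_sqrt_inner inner_vec_def sum_2 power2_eq_square)

text \<open>Base times height is the area of the parallelogram, and the foot of the perpendicular is
  one point of the line, so its distance bounds the infimum.\<close>

lemma infdist_line_le_cross2:
  assumes "a \<noteq> (b :: point)"
  shows "norm (b - a) * infdist x (affine hull {a, b}) \<le> \<bar>cross2 (b - a) (x - a)\<bar>"
proof -
  define d w where "d = b - a" and "w = x - a"
  \<comment> \<open>The coefficient of the orthogonal projection of \<open>w\<close> onto
    \<open>d\<close>; what remains of \<open>w\<close> is a multiple of \<open>d\<close> turned by a
    right angle.\<close>
  define t where "t = (w \<bullet> d) / (norm d)\<^sup>2"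
  have "norm d > 0" using assms by (simp add: d_def)
  have *: "(norm d)\<^sup>2 *\<^sub>R (w - t *\<^sub>R d) = cross2 d w *\<^sub>R vector [- (d $ 2), d $ 1]"
  proof -
    have "(norm d)\<^sup>2 *\<^sub>R (w - t *\<^sub>R d) = (norm d)\<^sup>2 *\<^sub>R w - (w \<bullet> d) *\<^sub>R d"
      using \<open>norm d > 0\<close> by (simp add: scaleR_diff_right t_def)
    also have "\<dots> = cross2 d w *\<^sub>R vector [- (d $ 2), d $ 1]"
      unfolding norm_real2
      by (simp add: vec_eq_iff forall_2 cross2_def inner_vec_def sum_2 algebra_simps power2_eq_square)
    finally show ?thesis .
  qed
  have "norm (vector [- (d $ 2), d $ 1] :: real^2) ^ 2 = norm d ^ 2"
    unfolding norm_real2 by simp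
  then have "norm (vector [- (d $ 2), d $ 1] :: real^2) = norm d"
    by (simp add: power2_eq_iff_nonneg)
  with arg_cong[OF *, of norm] have "norm d * (norm d * norm (w - t *\<^sub>R d)) = norm d * \<bar>cross2 d w\<bar>"
    by (simp add: power2_eq_square mult.commute)
  then have "norm d * norm (w - t *\<^sub>R d) = \<bar>cross2 d w\<bar>"
    using \<open>norm d > 0\<close> by simp
  moreover have "infdist x (affine hull {a, b}) \<le> norm (w - t *\<^sub>R d)"
  proof -
    have "a + t *\<^sub>R d = (1 - t) *\<^sub>R a + t *\<^sub>R b"
      by (simp add: d_def algebra_simps)
    then have "a + t *\<^sub>R d \<in> affine hull {a, b}"
      unfolding affine_hull_2 by (intro CollectI exI[of _ "1 - t"] exI[of _ t]) simp
    from infdist_le[OF this, of x] show ?thesis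
      by (simp add: dist_norm w_def algebra_simps)
  qed
  ultimately show ?thesis
    using mult_left_mono[of _ _ "norm d"] \<open>norm d > 0\<close> unfolding d_def w_def by fastforce
qed

abbreviation edge_vec :: "edge \<Rightarrow> real^2" where
  "edge_vec e \<equiv> snd e - fst e"

text \<open>Shape regularity in the form in which it is used: the triangle over \<open>e\<close> is
  given by its affine parameters and lies in \<open>T\<close>, and twice its area is comparable to
  the square of the diameter.\<close>

definition apex :: "real \<Rightarrow> point set \<Rightarrow> edge \<Rightarrow> point \<Rightarrow> bool" where
  "apex \<rho> T e A \<longleftrightarrow> A \<in> T \<and>
     (\<forall>s t. 0 \<le> s \<longrightarrow> 0 \<le> t \<longrightarrow> s + t \<le> 1 \<longrightarrow> fst e + s *\<^sub>R edge_vec e + t *\<^sub>R (A - fst e) \<in> T) \<and>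
     (\<rho> * diameter T)\<^sup>2 \<le> \<bar>cross2 (edge_vec e) (A - fst e)\<bar>"

text \<open>Strict inequalities for the barycentric coordinates, which are continuous, cut out an
  open set inside the triangle.\<close>

lemma apex_interior:
  assumes A: "apex \<rho> T e A" and D: "cross2 (edge_vec e) (A - fst e) \<noteq> 0"
    and s: "0 < s" "0 < t" "s + t < 1"
  shows "fst e + s *\<^sub>R edge_vec e + t *\<^sub>R (A - fst e) \<in> interior T"
proof -
  define d w D where "d = edge_vec e" and "w = A - fst e" and "D = cross2 d w"
  have D0: "D \<noteq> 0" using D by (simp add: D_def d_def w_def)
  let ?s = "\<lambda>x. cross2 (x - fst e) w / D" and ?t = "\<lambda>x. cross2 d (x - fst e) / D"
  define U where "U = {x. 0 < ?s x} \<inter> {x. 0 < ?t x} \<inter> {x. ?s x + ?t x < 1}"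
  have "open U"
    unfolding U_def
    by (intro open_Int open_Collect_less continuous_on_add continuous_on_divide continuous_on_cross2
        continuous_on_diff continuous_on_id continuous_on_const ballI D0)
  moreover have "U \<subseteq> T"
  proof
    fix x assume "x \<in> U"
    then have "fst e + ?s x *\<^sub>R d + ?t x *\<^sub>R w \<in> T"
      using A unfolding U_def apex_def d_def w_def by auto
    moreover have "x - fst e = ?s x *\<^sub>R d + ?t x *\<^sub>R w"
      using cross2_coords[of d w "x - fst e"] D0 by (simp add: D_def)
    ultimately show "x \<in> T" by (simp add: algebra_simps)
  qed
  moreover have "fst e + s *\<^sub>R d + t *\<^sub>R w \<in> U"
  proof -
    have "cross2 (s *\<^sub>R d + t *\<^sub>R w) w = s * D" "cross2 d (s *\<^sub>R d + t *\<^sub>R w) = t * D"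
      by (simp_all add: cross2_simps D_def)
    then show ?thesis using s D0 by (simp add: U_def add.assoc)
  qed
  ultimately show ?thesis
    unfolding d_def w_def by (intro interiorI)
qed

section \<open>Cells of a shape regular mesh\<close>

text \<open>The polygon together with its inside is the complement of the open outside, hence
  closed, and the frontier of the inside of a closed set lies in that set.\<close>

lemma polygonal_cellD:
  assumes "polygonal_cell M T"
  shows "closed T" "frontier T \<subseteq> \<Union>(seg ` edges_of M T)" "\<exists>x\<in>T. \<exists>y\<in>T. x \<noteq> y"
    "edges_of M T \<noteq> {}"
proof -
  obtain vs :: "point list" where vs: "3 \<le> length vs" "distinct vs"
    and E: "seg ` edges_of M T = (\<lambda>i. seg (vs ! i, vs ! (Suc i mod length vs))) ` {..<length vs}"
    and T: "T = (\<Union>i<length vs. seg (vs ! i, vs ! (Suc i mod length vs))) \<union>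
              inside (\<Union>i<length vs. seg (vs ! i, vs ! (Suc i mod length vs)))"
    using assms unfolding polygonal_cell_def Let_def by blast
  define P where "P = (\<Union>i<length vs. seg (vs ! i, vs ! (Suc i mod length vs)))"
  have P: "P = \<Union>(seg ` edges_of M T)" unfolding P_def E ..
  have "closed P" unfolding P_def seg_def by (intro closed_UN) auto
  then show "closed T"
    unfolding T P_def[symmetric] union_with_inside by (simp add: closed_Compl open_outside)
  have "frontier T \<subseteq> frontier P \<union> frontier (inside P)"
    unfolding T P_def[symmetric] by (rule frontier_Un_subset)
  also have "\<dots> \<subseteq> P"
    using frontier_inside_subset \<open>closed P\<close> frontier_subset_closed by blast
  finally show "frontier T \<subseteq> \<Union>(seg ` edges_of M T)" unfolding P .
  have v: "vs ! i \<in> T" if "i < length vs" for i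
    unfolding T using that by (auto simp: seg_def intro!: bexI[of _ i])
  then show "\<exists>x\<in>T. \<exists>y\<in>T. x \<noteq> y"
  proof -
    have l: "0 < length vs" "1 < length vs" using vs(1) by linarith+
    with nth_eq_iff_index_eq[OF vs(2) l] v[OF l(1)] v[OF l(2)] show ?thesis
      by (metis zero_neq_one)
  qed
  have "0 < length vs" using vs(1) by linarith
  then have "seg (vs ! 0, vs ! (Suc 0 mod length vs)) \<in> seg ` edges_of M T"
    unfolding E by (intro imageI) simp
  then show "edges_of M T \<noteq> {}" by blast
qed

locale regular_mesh =
  fixes \<Omega> :: "point set" and M :: poly_mesh and \<rho> :: real
  assumes open_domain: "open \<Omega>" and bounded_domain: "bounded \<Omega>"
    and mesh: "polygonal_mesh \<Omega> M" and regular: "shape_regular \<rho> M" and \<rho>_pos: "0 < \<rho>"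
begin

lemma finite_cells [simp]: "finite (cells M)" and finite_edges [simp]: "finite (edges M)"
  using mesh by (auto simp: polygonal_mesh_def)

lemma finite_edges_of [simp]: "finite (edges_of M T)"
  by (simp add: edges_of_def)

lemma edges_of_subset: "e \<in> edges_of M T \<Longrightarrow> e \<in> edges M"
  by (simp add: edges_of_def)

lemma cell_polygonal: "T \<in> cells M \<Longrightarrow> polygonal_cell M T"
  using mesh by (auto simp: polygonal_mesh_def)

lemma compact_cell:
  assumes "T \<in> cells M"
  shows "compact T"
proof -
  have "T \<subseteq> closure \<Omega>" using mesh assms by (auto simp: polygonal_mesh_def)
  then have "bounded T" using bounded_domain bounded_closure bounded_subset by blast
  then show ?thesis using polygonal_cellD(1)[OF cell_polygonal[OF assms]] compact_eq_bounded_closed by blast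
qed

lemma diameter_pos:
  assumes "T \<in> cells M"
  shows "0 < diameter T"
proof -
  obtain x y where "x \<in> T" "y \<in> T" "x \<noteq> y"
    using polygonal_cellD(3)[OF cell_polygonal[OF assms]] by blast
  then show ?thesis
    using diameter_bounded_bound[OF compact_imp_bounded[OF compact_cell[OF assms]], of x y]
    by (metis zero_less_dist_iff order_less_le_trans)
qed

lemma seg_subset_cell:
  assumes "T \<in> cells M" "e \<in> edges_of M T"
  shows "seg e \<subseteq> T"
  using assms frontier_subset_closed polygonal_cellD(1)[OF cell_polygonal] by (auto simp: edges_of_def)

lemma dist_le_diameter:
  "T \<in> cells M \<Longrightarrow> x \<in> T \<Longrightarrow> y \<in> T \<Longrightarrow> norm (x - y) \<le> diameter T"
  using diameter_bounded_bound[OF compact_imp_bounded[OF compact_cell]] by (simp add: dist_norm)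

lemma ends_in_cell:
  assumes "T \<in> cells M" "e \<in> edges_of M T"
  shows "fst e \<in> T" "snd e \<in> T"
  using seg_subset_cell[OF assms] by (auto simp: seg_def)

lemma len_le_diameter: "T \<in> cells M \<Longrightarrow> e \<in> edges_of M T \<Longrightarrow> len e \<le> diameter T"
  using dist_le_diameter ends_in_cell by (simp add: len_def dist_norm)

lemma len_ge_diameter: "T \<in> cells M \<Longrightarrow> e \<in> edges_of M T \<Longrightarrow> \<rho> * diameter T \<le> len e"
  using regular by (simp add: shape_regular_def)

lemma len_pos: "T \<in> cells M \<Longrightarrow> e \<in> edges_of M T \<Longrightarrow> 0 < len e"
  using len_ge_diameter[of T e] diameter_pos[of T] \<rho>_pos by (meson mult_pos_pos order_less_le_trans)

text \<open>Both halves of shape regularity enter: edge length and height are each at least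
  \<open>\<rho> * diameter T\<close>, and their product bounds the doubled area.\<close>

lemma apex_exists:
  assumes T: "T \<in> cells M" and e: "e \<in> edges_of M T"
  obtains A where "apex \<rho> T e A"
proof -
  obtain A where A: "A \<in> T" "convex hull (insert A (seg e)) \<subseteq> T"
    "\<rho> * diameter T \<le> infdist A (affine hull (seg e))"
    using regular T e unfolding shape_regular_def by blast
  have ne: "fst e \<noteq> snd e" using len_pos[OF T e] by (auto simp: len_def)
  have "affine hull (seg e) = affine hull {fst e, snd e}"
    by (simp add: seg_def segment_convex_hull affine_hull_convex_hull)
  then have "(\<rho> * diameter T) * (\<rho> * diameter T) \<le> norm (edge_vec e) * infdist A (affine hull {fst e, snd e})"
    using A(3) len_ge_diameter[OF T e] diameter_pos[OF T] \<rho>_pos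
    by (intro mult_mono) (auto simp: len_def dist_norm norm_minus_commute)
  also have "\<dots> \<le> \<bar>cross2 (edge_vec e) (A - fst e)\<bar>"
    by (rule infdist_line_le_cross2[OF ne])
  finally have D: "(\<rho> * diameter T)\<^sup>2 \<le> \<bar>cross2 (edge_vec e) (A - fst e)\<bar>"
    by (simp add: power2_eq_square)
  have "fst e + s *\<^sub>R edge_vec e + t *\<^sub>R (A - fst e) \<in> T" if st: "0 \<le> s" "0 \<le> t" "s + t \<le> 1" for s t
  proof -
    have "fst e + s *\<^sub>R edge_vec e + t *\<^sub>R (A - fst e) = t *\<^sub>R A + (1 - s - t) *\<^sub>R fst e + s *\<^sub>R snd e"
      by (simp add: algebra_simps)
    also have "\<dots> \<in> convex hull {A, fst e, snd e}"
      unfolding convex_hull_3 using st by fastforce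
    also have "\<dots> \<subseteq> convex hull (insert A (seg e))"
      by (intro hull_mono) (auto simp: seg_def)
    finally show ?thesis using A(2) by blast
  qed
  with A(1) D that show ?thesis unfolding apex_def by blast
qed

lemma apex_cross2: 
  assumes "T \<in> cells M" "apex \<rho> T e A"
  shows "cross2 (edge_vec e) (A - fst e) \<noteq> 0"
  using assms diameter_pos[OF assms(1)] \<rho>_pos unfolding apex_def
  by (metis abs_zero mult_pos_pos not_le zero_less_power)

lemma interior_cell_nonempty:
  assumes "T \<in> cells M"
  shows "interior T \<noteq> {}"
proof -
  obtain e where e: "e \<in> edges_of M T"
    using polygonal_cellD(4)[OF cell_polygonal[OF assms]] by blast
  obtain A where A: "apex \<rho> T e A" using apex_exists[OF assms e] .
  show ?thesis
    using apex_interior[OF A apex_cross2[OF assms A], of "1/3" "1/3"] by auto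
qed

lemma form_space_cell:
  "T \<in> cells M \<Longrightarrow> form_space (FPol k :: (point \<Rightarrow> 'b::euclidean_space) set) (ip T)"
  by (intro form_space_FPol compact_cell interior_cell_nonempty)

section \<open>Well-definedness of the weak operators\<close>

lemma Vh_edge_cont:
  assumes "v \<in> Vh k M" "e \<in> edges M"
  shows "edge_cont e (vb v e)" "edge_cont e (vg v e)"
  using assms by (auto simp: Vh_def intro: edge_cont_Pol_edge intro!: edge_cont_components)

lemma edge_cont_vPol: "q \<in> vPol k \<Longrightarrow> edge_cont e q"
  by (intro edge_cont_continuous continuous_on_vPol)

lemma edge_cont_Pol: "q \<in> Pol k \<Longrightarrow> edge_cont e q"
  by (intro edge_cont_continuous continuous_on_Pol)

lemma bdry_ip_add_right:
  assumes "\<And>e. e \<in> edges_of M T \<Longrightarrow> edge_cont e (v e)"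
    "\<And>e. e \<in> edges_of M T \<Longrightarrow> edge_cont e (w e)" "\<And>e. e \<in> edges_of M T \<Longrightarrow> edge_cont e (z e)"
  shows "bdry_ip M T v (\<lambda>e x. w e x + z e x) = bdry_ip M T v w + bdry_ip M T v z"
proof -
  have "edge_ip e (v e) (\<lambda>x. w e x + z e x) = edge_ip e (v e) (w e) + edge_ip e (v e) (z e)"
    if "e \<in> edges_of M T" for e
    using edge_ip_add_left[of e "w e" "z e" "v e"] assms that by (simp add: edge_ip_sym)
  then show ?thesis by (simp add: bdry_ip_def sum.distrib)
qed

lemma bdry_ip_scale_right: "bdry_ip M T v (\<lambda>e x. c *\<^sub>R w e x) = c * bdry_ip M T v w"
  by (simp add: bdry_ip_def sum_distrib_left edge_ip_def mult.left_commute)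

text \<open>The right-hand side of the defining identity is a linear functional of the test field.
  Its additivity rests on integrability of the boundary products, which the edge polynomials of a
  discrete triple provide.\<close>

lemma weak_hess:
  assumes v: "v \<in> Vh k M" and T: "T \<in> cells M"
  shows "weak_hess k M v T \<in> mPol k"
    and "\<phi> \<in> mPol k \<Longrightarrow> ip T (weak_hess k M v T) \<phi> = ip T (v0 v T) (dvg (mdvg \<phi>))
        - bdry_ip M T (vb v) (\<lambda>e x. mdvg \<phi> x \<bullet> outer_normal T e)
        + bdry_ip M T (vg v) (\<lambda>e x. \<phi> x *v outer_normal T e)"
proof -
  define l where "l = (\<lambda>\<phi>. ip T (v0 v T) (dvg (mdvg \<phi>))
        - bdry_ip M T (vb v) (\<lambda>e x. mdvg \<phi> x \<bullet> outer_normal T e)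
        + bdry_ip M T (vg v) (\<lambda>e x. \<phi> x *v outer_normal T e))"
  have c: "edge_cont e (vb v e)" "edge_cont e (vg v e)" if "e \<in> edges_of M T" for e
    using Vh_edge_cont[OF v edges_of_subset[OF that]] .
  have v0: "continuous_on T (v0 v T)" 
    using v T by (auto simp: Vh_def intro: continuous_on_Pol)
  have c1: "edge_cont e (\<lambda>x. mdvg \<phi> x \<bullet> outer_normal T e)" if "\<phi> \<in> mPol k" for \<phi> e
    by (intro edge_cont_Pol[of _ k] vPol_inner mdvg_vPol that)
  have c2: "edge_cont e (\<lambda>x. \<phi> x *v outer_normal T e)" if "\<phi> \<in> mPol k" for \<phi> e
    by (intro edge_cont_vPol[of _ k] mPol_mult_vec that)
  have "\<exists>!D. D \<in> mPol k \<and> (\<forall>\<phi>\<in>mPol k. ip T D \<phi> = l \<phi>)"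
    unfolding mPol_eq_FPol
  proof (rule form_space.riesz[OF form_space_cell[OF T]]; unfold mPol_eq_FPol[symmetric])
    fix \<phi> \<psi> assume *: "\<phi> \<in> mPol k" "\<psi> \<in> mPol k"
    have "ip T (v0 v T) (\<lambda>x. dvg (mdvg \<phi>) x + dvg (mdvg \<psi>) x)
        = ip T (v0 v T) (dvg (mdvg \<phi>)) + ip T (v0 v T) (dvg (mdvg \<psi>))"
      unfolding ip_sym[of T "v0 v T"]
      by (intro ip_add_left compact_cell T v0 continuous_on_Pol[of _ k] dvg_Pol mdvg_vPol *)
    then show "l (\<lambda>x. \<phi> x + \<psi> x) = l \<phi> + l \<psi>"
      unfolding l_def mdvg_add[OF *] dvg_add[OF mdvg_vPol mdvg_vPol, OF *]
        inner_add_left matrix_vector_mult_add_rdistrib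
      using bdry_ip_add_right[of T "vb v", OF c(1) c1[OF *(1)] c1[OF *(2)]]
        bdry_ip_add_right[of T "vg v", OF c(2) c2[OF *(1)] c2[OF *(2)]] by simp
  next
    fix \<phi> c assume *: "\<phi> \<in> mPol k"
    show "l (\<lambda>x. c *\<^sub>R \<phi> x) = c * l \<phi>"
      unfolding l_def mdvg_scale[OF *] dvg_scale[OF mdvg_vPol, OF *]
        inner_scaleR_left scaleR_matrix_vector_assoc[symmetric]
      using bdry_ip_scale_right[of T "vb v" c] bdry_ip_scale_right[of T "vg v" c]
        ip_scale_left[of T c "dvg (mdvg \<phi>)" "v0 v T"]
      by (simp add: ip_sym[of T "v0 v T"] algebra_simps)
  qed
  from theI'[OF this, folded] show "weak_hess k M v T \<in> mPol k"
    and "\<phi> \<in> mPol k \<Longrightarrow> ip T (weak_hess k M v T) \<phi> = ip T (v0 v T) (dvg (mdvg \<phi>))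
        - bdry_ip M T (vb v) (\<lambda>e x. mdvg \<phi> x \<bullet> outer_normal T e)
        + bdry_ip M T (vg v) (\<lambda>e x. \<phi> x *v outer_normal T e)"
    unfolding weak_hess_def l_def by blast+
qed

lemma weak_grad:
  assumes v: "v \<in> Vh k M" and T: "T \<in> cells M"
  shows "weak_grad k M v T \<in> vPol k"
    and "q \<in> vPol k \<Longrightarrow> ip T (weak_grad k M v T) q = - ip T (v0 v T) (dvg q)
        + bdry_ip M T (vb v) (\<lambda>e x. q x \<bullet> outer_normal T e)"
proof -
  define l where "l = (\<lambda>q. - ip T (v0 v T) (dvg q)
        + bdry_ip M T (vb v) (\<lambda>e x. q x \<bullet> outer_normal T e))"
  have c: "edge_cont e (vb v e)" if "e \<in> edges_of M T" for e
    using Vh_edge_cont[OF v edges_of_subset[OF that]] by simp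
  have v0: "continuous_on T (v0 v T)" 
    using v T by (auto simp: Vh_def intro: continuous_on_Pol)
  have c1: "edge_cont e (\<lambda>x. q x \<bullet> outer_normal T e)" if "q \<in> vPol k" for q e
    by (intro edge_cont_Pol[of _ k] vPol_inner that)
  have "\<exists>!D. D \<in> vPol k \<and> (\<forall>q\<in>vPol k. ip T D q = l q)"
    unfolding vPol_eq_FPol
  proof (rule form_space.riesz[OF form_space_cell[OF T]]; unfold vPol_eq_FPol[symmetric])
    fix p q assume *: "p \<in> vPol k" "q \<in> vPol k"
    have "ip T (v0 v T) (\<lambda>x. dvg p x + dvg q x) = ip T (v0 v T) (dvg p) + ip T (v0 v T) (dvg q)"
      unfolding ip_sym[of T "v0 v T"]
      by (intro ip_add_left compact_cell T v0 continuous_on_Pol[of _ k] dvg_Pol *)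
    then show "l (\<lambda>x. p x + q x) = l p + l q"
      unfolding l_def dvg_add[OF *] inner_add_left
      using bdry_ip_add_right[of T "vb v", OF c c1[OF *(1)] c1[OF *(2)]] by simp
  next
    fix q c assume *: "q \<in> vPol k"
    show "l (\<lambda>x. c *\<^sub>R q x) = c * l q"
      unfolding l_def dvg_scale[OF *] inner_scaleR_left
      using bdry_ip_scale_right[of T "vb v" c] ip_scale_left[of T c "dvg q" "v0 v T"]
      by (simp add: ip_sym[of T "v0 v T"] algebra_simps)
  qed
  from theI'[OF this] show "weak_grad k M v T \<in> vPol k"
    and "q \<in> vPol k \<Longrightarrow> ip T (weak_grad k M v T) q = - ip T (v0 v T) (dvg q)
        + bdry_ip M T (vb v) (\<lambda>e x. q x \<bullet> outer_normal T e)"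
    unfolding weak_grad_def l_def by blast+
qed

section \<open>The projection of the data\<close>

lemma negligible_cell_diff:
  assumes "T \<in> cells M"
  shows "negligible (T - interior T)"
proof -
  have "negligible (closed_segment a b :: point set)" for a b
    using negligible_convex_interior[of "closed_segment a b"] interior_closed_segment_ge2[of a b] by simp
  then have "negligible (\<Union>(seg ` edges_of M T))"
    by (intro negligible_Union) (auto simp: seg_def)
  moreover have "T - interior T \<subseteq> frontier T"
    using closure_subset by (auto simp: frontier_def)
  ultimately show ?thesis
    using polygonal_cellD(2)[OF cell_polygonal[OF assms]] negligible_subset by blast
qed

lemma interior_cell_subset:
  assumes "T \<in> cells M"
  shows "interior T \<subseteq> \<Omega>"
proof -
  have "interior T \<subseteq> interior (\<Union>(cells M))"
    using assms by (intro interior_mono) auto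
  also have "\<dots> = \<Omega>" using mesh unfolding polygonal_mesh_def by blast
  finally show ?thesis .
qed

text \<open>The data are square integrable on the open domain, whereas a closed cell may reach its
  boundary. The product is therefore integrated over the interior of the cell, and the cell differs
  from it by a null set.\<close>

lemma integrable_L2_times_Pol:
  assumes f: "L2 \<Omega> f" and T: "T \<in> cells M" and q: "q \<in> Pol k"
  shows "set_integrable lebesgue T (\<lambda>x. f x * q x)"
proof -
  let ?U = "interior T"
  have q_int: "set_integrable lebesgue T q" "set_integrable lebesgue T (\<lambda>x. (q x)\<^sup>2)"
    using q by (auto intro!: set_integrable_compact compact_cell T continuous_on_power continuous_on_Pol[OF q])
  have "set_integrable lebesgue ?U q"
    by (rule set_integrable_subset[OF q_int(1)]) (auto simp: interior_subset)
  then have [measurable]: "(\<lambda>x. indicator ?U x *\<^sub>R q x) \<in> borel_measurable lebesgue"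
    unfolding set_integrable_def by (rule borel_measurable_integrable)
  have [measurable]: "(\<lambda>x. indicator \<Omega> x *\<^sub>R f x) \<in> borel_measurable lebesgue"
    using f by (simp add: L2_def set_borel_measurable_def)
  have "(\<lambda>x. (indicator \<Omega> x *\<^sub>R f x) * (indicator ?U x *\<^sub>R q x)) \<in> borel_measurable lebesgue"
    by measurable
  also have "(\<lambda>x. (indicator \<Omega> x *\<^sub>R f x) * (indicator ?U x *\<^sub>R q x))
      = (\<lambda>x. indicator ?U x *\<^sub>R (f x * q x))"
    using interior_cell_subset[OF T] by (auto simp: indicator_def fun_eq_iff)
  finally have meas: "set_borel_measurable lebesgue ?U (\<lambda>x. f x * q x)"
    by (simp add: set_borel_measurable_def)
  have "set_integrable lebesgue ?U (\<lambda>x. (f x)\<^sup>2 + (q x)\<^sup>2)"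
  proof (rule set_integral_add)
    show "set_integrable lebesgue ?U (\<lambda>x. (f x)\<^sup>2)"
      by (rule set_integrable_subset[of _ \<Omega>])
        (use f interior_cell_subset[OF T] in \<open>auto simp: L2_def\<close>)
    show "set_integrable lebesgue ?U (\<lambda>x. (q x)\<^sup>2)"
      by (rule set_integrable_subset[OF q_int(2)]) (auto simp: interior_subset)
  qed
  then have "set_integrable lebesgue ?U (\<lambda>x. f x * q x)"
  proof (rule set_integrable_bound[OF _ meas])
    have "\<bar>f x * q x\<bar> \<le> (f x)\<^sup>2 + (q x)\<^sup>2" for x
    proof -
      have "2 * (\<bar>f x\<bar> * \<bar>q x\<bar>) \<le> (f x)\<^sup>2 + (q x)\<^sup>2"
        using sum_squares_bound[of "\<bar>f x\<bar>" "\<bar>q x\<bar>"] by (simp add: mult.assoc)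
      moreover have "0 \<le> \<bar>f x\<bar> * \<bar>q x\<bar>" by simp
      ultimately show ?thesis unfolding abs_mult by linarith
    qed
    then show "AE x in lebesgue. x \<in> ?U \<longrightarrow> norm (f x * q x) \<le> norm ((f x)\<^sup>2 + (q x)\<^sup>2)"
      by (intro AE_I2) simp
  qed
  moreover have "negligible {x \<in> ?U - T. f x * q x \<noteq> 0}"
    using interior_subset by (intro negligible_subset[OF negligible_empty]) blast
  moreover have "negligible {x \<in> T - ?U. f x * q x \<noteq> 0}"
    by (rule negligible_subset[OF negligible_cell_diff[OF T]]) blast
  ultimately show ?thesis
    using absolutely_integrable_spike_set_eq[of ?U T "\<lambda>x. f x * q x"] by blast
qed

lemma L2_proj_Pol:
  assumes f: "L2 \<Omega> f" and T: "T \<in> cells M"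
  shows "L2_proj k f T \<in> Pol k"
    and "q \<in> Pol k \<Longrightarrow> ip T (L2_proj k f T) q = ip T f q"
proof -
  have "\<exists>!p. p \<in> Pol k \<and> (\<forall>q\<in>Pol k. ip T p q = ip T f q)"
    unfolding Pol_eq_FPol
  proof (rule form_space.riesz[OF form_space_cell[OF T]]; unfold Pol_eq_FPol[symmetric])
    fix p q :: scalar_field assume *: "p \<in> Pol k" "q \<in> Pol k"
    show "ip T f (\<lambda>x. p x + q x) = ip T f p + ip T f q"
      unfolding ip_def using integrable_L2_times_Pol[OF f T *(1)] integrable_L2_times_Pol[OF f T *(2)]
      by (simp add: distrib_left)
  next
    fix q :: scalar_field and c assume *: "q \<in> Pol k"
    show "ip T f (\<lambda>x. c *\<^sub>R q x) = c * ip T f q"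
      using ip_scale_left[of T c q f] by (simp add: ip_sym[of T f])
  qed
  from theI'[OF this] show "L2_proj k f T \<in> Pol k"
    and "q \<in> Pol k \<Longrightarrow> ip T (L2_proj k f T) q = ip T f q"
    unfolding L2_proj_def by blast+
qed

end

section \<open>Inverse and trace inequalities\<close>

text \<open>With side 1/2 the coordinates of a point add up to at most 1, so the square fits into
  the reference triangle, and its affine image into the triangle over an edge.\<close>

abbreviation ref_cell :: "point set" where
  "ref_cell \<equiv> cbox 0 (vector [1/2, 1/2])"

lemma mem_ref_cell: "x \<in> ref_cell \<longleftrightarrow> 0 \<le> x $ 1 \<and> x $ 1 \<le> 1/2 \<and> 0 \<le> x $ 2 \<and> x $ 2 \<le> 1/2"
  by (auto simp: mem_box_cart forall_2)

lemma interior_ref_cell: "interior ref_cell \<noteq> {}"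
proof -
  have "vector [1/4, 1/4] \<in> box 0 (vector [1/2, 1/2] :: point)"
    by (simp add: mem_box_cart forall_2)
  then show ?thesis by auto
qed

text \<open>The points range over a segment of length 1, of which only half belongs to
  \<open>ref_cell\<close>. Finite dimension makes this harmless: \<open>C\<close> bounds, along the
  whole segment, the squares of an orthonormal basis and of its partial derivatives.\<close>

lemma reference_bound:
  obtains C where "C > 0"
    and "\<And>q s. q \<in> Pol k \<Longrightarrow> s \<in> {0..1} \<Longrightarrow> (q (s *\<^sub>R axis 1 1))\<^sup>2 \<le> C * ip ref_cell q q"
    and "\<And>q s l. q \<in> Pol k \<Longrightarrow> s \<in> {0..1} \<Longrightarrow> (pd l q (s *\<^sub>R axis 1 1))\<^sup>2 \<le> C * ip ref_cell q q"
proof -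
  interpret form_space "Pol k" "ip ref_cell"
    unfolding Pol_eq_FPol by (intro form_space_FPol interior_ref_cell) simp
  obtain m e where e: "orthonormal m e" and ex: "\<And>q. q \<in> Pol k \<Longrightarrow> expands m e q"
    using orthonormal_basis by blast
  have eV: "e i \<in> Pol k" if "i < m" for i using e that by (auto simp: orthonormal_def)
  define B where "B x = (\<Sum>i<m. (e i x)\<^sup>2) + (\<Sum>l\<in>UNIV. \<Sum>i<m. (pd l (e i) x)\<^sup>2)" for x
  have "continuous_on (closed_segment 0 (axis 1 1)) B"
    unfolding B_def using eV
    by (intro continuous_intros continuous_on_Pol[of _ k] Pol_pd) auto
  then have "bounded (B ` closed_segment 0 (axis 1 1))"
    by (intro compact_imp_bounded compact_continuous_image) auto
  then obtain C where C: "C > 0" "\<And>x. x \<in> closed_segment 0 (axis 1 1) \<Longrightarrow> \<bar>B x\<bar> \<le> C"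
    unfolding bounded_pos by auto
  have B: "B (s *\<^sub>R axis 1 1) \<le> C" if "s \<in> {0..1}" for s
    using C(2)[of "s *\<^sub>R axis 1 1"] that by (auto simp: closed_segment_def)
  have nn: "0 \<le> ip ref_cell q q" for q :: scalar_field by (rule ip_self_nonneg)
  show ?thesis
  proof (rule that[OF C(1)])
    fix q s assume q: "q \<in> Pol k" and s: "s \<in> {0..1::real}"
    have "(q (s *\<^sub>R axis 1 1))\<^sup>2 \<le> ip ref_cell q q * (\<Sum>i<m. (e i (s *\<^sub>R axis 1 1))\<^sup>2)"
      by (rule functional_bound[OF e ex[OF q] q]) auto
    also have "\<dots> \<le> ip ref_cell q q * C"
      by (intro mult_left_mono nn order.trans[OF _ B[OF s]]) (simp add: B_def sum_nonneg)
    finally show "(q (s *\<^sub>R axis 1 1))\<^sup>2 \<le> C * ip ref_cell q q" by (simp add: mult.commute)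
  next
    fix q s l assume q: "q \<in> Pol k" and s: "s \<in> {0..1::real}"
    let ?x = "s *\<^sub>R axis 1 1"
    have le: "(pd l q ?x)\<^sup>2 \<le> ip ref_cell q q * (\<Sum>i<m. (pd l (e i) ?x)\<^sup>2)"
      by (rule functional_bound[OF e ex[OF q] q])
        (auto intro!: pd_add pd_scale differentiable_Pol[of _ k])
    have "(\<Sum>i<m. (pd l (e i) ?x)\<^sup>2) \<le> (\<Sum>l\<in>UNIV. \<Sum>i<m. (pd l (e i) ?x)\<^sup>2)"
      by (rule member_le_sum[of l UNIV "\<lambda>l. \<Sum>i<m. (pd l (e i) ?x)\<^sup>2"]) (auto intro: sum_nonneg)
    also have "\<dots> \<le> B ?x" by (simp add: B_def sum_nonneg)
    also have "\<dots> \<le> C" by (rule B[OF s])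
    finally have "(\<Sum>i<m. (pd l (e i) ?x)\<^sup>2) \<le> C" .
    then have "ip ref_cell q q * (\<Sum>i<m. (pd l (e i) ?x)\<^sup>2) \<le> ip ref_cell q q * C"
      by (intro mult_left_mono nn)
    with le show "(pd l q ?x)\<^sup>2 \<le> C * ip ref_cell q q" by (simp add: mult.commute)
  qed
qed

section \<open>Transport from the reference square to a cell\<close>

definition affine_chart :: "point \<Rightarrow> real^2 \<Rightarrow> real^2 \<Rightarrow> point \<Rightarrow> point" where
  "affine_chart a d w x = a + (x $ 1) *\<^sub>R d + (x $ 2) *\<^sub>R w"

lemma has_derivative_affine_chart:
  "(affine_chart a d w has_derivative (\<lambda>h. (h $ 1) *\<^sub>R d + (h $ 2) *\<^sub>R w)) (at x within S)"
  unfolding affine_chart_def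
  by (auto intro!: derivative_eq_intros bounded_linear_imp_has_derivative[OF bounded_linear_vec_nth])

lemma Pol_affine_chart:
  assumes "p \<in> Pol k"
  shows "(\<lambda>x. p (affine_chart a d w x)) \<in> Pol k"
proof (rule Pol_compose[OF assms])
  fix i
  have "(\<lambda>x. a $ i + (d $ i * mon (1, 0) x + w $ i * mon (0, 1) x)) \<in> Pol 1"
    by (intro Pol_add Pol_const Pol_scale Pol_mon) auto
  then show "(\<lambda>x. affine_chart a d w x $ i) \<in> Pol 1"
    by (simp add: affine_chart_def mon_def algebra_simps)
qed

lemma pd_affine_chart:
  assumes "p \<in> Pol k"
  shows "pd 1 (\<lambda>x. p (affine_chart a d w x)) x = grad p (affine_chart a d w x) \<bullet> d"
    and "pd 2 (\<lambda>x. p (affine_chart a d w x)) x = grad p (affine_chart a d w x) \<bullet> w"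
proof -
  let ?y = "affine_chart a d w x"
  have "((\<lambda>x. p (affine_chart a d w x)) has_derivative
      (\<lambda>h. pd 1 p ?y * ((h $ 1) *\<^sub>R d + (h $ 2) *\<^sub>R w) $ 1 + pd 2 p ?y * ((h $ 1) *\<^sub>R d + (h $ 2) *\<^sub>R w) $ 2)) (at x)"
    by (rule has_derivative_compose[OF has_derivative_affine_chart has_derivative_Pol[OF assms]])
  from frechet_derivative_at[OF this, symmetric]
  show "pd 1 (\<lambda>x. p (affine_chart a d w x)) x = grad p ?y \<bullet> d"
    "pd 2 (\<lambda>x. p (affine_chart a d w x)) x = grad p ?y \<bullet> w"
    by (simp_all add: pd_def[of _ "\<lambda>x. p (affine_chart a d w x)"] grad_def inner_vec_def sum_2 axis_def)
qed

lemma ip_affine_chart: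
  fixes p :: scalar_field
  assumes p: "p \<in> Pol k" and D: "cross2 d w \<noteq> 0"
  shows "ip (affine_chart a d w ` ref_cell) p p
    = \<bar>cross2 d w\<bar> * ip ref_cell (\<lambda>x. p (affine_chart a d w x)) (\<lambda>x. p (affine_chart a d w x))"
proof -
  let ?F = "affine_chart a d w"
  let ?G = "\<lambda>h::point. (h $ 1) *\<^sub>R d + (h $ 2) *\<^sub>R w"
  \<comment> \<open>The change of variables theorem is about functions into a Cartesian power of the
    reals, hence the vector with one entry.\<close>
  define f where "f x = (vec (p x * p x) :: real^1)" for x
  have cont: "continuous_on S ?F" for S
    unfolding affine_chart_def by (intro continuous_intros)
  have comp: "compact (?F ` ref_cell)"
    by (intro compact_continuous_image cont) simp
  have det: "det (matrix ?G) = cross2 d w"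
    by (simp add: det_2 matrix_def cross2_def axis_def)
  have inj: "inj_on ?F ref_cell"
  proof (rule inj_onI)
    fix x y assume "?F x = ?F y"
    then have *: "(x $ 1 - y $ 1) *\<^sub>R d + (x $ 2 - y $ 2) *\<^sub>R w = 0"
      by (simp add: affine_chart_def algebra_simps)
    have "cross2 ((x $ 1 - y $ 1) *\<^sub>R d + (x $ 2 - y $ 2) *\<^sub>R w) w = (x $ 1 - y $ 1) * cross2 d w"
      "cross2 d ((x $ 1 - y $ 1) *\<^sub>R d + (x $ 2 - y $ 2) *\<^sub>R w) = (x $ 2 - y $ 2) * cross2 d w"
      by (simp_all add: cross2_simps)
    then have "x $ 1 = y $ 1" "x $ 2 = y $ 2"
      using D unfolding * by (simp_all add: cross2_simps)
    then show "x = y" by (simp add: vec_eq_iff forall_2)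
  qed
  have contp: "continuous_on S (\<lambda>x. p x * p x)" for S
    by (intro continuous_intros continuous_on_Pol[OF p])
  have contq: "continuous_on S (\<lambda>x. p (?F x) * p (?F x))" for S
    by (intro continuous_intros continuous_on_Pol[OF Pol_affine_chart[OF p]])
  have fq: "(\<lambda>x. \<bar>cross2 d w\<bar> *\<^sub>R f (?F x)) absolutely_integrable_on ref_cell"
    unfolding f_def
    by (intro absolutely_integrable_continuous continuous_on_scaleR continuous_on_const)
      (use contq[of ref_cell] in \<open>simp add: vec_def continuous_on_vec_lambda\<close>)
  have "integral (?F ` ref_cell) f = integral ref_cell (\<lambda>x. \<bar>cross2 d w\<bar> *\<^sub>R f (?F x))"
    using has_absolute_integral_change_of_variables[of ref_cell ?F "\<lambda>_. ?G" f
        "integral ref_cell (\<lambda>x. \<bar>cross2 d w\<bar> *\<^sub>R f (?F x))"]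
      has_derivative_affine_chart inj fq unfolding det by auto
  then have "integral (?F ` ref_cell) f $ 1 = \<bar>cross2 d w\<bar> * integral ref_cell (\<lambda>x. f (?F x)) $ 1"
    by simp
  moreover have "f integrable_on ?F ` ref_cell"
    using has_absolute_integral_change_of_variables[of ref_cell ?F "\<lambda>_. ?G" f
        "integral ref_cell (\<lambda>x. \<bar>cross2 d w\<bar> *\<^sub>R f (?F x))"]
      has_derivative_affine_chart inj fq unfolding det by (auto dest: set_lebesgue_integral_eq_integral)
  moreover have "(\<lambda>x. f (?F x)) integrable_on ref_cell"
    unfolding f_def
    by (intro integrable_continuous) (use contq[of ref_cell] in \<open>simp add: vec_def continuous_on_vec_lambda\<close>)
  ultimately have "integral (?F ` ref_cell) (\<lambda>x. p x * p x)
      = \<bar>cross2 d w\<bar> * integral ref_cell (\<lambda>x. p (?F x) * p (?F x))"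
    using integral_component_eq_cart[of f "?F ` ref_cell" 1]
      integral_component_eq_cart[of "\<lambda>x. f (?F x)" ref_cell 1]
    by (simp add: f_def)
  then show ?thesis
    unfolding ip_def inner_real_def
    using set_lebesgue_integral_eq_integral(2)[OF set_integrable_compact[OF comp contp]]
      set_lebesgue_integral_eq_integral(2)[OF set_integrable_compact[OF compact_cbox contq]] by simp
qed

text \<open>Cramer's rule recovers the components of \<open>g\<close> from its products with
  \<open>d\<close> and \<open>w\<close>; the determinant is the price for directions that are nearly
  parallel.\<close>

lemma gradient_from_directional:
  fixes g d w :: "real^2"
  assumes "norm d \<le> h" "norm w \<le> h"
  shows "(cross2 d w)\<^sup>2 * (g \<bullet> g) \<le> 2 * h\<^sup>2 * ((g \<bullet> d)\<^sup>2 + (g \<bullet> w)\<^sup>2)"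
proof -
  define x y where "x = g \<bullet> d" and "y = g \<bullet> w"
  have e: "cross2 d w * g $ 1 = x * w $ 2 - y * d $ 2" "cross2 d w * g $ 2 = y * d $ 1 - x * w $ 1"
    by (simp_all add: x_def y_def cross2_def inner_vec_def sum_2 algebra_simps)
  have "(cross2 d w)\<^sup>2 * (g \<bullet> g) = (cross2 d w * g $ 1)\<^sup>2 + (cross2 d w * g $ 2)\<^sup>2"
    by (simp add: inner_vec_def sum_2 power_mult_distrib power2_eq_square algebra_simps)
  also have "\<dots> = (x * w $ 2 - y * d $ 2)\<^sup>2 + (y * d $ 1 - x * w $ 1)\<^sup>2"
    unfolding e ..
  \<comment> \<open>The square of a difference is at most twice the sum of the squares, the defect
    being the square of the sum.\<close>
  also have "\<dots> \<le> 2 * (x\<^sup>2 * ((w $ 1)\<^sup>2 + (w $ 2)\<^sup>2) + y\<^sup>2 * ((d $ 1)\<^sup>2 + (d $ 2)\<^sup>2))"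
    using sum_squares_ge_zero[of "x * w $ 2 + y * d $ 2" "y * d $ 1 + x * w $ 1"]
    by (simp add: power2_eq_square algebra_simps)
  also have "\<dots> = 2 * (x\<^sup>2 * (norm w)\<^sup>2 + y\<^sup>2 * (norm d)\<^sup>2)"
    by (simp add: norm_real2)
  also have "\<dots> \<le> 2 * (x\<^sup>2 * h\<^sup>2 + y\<^sup>2 * h\<^sup>2)"
    using assms by (intro mult_left_mono add_mono power_mono) auto
  finally show ?thesis by (simp add: x_def y_def algebra_simps)
qed

lemma mem_seg: "x \<in> seg e \<longleftrightarrow> (\<exists>s\<in>{0..1}. x = fst e + s *\<^sub>R edge_vec e)"
proof -
  have "(1 - s) *\<^sub>R fst e + s *\<^sub>R snd e = fst e + s *\<^sub>R edge_vec e" for s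
    by (simp add: algebra_simps)
  then show ?thesis
    unfolding seg_def closed_segment_def by auto
qed

lemma in_seg: "0 \<le> s \<Longrightarrow> s \<le> 1 \<Longrightarrow> fst e + s *\<^sub>R edge_vec e \<in> seg e"
  unfolding mem_seg by auto

text \<open>The chart takes the reference segment to the edge and the second axis towards the apex.
  Pulling the reference bound back costs a Jacobian, for which the area bound in \<open>apex\<close>
  supplies the lower estimate; the powers of the diameter are those dictated by scaling.\<close>

lemma polynomial_bounds_on_edge:
  assumes "0 < \<rho>"
  obtains C where "C > 0"
    and "\<And>T e A p x. compact T \<Longrightarrow> 0 < diameter T \<Longrightarrow> apex \<rho> T e A \<Longrightarrow>
       fst e \<in> T \<Longrightarrow> snd e \<in> T \<Longrightarrow> p \<in> Pol k \<Longrightarrow> x \<in> seg e \<Longrightarrow>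
       diameter T ^ 2 * (p x)\<^sup>2 \<le> C * ip T p p \<and>
       diameter T ^ 4 * (grad p x \<bullet> grad p x) \<le> C * ip T p p"
proof -
  obtain C0 where C0: "C0 > 0"
    and C1: "\<And>q s. q \<in> Pol k \<Longrightarrow> s \<in> {0..1} \<Longrightarrow> (q (s *\<^sub>R axis 1 1))\<^sup>2 \<le> C0 * ip ref_cell q q"
    and C2: "\<And>q s l. q \<in> Pol k \<Longrightarrow> s \<in> {0..1} \<Longrightarrow> (pd l q (s *\<^sub>R axis 1 1))\<^sup>2 \<le> C0 * ip ref_cell q q"
    by (rule reference_bound[of k]) blast
  \<comment> \<open>The summands serve the value and the gradient bound. The former divides by one
    lower bound of the Jacobian, the latter by three of them.\<close>
  define C where "C = C0 / \<rho>^2 + 4 * C0 / \<rho>^6"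
  have C: "C0 / \<rho>^2 \<le> C" "4 * C0 / \<rho>^6 \<le> C" "C > 0"
    using assms C0 by (auto simp: C_def add_pos_pos)
  show ?thesis
  proof (rule that[OF C(3)])
    fix T e A and p :: scalar_field and x
    assume T: "compact T" and h: "0 < diameter T" and A: "apex \<rho> T e A"
      and ends: "fst e \<in> T" "snd e \<in> T" and p: "p \<in> Pol k" and x: "x \<in> seg e"
    define h where "h = diameter T"
    define d w where "d = edge_vec e" and "w = A - fst e"
    let ?F = "affine_chart (fst e) d w"
    let ?D = "\<bar>cross2 d w\<bar>"
    define q where "q = (\<lambda>x. p (?F x))"
    have "h > 0" using h by (simp add: h_def)
    have AT: "A \<in> T" using A by (simp add: apex_def)
    have le: "norm d \<le> h" "norm w \<le> h"
      unfolding d_def w_def h_def dist_norm[symmetric]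
      by (intro diameter_bounded_bound compact_imp_bounded T ends AT)+
    have D: "\<rho>\<^sup>2 * h\<^sup>2 \<le> ?D" using A by (simp add: apex_def d_def w_def h_def power_mult_distrib)
    have Dpos: "0 < ?D"
      by (rule order_less_le_trans[OF _ D]) (use assms \<open>h > 0\<close> in simp)
    have qk: "q \<in> Pol k" unfolding q_def by (rule Pol_affine_chart[OF p])
    have sub: "?F ` ref_cell \<subseteq> T"
      using A by (auto simp: mem_ref_cell affine_chart_def apex_def d_def w_def)
    have "?D * ip ref_cell q q = ip (?F ` ref_cell) p p"
      using ip_affine_chart[OF p, of d w "fst e"] Dpos by (simp add: q_def)
    also have "\<dots> \<le> ip T p p"
      by (rule ip_self_mono[OF T continuous_on_Pol[OF p] sub])
    finally have I: "?D * ip ref_cell q q \<le> ip T p p" .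
    obtain s where s: "s \<in> {0..1}" "x = fst e + s *\<^sub>R d" using x by (auto simp: mem_seg d_def)
    have Fx: "?F (s *\<^sub>R axis 1 1) = x" by (simp add: affine_chart_def s axis_def)
    have inn: "0 \<le> ip ref_cell q q" "0 \<le> ip T p p" by (rule ip_self_nonneg)+
    have "\<rho>\<^sup>2 * h\<^sup>2 * (p x)\<^sup>2 \<le> ?D * (p x)\<^sup>2" using D by (rule mult_right_mono) simp
    also have "\<dots> \<le> ?D * (C0 * ip ref_cell q q)"
      using C1[OF qk s(1)] Fx by (intro mult_left_mono) (auto simp: q_def)
    also have "\<dots> \<le> C0 * ip T p p" using I C0 by (simp add: mult.left_commute mult_left_mono)
    finally have "h\<^sup>2 * (p x)\<^sup>2 \<le> C0 / \<rho>^2 * ip T p p"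
      using assms by (simp add: field_simps)
    also have "\<dots> \<le> C * ip T p p" by (intro mult_right_mono C inn)
    finally have 1: "h\<^sup>2 * (p x)\<^sup>2 \<le> C * ip T p p" .
    define G where "G = grad p x \<bullet> grad p x"
    have G0: "0 \<le> G" by (simp add: G_def)
    have gd: "(grad p x \<bullet> d)\<^sup>2 \<le> C0 * ip ref_cell q q" "(grad p x \<bullet> w)\<^sup>2 \<le> C0 * ip ref_cell q q"
      using C2[OF qk s(1), of 1] C2[OF qk s(1), of 2] pd_affine_chart[OF p, of "fst e" d w "s *\<^sub>R axis 1 1"]
      unfolding q_def[symmetric] Fx by auto
    \<comment> \<open>Of the three Jacobian factors, one turns the reference integral into an
      integral over part of the cell and two are consumed by Cramer's rule for the gradient.\<close>
    have "(\<rho>\<^sup>2 * h\<^sup>2) ^ 3 * G \<le> ?D ^ 3 * G"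
      using D G0 by (intro mult_right_mono power_mono) auto
    also have "\<dots> = ?D * ((cross2 d w)\<^sup>2 * G)"
      by (simp add: power3_eq_cube power2_eq_square[of "cross2 d w"] abs_mult_self_eq flip: mult.assoc)
    also have "\<dots> \<le> ?D * (2 * h\<^sup>2 * ((grad p x \<bullet> d)\<^sup>2 + (grad p x \<bullet> w)\<^sup>2))"
      unfolding G_def by (intro mult_left_mono gradient_from_directional le) simp
    also have "\<dots> \<le> ?D * (2 * h\<^sup>2 * (C0 * ip ref_cell q q + C0 * ip ref_cell q q))"
      using gd by (intro mult_left_mono add_mono) auto
    also have "\<dots> = 4 * h\<^sup>2 * C0 * (?D * ip ref_cell q q)" by (simp add: algebra_simps)
    also have "\<dots> \<le> 4 * h\<^sup>2 * C0 * ip T p p" using I C0 by (intro mult_left_mono) auto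
    finally have "(\<rho>\<^sup>2 * h\<^sup>2) ^ 3 * G \<le> 4 * h\<^sup>2 * C0 * ip T p p" .
    then have "(h\<^sup>2 * \<rho>^6) * (h^4 * G) \<le> (h\<^sup>2 * \<rho>^6) * (4 * C0 / \<rho>^6 * ip T p p)"
    proof -
      have "(\<rho>\<^sup>2 * h\<^sup>2) ^ 3 = (h\<^sup>2 * \<rho>^6) * h^4"
        by (simp add: power_mult_distrib mult.commute mult.left_commute flip: power_mult power_add)
      moreover have "4 * h\<^sup>2 * C0 * ip T p p = (h\<^sup>2 * \<rho>^6) * (4 * C0 / \<rho>^6 * ip T p p)"
        using assms by simp
      ultimately show ?thesis
        using \<open>(\<rho>\<^sup>2 * h\<^sup>2) ^ 3 * G \<le> 4 * h\<^sup>2 * C0 * ip T p p\<close> by (simp only: mult.assoc)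
    qed
    then have "h^4 * G \<le> 4 * C0 / \<rho>^6 * ip T p p"
      using \<open>h > 0\<close> assms by (subst (asm) mult_le_cancel_left_pos) auto
    also have "\<dots> \<le> C * ip T p p" by (intro mult_right_mono C inn)
    finally show "diameter T ^ 2 * (p x)\<^sup>2 \<le> C * ip T p p \<and>
       diameter T ^ 4 * (grad p x \<bullet> grad p x) \<le> C * ip T p p"
      using 1 unfolding h_def G_def by blast
  qed
qed

section \<open>The number of edges of a cell\<close>

text \<open>An edge and its apex have six coordinates. Inside a cell each varies by at most
  \<open>16 / \<rho>\<^sup>2\<close> grid widths to either side of a reference point, so rounding
  leaves at most \<open>2 * nat \<lceil>16 / \<rho>\<^sup>2\<rceil> + 1\<close> values for
  each.\<close>

definition max_edges :: "real \<Rightarrow> nat" where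
  "max_edges \<rho> = (2 * nat \<lceil>16 / \<rho>\<^sup>2\<rceil> + 1) ^ 6"

context regular_mesh
begin

lemma edge_vec_nonzero: "T \<in> cells M \<Longrightarrow> e \<in> edges_of M T \<Longrightarrow> edge_vec e \<noteq> 0"
  using len_pos[of T e] by (auto simp: len_def)

lemma seg_frontier: "e \<in> edges_of M T \<Longrightarrow> seg e \<subseteq> frontier T"
  by (simp add: edges_of_def)

lemma edges_inter:
  "e \<in> edges M \<Longrightarrow> e' \<in> edges M \<Longrightarrow> e \<noteq> e' \<Longrightarrow> x \<in> seg e \<Longrightarrow> x \<in> seg e' \<Longrightarrow> x = fst e \<or> x = snd e"
  using mesh unfolding polygonal_mesh_def by blast

lemma inner_point_not_in_other_edge:
  assumes T: "T \<in> cells M" and e: "e \<in> edges_of M T" and e': "e' \<in> edges M" "e' \<noteq> e"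
    and \<sigma>: "0 < \<sigma>" "\<sigma> < 1"
  shows "fst e + \<sigma> *\<^sub>R edge_vec e \<notin> seg e'"
proof
  let ?x = "fst e + \<sigma> *\<^sub>R edge_vec e"
  assume "?x \<in> seg e'"
  moreover have "?x \<in> seg e" using \<sigma> by (auto simp: mem_seg)
  ultimately have "?x = fst e \<or> ?x = snd e"
    using edges_inter[OF edges_of_subset[OF e] e'(1)] e'(2) by blast
  then have "\<sigma> *\<^sub>R edge_vec e = 0 \<or> (1 - \<sigma>) *\<^sub>R edge_vec e = 0"
    by (auto simp: algebra_simps)
  then show False using \<sigma> edge_vec_nonzero[OF T e] by auto
qed

text \<open>Otherwise the segment from the midpoint of \<open>e\<close> to its apex would meet the edge \<open>e'\<close> inside the
  triangle on \<open>e\<close>, or else the midpoint would lie inside the triangle on \<open>e'\<close>; but no edge of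
  \<open>T\<close> enters the interior of \<open>T\<close>.\<close>
lemma nearby_edges_equal:
  assumes T: "T \<in> cells M" and e: "e \<in> edges_of M T" "e' \<in> edges_of M T"
    and A: "apex \<rho> T e A" "apex \<rho> T e' A'"
    and g: "g = \<rho>\<^sup>2 * diameter T / 16"
    and near: "\<And>i. \<bar>(fst e - fst e') $ i\<bar> \<le> g" "\<And>i. \<bar>(snd e - snd e') $ i\<bar> \<le> g" "\<And>i. \<bar>(A - A') $ i\<bar> \<le> g"
  shows "e = e'"
proof (rule ccontr)
  assume ne: "e \<noteq> e'"
  define h where "h = diameter T"
  have h: "h > 0" using diameter_pos[OF T] by (simp add: h_def)
  have "g > 0" using h \<rho>_pos by (simp add: g h_def)
  define d w d' w' where "d = edge_vec e" and "w = A - fst e"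
    and "d' = edge_vec e'" and "w' = A' - fst e'"
  define D' where "D' = cross2 d' w'"
  have D'0: "D' \<noteq> 0" using apex_cross2[OF T A(2)] by (simp add: D'_def d'_def w'_def)
  have D0: "cross2 d w \<noteq> 0" using apex_cross2[OF T A(1)] by (simp add: d_def w_def)
  have D'ge: "16 * g * h \<le> \<bar>D'\<bar>"
    using A(2) by (simp add: apex_def D'_def d'_def w'_def h_def g power_mult_distrib power2_eq_square mult_ac)
  have AT: "A \<in> T" "A' \<in> T" using A by (auto simp: apex_def)
  have comp: "\<bar>d' $ i\<bar> \<le> h" "\<bar>w' $ i\<bar> \<le> h" for i
    using dist_le_diameter[OF T] ends_in_cell[OF T] e AT
      component_le_norm_cart[of d' i] component_le_norm_cart[of w' i]
    unfolding d'_def w'_def h_def by (meson order_trans)+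
  \<comment> \<open>The factor 16 in \<open>g\<close> is chosen for this: a displacement by at most
    \<open>g\<close> changes an affine coordinate in the triangle over \<open>e'\<close> by at most
    1/8.\<close>
  have small: "\<bar>cross2 u v / D'\<bar> \<le> 1/8" if "\<And>i. \<bar>u $ i\<bar> \<le> g" "\<And>i. \<bar>v $ i\<bar> \<le> h" for u v
  proof -
    have "\<bar>cross2 u v\<bar> \<le> \<bar>u $ 1\<bar> * \<bar>v $ 2\<bar> + \<bar>u $ 2\<bar> * \<bar>v $ 1\<bar>"
      unfolding cross2_def by (metis abs_triangle_ineq4 abs_mult)
    also have "\<dots> \<le> g * h + g * h"
      using that \<open>g > 0\<close> by (intro add_mono mult_mono) auto
    also have "\<dots> \<le> \<bar>D'\<bar> / 8" using D'ge by simp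
    finally show ?thesis using D'0 by (simp add: field_simps abs_divide)
  qed
  have small': "\<bar>cross2 v u / D'\<bar> \<le> 1/8" if "\<And>i. \<bar>u $ i\<bar> \<le> g" "\<And>i. \<bar>v $ i\<bar> \<le> h" for u v
    using small[OF that] by (simp add: cross2_def algebra_simps abs_minus_commute abs_divide)
  define m where "m = fst e + (1/2) *\<^sub>R d"
  \<comment> \<open>The displacement between the midpoints of the two edges, as an average of the
    endpoint displacements.\<close>
  define u where "u = (1/2) *\<^sub>R ((fst e - fst e') + (snd e - snd e'))"
  have u: "\<bar>u $ i\<bar> \<le> g" for i using near(1,2)[of i] by (simp add: u_def abs_le_iff)
  \<comment> \<open>Affine coordinates in the triangle over \<open>e'\<close>: its edge is
    \<open>t = 0\<close> with \<open>s\<close> between 0 and 1, and its apex is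
    \<open>s = 0\<close>, \<open>t = 1\<close>. In them \<open>m\<close> is near the midpoint of
    \<open>e'\<close>, and \<open>A\<close> near its apex.\<close>
  define s t where "s x = cross2 (x - fst e') w' / D'" and "t x = cross2 d' (x - fst e') / D'" for x
  have coord: "x = fst e' + s x *\<^sub>R d' + t x *\<^sub>R w'" for x
    using cross2_coords[of d' w' "x - fst e'"] D'0 by (simp add: s_def t_def D'_def algebra_simps)
  have "m - fst e' = (1/2) *\<^sub>R d' + u"
  proof -
    have "2 *\<^sub>R (m - fst e') = 2 *\<^sub>R ((1/2) *\<^sub>R d' + u)"
      unfolding m_def u_def d_def d'_def scaleR_add_right scaleR_diff_right scaleR_scaleR
      by (simp add: scaleR_2)
    then show ?thesis by (simp only: scaleR_cancel_left) simp
  qed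
  then have m: "s m = 1/2 + cross2 u w' / D'" "t m = cross2 d' u / D'"
    using D'0 by (simp_all add: s_def t_def cross2_simps add_divide_distrib flip: D'_def)
  have "A - fst e' = w' + (A - A')" by (simp add: w'_def)
  then have A': "s A = cross2 (A - A') w' / D'" "t A = 1 + cross2 d' (A - A') / D'"
    unfolding s_def t_def using D'0
    by (simp_all only: cross2_simps(1,2,7) add_divide_distrib D'_def[symmetric]) simp_all
  have sm: "3/8 \<le> s m" "s m \<le> 5/8" and tm: "\<bar>t m\<bar> \<le> 1/8" and sA: "\<bar>s A\<bar> \<le> 1/8" and tA: "7/8 \<le> t A"
    using small[OF u comp(2)] small'[OF u comp(1)] small[OF near(3) comp(2)] small'[OF near(3) comp(1)]
    unfolding m A' by linarith+
  have mf: "m \<in> frontier T"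
    using seg_frontier[OF e(1)] in_seg[of "1/2" e] by (auto simp: m_def d_def)
  have "t m \<le> 0"
  proof (rule ccontr)
    assume "\<not> t m \<le> 0"
    then have "m \<in> interior T"
      using apex_interior[OF A(2) apex_cross2[OF T A(2)], of "s m" "t m"] sm tm
      unfolding d'_def[symmetric] w'_def[symmetric] coord[symmetric] by (simp add: abs_le_iff)
    then show False using mf by (simp add: frontier_def)
  qed
  \<comment> \<open>The parameter at which the segment from \<open>m\<close> to \<open>A\<close>
    crosses the line \<open>t = 0\<close> carrying \<open>e'\<close>. The crossing stays near
    \<open>m\<close>, hence between the endpoints of \<open>e'\<close>.\<close>
  define r where "r = - t m / (t A - t m)"
  have r: "0 \<le> r" "r \<le> 1/7" and rt: "(1 - r) * t m + r * t A = 0"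
    using \<open>t m \<le> 0\<close> tm tA by (auto simp: r_def field_simps abs_le_iff)
  define \<sigma> where "\<sigma> = (1 - r) * s m + r * s A"
  define p where "p = (1 - r) *\<^sub>R m + r *\<^sub>R A"
  have "p = (1 - r) *\<^sub>R (fst e' + s m *\<^sub>R d' + t m *\<^sub>R w') + r *\<^sub>R (fst e' + s A *\<^sub>R d' + t A *\<^sub>R w')"
    unfolding p_def using coord[of m] coord[of A] by simp
  also have "\<dots> = fst e' + \<sigma> *\<^sub>R d' + ((1 - r) * t m + r * t A) *\<^sub>R w'"
    by (simp add: \<sigma>_def algebra_simps)
  finally have p: "p = fst e' + \<sigma> *\<^sub>R d'" by (simp add: rt)
  have "(6/7) * (3/8) \<le> (1 - r) * s m" using r sm by (intro mult_mono) auto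
  moreover have "(1 - r) * s m \<le> 1 * (5/8)" using r sm by (intro mult_mono) auto
  moreover have "\<bar>r * s A\<bar> \<le> (1/7) * (1/8)" unfolding abs_mult using r sA by (intro mult_mono) auto
  ultimately have "\<sigma> \<in> {0..1}" by (auto simp: \<sigma>_def abs_le_iff)
  then have pe: "p \<in> seg e'" using p by (auto simp: mem_seg d'_def)
  show False
  \<comment> \<open>For \<open>r = 0\<close> the crossing is \<open>m\<close> itself, which is not
    interior to \<open>T\<close>; there the contradiction is that distinct edges meet only in
    endpoints.\<close>
  proof (cases "r = 0")
    case True
    then have "m \<in> seg e'" using pe by (simp add: p_def)
    then show False
      using inner_point_not_in_other_edge[OF T e(1) edges_of_subset[OF e(2)], of "1/2"] ne
      by (simp add: m_def d_def)
  next
    case False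
    have "p = fst e + ((1 - r) / 2) *\<^sub>R d + r *\<^sub>R w"
      by (simp add: p_def m_def w_def algebra_simps)
    moreover have "0 < (1 - r) / 2" "0 < r" "(1 - r) / 2 + r < 1"
      using r False by (auto simp: field_simps)
    ultimately have "p \<in> interior T"
      using apex_interior[OF A(1) apex_cross2[OF T A(1)]] by (simp only: d_def w_def)
    then show False using seg_frontier[OF e(2)] pe by (auto simp: frontier_def)
  qed
qed

lemma card_edges_of:
  assumes T: "T \<in> cells M"
  shows "card (edges_of M T) \<le> max_edges \<rho>"
proof -
  define g where "g = \<rho>\<^sup>2 * diameter T / 16"
  have h: "diameter T > 0" by (rule diameter_pos[OF T])
  have g: "g > 0" using h \<rho>_pos by (simp add: g_def)
  have "\<forall>e\<in>edges_of M T. \<exists>A. apex \<rho> T e A"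
    using apex_exists[OF T] by blast
  then obtain A where A: "\<And>e. e \<in> edges_of M T \<Longrightarrow> apex \<rho> T e (A e)"
    by metis
  obtain z where z: "z \<in> T" using polygonal_cellD(3)[OF cell_polygonal[OF T]] by blast
  define K where "K = \<lceil>16 / \<rho>\<^sup>2\<rceil>"
  define pos where "pos e = [fst e $ 1, fst e $ 2, snd e $ 1, snd e $ 2, A e $ 1, A e $ 2]" for e
  define zs where "zs = [z $ 1, z $ 2, z $ 1, z $ 2, z $ 1, z $ 2]"
  \<comment> \<open>Rounding to multiples of \<open>g\<close>: edges with the same code differ by
    less than \<open>g\<close> in every coordinate and are equal by
    \<open>nearby_edges_equal\<close>.\<close>
  define grid where "grid e = map (\<lambda>i. \<lfloor>(pos e ! i - zs ! i) / g\<rfloor>) [0..<6]" for e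
  have eq: "16 / \<rho>\<^sup>2 = diameter T / g" using h \<rho>_pos by (simp add: g_def)
  have in_range: "\<lfloor>(x $ i - z $ i) / g\<rfloor> \<in> {-K..K}" if "x \<in> T" for x i
  proof -
    have "\<bar>x $ i - z $ i\<bar> \<le> diameter T"
      using component_le_norm_cart[of "x - z" i] dist_le_diameter[OF T that z] by simp
    then have "\<bar>(x $ i - z $ i) / g\<bar> \<le> 16 / \<rho>\<^sup>2"
      unfolding eq abs_divide using g by (simp add: divide_right_mono)
    also have "\<dots> \<le> of_int K" by (simp add: K_def)
    finally have "\<bar>(x $ i - z $ i) / g\<bar> \<le> of_int K" .
    then have "- of_int K \<le> (x $ i - z $ i) / g" "(x $ i - z $ i) / g < of_int K + 1" by linarith+
    then show ?thesis by (simp add: le_floor_iff floor_le_iff)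
  qed
  have AT: "A e \<in> T" if "e \<in> edges_of M T" for e using A[OF that] by (simp add: apex_def)
  have six: "[0..<6] = [0, 1, 2, 3, 4, 5::nat]" by (simp add: upt_rec)
  have grid: "grid e = [\<lfloor>(fst e $ 1 - z $ 1) / g\<rfloor>, \<lfloor>(fst e $ 2 - z $ 2) / g\<rfloor>, \<lfloor>(snd e $ 1 - z $ 1) / g\<rfloor>,
      \<lfloor>(snd e $ 2 - z $ 2) / g\<rfloor>, \<lfloor>(A e $ 1 - z $ 1) / g\<rfloor>, \<lfloor>(A e $ 2 - z $ 2) / g\<rfloor>]" for e
    by (simp add: grid_def six pos_def zs_def)
  have "grid ` edges_of M T \<subseteq> {xs. set xs \<subseteq> {-K..K} \<and> length xs = 6}"
    using in_range ends_in_cell[OF T] AT by (auto simp only: grid image_subset_iff) auto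
  moreover have "inj_on grid (edges_of M T)"
  proof (rule inj_onI)
    fix e e' assume e: "e \<in> edges_of M T" "e' \<in> edges_of M T" and "grid e = grid e'"
    then have *: "\<lfloor>(fst e $ i - z $ i) / g\<rfloor> = \<lfloor>(fst e' $ i - z $ i) / g\<rfloor>"
       "\<lfloor>(snd e $ i - z $ i) / g\<rfloor> = \<lfloor>(snd e' $ i - z $ i) / g\<rfloor>"
       "\<lfloor>(A e $ i - z $ i) / g\<rfloor> = \<lfloor>(A e' $ i - z $ i) / g\<rfloor>" for i
      using exhaust_2[of i] unfolding grid by auto
    have close: "\<bar>(x - y) $ i\<bar> \<le> g" if "\<lfloor>(x $ i - z $ i) / g\<rfloor> = \<lfloor>(y $ i - z $ i) / g\<rfloor>" for x y :: point and i
    proof -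
      have "\<bar>(x $ i - z $ i) / g - (y $ i - z $ i) / g\<bar> < 1"
        using that by linarith
      then have "\<bar>((x - y) $ i) / g\<bar> < 1" by (simp add: diff_divide_distrib)
      then show ?thesis using g by (simp add: abs_divide)
    qed
    show "e = e'"
      by (rule nearby_edges_equal[OF T e A[OF e(1)] A[OF e(2)] g_def]) (intro close *)+
  qed
  ultimately have "card (edges_of M T) \<le> card {xs. set xs \<subseteq> {-K..K} \<and> length xs = 6}"
    by (intro card_inj_on_le[of grid]) (auto intro: finite_lists_length_eq)
  also have "\<dots> = card {-K..K} ^ 6"
    by (rule card_lists_length_eq) simp
  also have "card {-K..K} = 2 * nat K + 1"
  proof -
    have "0 \<le> K" by (simp add: K_def order_less_le_trans[of "- 1" 0])
    then show ?thesis by (simp add: nat_add_distrib nat_mult_distrib)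
  qed
  finally show ?thesis by (simp add: max_edges_def K_def)
qed


section \<open>The two cells of an interior edge\<close>

text \<open>The other edges are finitely many closed sets, and none of them contains an inner point
  of \<open>e\<close>.\<close>

lemma isolating_ball:
  assumes T: "T \<in> cells M" and e: "e \<in> edges_of M T" and \<sigma>: "0 < \<sigma>" "\<sigma> < 1"
  obtains r where "0 < r"
    "\<And>e' y. e' \<in> edges M \<Longrightarrow> e' \<noteq> e \<Longrightarrow> y \<in> ball (fst e + \<sigma> *\<^sub>R edge_vec e) r \<Longrightarrow> y \<notin> seg e'"
proof -
  let ?x = "fst e + \<sigma> *\<^sub>R edge_vec e"
  let ?U = "- (\<Union>e'\<in>edges M - {e}. seg e')"
  have "open ?U"
    by (intro open_Compl closed_UN) (auto simp: seg_def)
  moreover have "?x \<in> ?U"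
    using inner_point_not_in_other_edge[OF T e _ _ \<sigma>] by blast
  ultimately obtain r where r: "r > 0" "ball ?x r \<subseteq> ?U"
    by (rule openE)
  show ?thesis
  proof (rule that[OF r(1)])
    fix e' y assume "e' \<in> edges M" "e' \<noteq> e" "y \<in> ball ?x r"
    then show "y \<notin> seg e'" using subsetD[OF r(2)] by blast
  qed
qed

text \<open>The part of the ball strictly to one side of the line through \<open>e\<close>; the sign
  of \<open>c\<close> selects the side.\<close>

definition half_ball :: "edge \<Rightarrow> point \<Rightarrow> real \<Rightarrow> real \<Rightarrow> point set" where
  "half_ball e x r c = ball x r \<inter> {y. 0 < c * cross2 (edge_vec e) (y - x)}"

lemma convex_half_ball: "convex (half_ball e x r c)"
proof -
  have "c * cross2 (edge_vec e) (y - x)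
      = vector [- c * edge_vec e $ 2, c * edge_vec e $ 1] \<bullet> y - c * cross2 (edge_vec e) x" for y
    by (simp add: cross2_def inner_vec_def sum_2 algebra_simps)
  then have "{y. 0 < c * cross2 (edge_vec e) (y - x)}
      = {y. vector [- c * edge_vec e $ 2, c * edge_vec e $ 1] \<bullet> y > c * cross2 (edge_vec e) x}"
    by auto
  then show ?thesis
    unfolding half_ball_def by (auto intro!: convex_Int convex_halfspace_gt)
qed

lemma half_ball_avoids_edge: "y \<in> half_ball e (fst e + \<sigma> *\<^sub>R edge_vec e) r c \<Longrightarrow> y \<notin> seg e"
proof
  assume y: "y \<in> half_ball e (fst e + \<sigma> *\<^sub>R edge_vec e) r c" and "y \<in> seg e"
  then obtain s where "y = fst e + s *\<^sub>R edge_vec e" by (auto simp: mem_seg)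
  then have "y - (fst e + \<sigma> *\<^sub>R edge_vec e) = (s - \<sigma>) *\<^sub>R edge_vec e"
    by (simp add: scaleR_left_diff_distrib)
  then have "cross2 (edge_vec e) (y - (fst e + \<sigma> *\<^sub>R edge_vec e)) = 0"
    by (simp only: cross2_simps(6,7) mult_zero_right)
  then show False using y by (simp add: half_ball_def)
qed

text \<open>The half ball is convex and misses every edge, \<open>e\<close> included, hence the
  frontier of every cell. A connected set that misses the frontier lies inside or outside.\<close>

lemma half_ball_cell:
  assumes T: "T \<in> cells M"
    and iso: "\<And>e' y. e' \<in> edges M \<Longrightarrow> e' \<noteq> e \<Longrightarrow> y \<in> ball (fst e + \<sigma> *\<^sub>R edge_vec e) r \<Longrightarrow> y \<notin> seg e'"
  shows "half_ball e (fst e + \<sigma> *\<^sub>R edge_vec e) r c \<subseteq> interior T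
    \<or> half_ball e (fst e + \<sigma> *\<^sub>R edge_vec e) r c \<inter> T = {}"
proof -
  let ?H = "half_ball e (fst e + \<sigma> *\<^sub>R edge_vec e) r c"
  have "y \<notin> seg e'" if "e' \<in> edges M" "y \<in> ?H" for e' y
    using that iso half_ball_avoids_edge by (cases "e' = e") (auto simp: half_ball_def)
  then have fr: "?H \<inter> frontier T = {}"
    using polygonal_cellD(2)[OF cell_polygonal[OF T]] edges_of_subset by blast
  then have "?H \<inter> T = {} \<or> ?H \<subseteq> T"
    using connected_Int_frontier[OF convex_connected[OF convex_half_ball]] by blast
  moreover have "?H \<subseteq> interior T" if "?H \<subseteq> T"
    using that fr closure_subset by (auto simp: frontier_def)
  ultimately show ?thesis by blast
qed

lemma eventually_small_step:
  fixes x v :: point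
  assumes "0 < r"
  shows "\<forall>\<^sub>F t in at_right 0. x + t *\<^sub>R v \<in> ball x r"
proof -
  have "((\<lambda>t. x + t *\<^sub>R v) \<longlongrightarrow> x + 0 *\<^sub>R v) (at_right 0)"
    by (intro tendsto_intros)
  then show ?thesis
    using assms by (intro topological_tendstoD[where f = "\<lambda>t. x + t *\<^sub>R v"]) auto
qed

text \<open>Points just above the edge towards the apex are interior, which settles one side. If the
  cell filled the other side too, it would contain the whole ball, although the centre is a frontier
  point.\<close>

lemma cell_on_one_side:
  assumes T: "T \<in> cells M" and e: "e \<in> edges_of M T" and A: "apex \<rho> T e A"
    and \<sigma>: "0 < \<sigma>" "\<sigma> < 1" and r: "0 < r"
    and iso: "\<And>e' y. e' \<in> edges M \<Longrightarrow> e' \<noteq> e \<Longrightarrow> y \<in> ball (fst e + \<sigma> *\<^sub>R edge_vec e) r \<Longrightarrow> y \<notin> seg e'"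
    and D: "D = cross2 (edge_vec e) (A - fst e)"
  shows "half_ball e (fst e + \<sigma> *\<^sub>R edge_vec e) r D \<subseteq> interior T"
    and "half_ball e (fst e + \<sigma> *\<^sub>R edge_vec e) r (- D) \<inter> T = {}"
proof -
  define x w where "x = fst e + \<sigma> *\<^sub>R edge_vec e" and "w = A - fst e"
  have D0: "D \<noteq> 0" using apex_cross2[OF T A] by (simp add: D)
  have "\<forall>\<^sub>F t in at_right (0::real). 0 < t \<and> t < 1 - \<sigma>"
    using \<sigma> eventually_at_right_real[of 0 "1 - \<sigma>"] by simp
  then have "\<forall>\<^sub>F t in at_right 0. 0 < t \<and> t < 1 - \<sigma> \<and> x + t *\<^sub>R w \<in> ball x r"
    using eventually_small_step[OF r, of x w] by eventually_elim auto
  then obtain t where t: "0 < t" "t < 1 - \<sigma>" "x + t *\<^sub>R w \<in> ball x r"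
    using eventually_happens'[OF trivial_limit_at_right_real] by blast
  have pos: "0 < D * cross2 (edge_vec e) (s *\<^sub>R w)" if "0 < s" for s
    using that D0 unfolding cross2_simps(6) w_def D[symmetric] by (auto simp: zero_less_mult_iff mult_less_0_iff)
  have "x + t *\<^sub>R w \<in> interior T"
    unfolding x_def w_def using t \<sigma> by (intro apex_interior[OF A apex_cross2[OF T A]]) auto
  moreover have "x + t *\<^sub>R w \<in> half_ball e x r D"
    using t pos[of t] by (simp add: half_ball_def)
  ultimately have "\<not> half_ball e x r D \<inter> T = {}"
    using interior_subset by blast
  then show plus: "half_ball e (fst e + \<sigma> *\<^sub>R edge_vec e) r D \<subseteq> interior T"
    using half_ball_cell[of T e \<sigma> r D, OF T iso] unfolding x_def by blast
  show "half_ball e (fst e + \<sigma> *\<^sub>R edge_vec e) r (- D) \<inter> T = {}"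
  proof (rule ccontr)
    assume "\<not> ?thesis"
    then have minus: "half_ball e x r (- D) \<subseteq> interior T"
      using half_ball_cell[of T e \<sigma> r "- D", OF T iso] unfolding x_def by blast
    have "ball x r \<subseteq> T"
    proof
      fix y assume y: "y \<in> ball x r"
      consider "0 < D * cross2 (edge_vec e) (y - x)" | "0 < - D * cross2 (edge_vec e) (y - x)"
        | "cross2 (edge_vec e) (y - x) = 0"
        using D0 by (metis linorder_neqE_linordered_idom mult_eq_0_iff mult_minus_left neg_0_less_iff_less)
      then show "y \<in> T"
      proof cases
        case 1
        then have "y \<in> half_ball e x r D" using y by (simp add: half_ball_def)
        then show ?thesis using plus interior_subset unfolding x_def by blast
      next
        case 2
        then have "y \<in> half_ball e x r (- D)" using y by (simp add: half_ball_def)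
        then show ?thesis using minus interior_subset by blast
      next
        \<comment> \<open>Points on the line of the edge are limits of points pushed towards the
          apex, and \<open>T\<close> is closed.\<close>
        case 3
        have "\<forall>\<^sub>F s in at_right 0. y + s *\<^sub>R w \<in> ball y (r - dist x y)"
          using y by (intro eventually_small_step) simp
        then have "\<forall>\<^sub>F s in at_right 0. y + s *\<^sub>R w \<in> T"
          using eventually_at_right_less[of 0]
        proof eventually_elim
          case (elim s)
          have "y + s *\<^sub>R w \<in> ball x r"
            using elim(1) dist_triangle[of x "y + s *\<^sub>R w" y] by simp
          moreover have "y + s *\<^sub>R w - x = (y - x) + s *\<^sub>R w" by simp
          then have "cross2 (edge_vec e) (y + s *\<^sub>R w - x) = cross2 (edge_vec e) (s *\<^sub>R w)"
            using 3 by (simp only: cross2_simps(2) add_0_left)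
          ultimately have "y + s *\<^sub>R w \<in> half_ball e x r D"
            using pos[OF elim(2)] by (simp add: half_ball_def)
          then show ?case using plus interior_subset unfolding x_def by blast
        qed
        moreover have "((\<lambda>s. y + s *\<^sub>R w) \<longlongrightarrow> y + 0 *\<^sub>R w) (at_right 0)"
          by (intro tendsto_intros)
        ultimately show ?thesis
          using Lim_in_closed_set[OF polygonal_cellD(1)[OF cell_polygonal[OF T]]]
            trivial_limit_at_right_real by fastforce
      qed
    qed
    then have "x \<in> interior T" using r by (meson centre_in_ball interiorI open_ball)
    moreover have "x \<in> frontier T"
      using seg_frontier[OF e] in_seg[of \<sigma> e] \<sigma> by (auto simp: x_def)
    ultimately show False by (simp add: frontier_def)
  qed
qed

section \<open>Outward normals\<close>

lemma midpoint_eq: "midpoint (fst e) (snd e) = fst e + (1/2) *\<^sub>R edge_vec e"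
  by (simp add: midpoint_def vec_eq_iff field_simps)

lemma norm_square_edge_vec: "(edge_vec e $ 1)\<^sup>2 + (edge_vec e $ 2)\<^sup>2 = (len e)\<^sup>2"
  using norm_real2[of "edge_vec e"] by (simp add: len_def dist_norm norm_minus_commute)

lemma cross2_edge_normal:
  assumes "len e > 0"
  shows "cross2 (edge_vec e) (edge_normal e) = - len e"
proof -
  have "cross2 (edge_vec e) (edge_normal e) = - ((edge_vec e $ 1)\<^sup>2 + (edge_vec e $ 2)\<^sup>2) / len e"
    by (simp add: cross2_def edge_normal_def Let_def power2_eq_square add_divide_distrib diff_divide_distrib
        algebra_simps)
  also have "\<dots> = - len e"
    unfolding norm_square_edge_vec using assms by (simp add: power2_eq_square)
  finally show ?thesis .
qed

text \<open>Moving from the midpoint against \<open>edge_normal e\<close> makes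
  \<open>cross2 (edge_vec e)\<close> positive, by \<open>cross2_edge_normal\<close>. So the germ
  condition in \<open>outer_normal\<close> asks whether the cell, and with it the apex, lies on the
  positive side.\<close>

lemma outer_normal_apex:
  assumes T: "T \<in> cells M" and e: "e \<in> edges_of M T" and A: "apex \<rho> T e A"
  shows "outer_normal T e = (if 0 < cross2 (edge_vec e) (A - fst e) then edge_normal e else - edge_normal e)"
proof -
  define D where "D = cross2 (edge_vec e) (A - fst e)"
  define m where "m = midpoint (fst e) (snd e)"
  have D0: "D \<noteq> 0" using apex_cross2[OF T A] by (simp add: D_def)
  obtain r where r: "0 < r"
    and iso: "\<And>e' y. e' \<in> edges M \<Longrightarrow> e' \<noteq> e \<Longrightarrow> y \<in> ball (fst e + (1/2) *\<^sub>R edge_vec e) r \<Longrightarrow> y \<notin> seg e'"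
    using isolating_ball[OF T e, of "1/2"] by auto
  have sides: "half_ball e m r D \<subseteq> interior T" "half_ball e m r (- D) \<inter> T = {}"
    using cell_on_one_side[OF T e A _ _ r iso D_def] by (simp_all add: m_def midpoint_eq)
  have "\<forall>\<^sub>F t in at_right 0. m + t *\<^sub>R (- edge_normal e) \<in> ball m r"
    by (rule eventually_small_step[OF r])
  then have ev: "\<forall>\<^sub>F t in at_right 0. m - t *\<^sub>R edge_normal e \<in> half_ball e m r c" if "0 < c" for c
    using eventually_at_right_less[of 0]
  proof eventually_elim
    case (elim t)
    have "cross2 (edge_vec e) (m - t *\<^sub>R edge_normal e - m) = t * len e"
    proof -
      have "m - t *\<^sub>R edge_normal e - m = (- t) *\<^sub>R edge_normal e" by simp
      then show ?thesis
        using cross2_edge_normal[OF len_pos[OF T e]] by (simp only: cross2_simps(6) minus_mult_minus)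
    qed
    then show ?case
      using elim len_pos[OF T e] that by (simp add: half_ball_def)
  qed
  show ?thesis
  proof (cases "0 < D")
    case True
    have "\<forall>\<^sub>F t in at_right 0. m - t *\<^sub>R edge_normal e \<in> interior T"
      using ev[OF True] sides(1) by (auto elim: eventually_mono)
    then show ?thesis using True by (simp add: outer_normal_def m_def D_def)
  next
    case False
    then have "0 < - D" using D0 by simp
    have "\<forall>\<^sub>F t in at_right 0. m - t *\<^sub>R edge_normal e \<notin> interior T"
      using ev[OF \<open>0 < - D\<close>] sides(2) interior_subset by (auto elim!: eventually_mono)
    then have "\<not> (\<forall>\<^sub>F t in at_right 0. m - t *\<^sub>R edge_normal e \<in> interior T)"
      using eventually_happens'[OF trivial_limit_at_right_real] eventually_conj by (metis (mono_tags, lifting))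
    then show ?thesis using False by (simp add: outer_normal_def m_def D_def)
  qed
qed

lemma edge_normal_nonzero: "T \<in> cells M \<Longrightarrow> e \<in> edges_of M T \<Longrightarrow> edge_normal e \<noteq> 0"
  using cross2_edge_normal[of e] len_pos[of T e] by (auto simp: cross2_simps(9))

lemma outer_normal_cases:
  "outer_normal T e = edge_normal e \<or> outer_normal T e = - edge_normal e"
  by (auto simp: outer_normal_def)

text \<open>Two cells with the same outward normal lie on the same side of \<open>e\<close>, and
  their disjoint interiors would share a nonempty half ball.\<close>

lemma normals_distinct:
  assumes T: "T \<in> cells M" "e \<in> edges_of M T" and T': "T' \<in> cells M" "e \<in> edges_of M T'"
    and ne: "T \<noteq> T'"
  shows "outer_normal T e \<noteq> outer_normal T' e"
proof
  assume eq: "outer_normal T e = outer_normal T' e"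
  obtain A where A: "apex \<rho> T e A" using apex_exists[OF T] .
  obtain A' where A': "apex \<rho> T' e A'" using apex_exists[OF T'] .
  define D D' where "D = cross2 (edge_vec e) (A - fst e)" and "D' = cross2 (edge_vec e) (A' - fst e)"
  define x where "x = fst e + (1/2) *\<^sub>R edge_vec e"
  have nz: "D \<noteq> 0" "D' \<noteq> 0" using apex_cross2[OF T(1) A] apex_cross2[OF T'(1) A'] by (auto simp: D_def D'_def)
  have "edge_normal e \<noteq> - edge_normal e"
    using edge_normal_nonzero[OF T] by (metis add.right_inverse scaleR_2 scaleR_eq_0_iff zero_neq_numeral)
  then have sgn: "0 < D \<longleftrightarrow> 0 < D'"
    using eq outer_normal_apex[OF T A] outer_normal_apex[OF T' A'] by (auto simp: D_def D'_def split: if_splits)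
  obtain r where r: "0 < r"
    and iso: "\<And>e' y. e' \<in> edges M \<Longrightarrow> e' \<noteq> e \<Longrightarrow> y \<in> ball (fst e + (1/2) *\<^sub>R edge_vec e) r \<Longrightarrow> y \<notin> seg e'"
    using isolating_ball[OF T, of "1/2"] by auto
  have "half_ball e x r D \<subseteq> interior T" "half_ball e x r D' \<subseteq> interior T'"
    using cell_on_one_side(1)[OF T A _ _ r iso D_def] cell_on_one_side(1)[OF T' A' _ _ r iso D'_def]
    by (simp_all add: x_def)
  moreover have "half_ball e x r D = half_ball e x r D'"
    using sgn nz unfolding half_ball_def zero_less_mult_iff by auto
  moreover have "half_ball e x r D \<noteq> {}"
  proof -
    have "\<forall>\<^sub>F t in at_right 0. x + t *\<^sub>R (A - fst e) \<in> ball x r"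
      by (rule eventually_small_step[OF r])
    then have "\<forall>\<^sub>F t in at_right 0. x + t *\<^sub>R (A - fst e) \<in> half_ball e x r D"
      using eventually_at_right_less[of 0]
      by eventually_elim
        (use nz in \<open>auto simp: half_ball_def cross2_simps(6) zero_less_mult_iff mult_less_0_iff simp flip: D_def\<close>)
    then show ?thesis
      using eventually_happens'[OF trivial_limit_at_right_real] by blast
  qed
  moreover have "interior T \<inter> interior T' = {}"
    using mesh T(1) T'(1) ne unfolding polygonal_mesh_def by blast
  ultimately show False by blast
qed

text \<open>An edge off the boundary has an inner point \<open>x\<close> in the open domain. A point
  of the half ball opposite to \<open>T\<close> is covered by some cell \<open>T'\<close>; this cell
  swallows the half ball, has \<open>x\<close> on its frontier, and by isolation the only edge
  through \<open>x\<close> is \<open>e\<close>.\<close>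

lemma second_cell:
  assumes T: "T \<in> cells M" and e: "e \<in> edges_of M T" and int: "e \<notin> boundary_edges \<Omega> M"
  obtains T' where "T' \<in> cells M" "e \<in> edges_of M T'" "T' \<noteq> T"
proof -
  have cover: "\<Union>(cells M) = closure \<Omega>" using mesh by (simp add: polygonal_mesh_def)
  have "seg e \<subseteq> closure \<Omega>" using seg_subset_cell[OF T e] T cover by blast
  then have sub: "seg e \<subseteq> \<Omega> \<union> frontier \<Omega>"
    using open_domain by (auto simp: frontier_def interior_open)
  obtain x0 where "x0 \<in> seg e" "x0 \<in> \<Omega>"
    using int sub edges_of_subset[OF e] by (auto simp: boundary_edges_def)
  then obtain s0 where s0: "s0 \<in> {0..1}" "fst e + s0 *\<^sub>R edge_vec e \<in> \<Omega>" by (auto simp: mem_seg)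
  \<comment> \<open>The point found may be an endpoint; moving it slightly towards the midpoint
    stays in the open domain.\<close>
  obtain \<sigma> where \<sigma>: "0 < \<sigma>" "\<sigma> < 1" "fst e + \<sigma> *\<^sub>R edge_vec e \<in> \<Omega>"
  proof -
    have "((\<lambda>t. fst e + (s0 + t * (1/2 - s0)) *\<^sub>R edge_vec e)
        \<longlongrightarrow> fst e + (s0 + 0 * (1/2 - s0)) *\<^sub>R edge_vec e) (at_right 0)"
      by (intro tendsto_intros)
    then have "\<forall>\<^sub>F t in at_right 0. fst e + (s0 + t * (1/2 - s0)) *\<^sub>R edge_vec e \<in> \<Omega>"
      using s0 open_domain
      by (intro topological_tendstoD[where f = "\<lambda>t. fst e + (s0 + t * (1/2 - s0)) *\<^sub>R edge_vec e"]) auto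
    moreover have "\<forall>\<^sub>F t in at_right (0::real). 0 < t \<and> t < 1"
      using eventually_at_right_real[of 0 1] by simp
    ultimately have "\<forall>\<^sub>F t in at_right 0. fst e + (s0 + t * (1/2 - s0)) *\<^sub>R edge_vec e \<in> \<Omega> \<and> 0 < t \<and> t < 1"
      by eventually_elim auto
    then obtain t where t: "fst e + (s0 + t * (1/2 - s0)) *\<^sub>R edge_vec e \<in> \<Omega>" "0 < t" "t < 1"
      using eventually_happens'[OF trivial_limit_at_right_real] by blast
    have "s0 + t * (1/2 - s0) = (1 - t) * s0 + t / 2" by (simp add: algebra_simps)
    moreover have "0 \<le> (1 - t) * s0" "(1 - t) * s0 \<le> (1 - t) * 1"
      using s0 t by (auto intro: mult_left_mono)
    ultimately have "t / 2 \<le> s0 + t * (1/2 - s0)" "s0 + t * (1/2 - s0) \<le> 1 - t + t / 2" by simp_all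
    then have "0 < s0 + t * (1/2 - s0)" "s0 + t * (1/2 - s0) < 1" using t by linarith+
    with t that show ?thesis by blast
  qed
  define x where "x = fst e + \<sigma> *\<^sub>R edge_vec e"
  obtain r1 where r1: "0 < r1"
    and iso1: "\<And>e' y. e' \<in> edges M \<Longrightarrow> e' \<noteq> e \<Longrightarrow> y \<in> ball (fst e + \<sigma> *\<^sub>R edge_vec e) r1 \<Longrightarrow> y \<notin> seg e'"
    using isolating_ball[OF T e \<sigma>(1,2)] by auto
  obtain r2 where r2: "0 < r2" "ball x r2 \<subseteq> \<Omega>"
    using openE[OF open_domain \<sigma>(3)] unfolding x_def by metis
  define r where "r = min r1 r2"
  have r: "0 < r" using r1 r2 by (simp add: r_def)
  have iso: "\<And>e' y. e' \<in> edges M \<Longrightarrow> e' \<noteq> e \<Longrightarrow> y \<in> ball (fst e + \<sigma> *\<^sub>R edge_vec e) r \<Longrightarrow> y \<notin> seg e'"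
    using iso1 by (simp add: r_def)
  obtain A where A: "apex \<rho> T e A" using apex_exists[OF T e] .
  define D where "D = cross2 (edge_vec e) (A - fst e)"
  have D0: "D \<noteq> 0" using apex_cross2[OF T A] by (simp add: D_def)
  have sides: "half_ball e x r D \<subseteq> interior T" "half_ball e x r (- D) \<inter> T = {}"
    using cell_on_one_side[OF T e A \<sigma>(1,2) r iso D_def] by (simp_all add: x_def)
  have approach: "\<forall>\<^sub>F t in at_right 0. x + t *\<^sub>R (c *\<^sub>R (A - fst e)) \<in> half_ball e x r (c * D)" if "c \<noteq> 0" for c
    using eventually_small_step[OF r, of x "c *\<^sub>R (A - fst e)"] eventually_at_right_less[of 0]
  proof eventually_elim
    case (elim t)
    have "c * D * cross2 (edge_vec e) (t *\<^sub>R (c *\<^sub>R (A - fst e))) = t * (c * D)\<^sup>2"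
      by (simp add: cross2_simps(6) power2_eq_square D_def)
    then show ?case using elim that D0 by (simp add: half_ball_def)
  qed
  obtain y where y: "y \<in> half_ball e x r (- D)"
    using eventually_happens'[OF trivial_limit_at_right_real approach[of "- 1"]] by auto
  then have "y \<in> \<Omega>" using r2 by (auto simp: half_ball_def r_def)
  then obtain T' where T': "T' \<in> cells M" "y \<in> T'"
    using cover closure_subset by blast
  have ne: "T' \<noteq> T" using T' y sides(2) by blast
  have sub': "half_ball e x r (- D) \<subseteq> interior T'"
    using half_ball_cell[of T' e \<sigma> r "- D", OF T'(1) iso] y T'(2) unfolding x_def by blast
  have lim: "((\<lambda>t. x + t *\<^sub>R (c *\<^sub>R (A - fst e))) \<longlongrightarrow> x) (at_right 0)" for c
  proof -
    have "((\<lambda>t. x + t *\<^sub>R (c *\<^sub>R (A - fst e))) \<longlongrightarrow> x + 0 *\<^sub>R (c *\<^sub>R (A - fst e))) (at_right 0)"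
      by (intro tendsto_intros)
    then show ?thesis by simp
  qed
  have "\<forall>\<^sub>F t in at_right 0. x + t *\<^sub>R ((- 1) *\<^sub>R (A - fst e)) \<in> T'"
  proof (rule eventually_mono[OF approach])
    fix t assume "x + t *\<^sub>R ((- 1) *\<^sub>R (A - fst e)) \<in> half_ball e x r (- 1 * D)"
    then show "x + t *\<^sub>R ((- 1) *\<^sub>R (A - fst e)) \<in> T'"
      using sub' interior_subset[of T'] by auto
  qed simp
  then have "x \<in> T'"
    using Lim_in_closed_set[OF polygonal_cellD(1)[OF cell_polygonal[OF T'(1)]] _ trivial_limit_at_right_real lim]
    by blast
  \<comment> \<open>Otherwise points near \<open>x\<close> on the side of \<open>T\<close> would be
    interior to both cells.\<close>
  moreover have "x \<notin> interior T'"
  proof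
    assume "x \<in> interior T'"
    then have "\<forall>\<^sub>F t in at_right 0. x + t *\<^sub>R (1 *\<^sub>R (A - fst e)) \<in> interior T'"
      by (intro topological_tendstoD[OF lim]) auto
    then have "\<forall>\<^sub>F t in at_right 0. x + t *\<^sub>R (1 *\<^sub>R (A - fst e)) \<in> interior T' \<inter> interior T"
      using approach[OF one_neq_zero] by eventually_elim (use sides(1) in auto)
    then have "interior T' \<inter> interior T \<noteq> {}"
      using eventually_happens'[OF trivial_limit_at_right_real] by blast
    then show False using mesh T T'(1) ne unfolding polygonal_mesh_def by blast
  qed
  ultimately have "x \<in> frontier T'" using closure_subset by (auto simp: frontier_def)
  then obtain e' where e': "e' \<in> edges_of M T'" "x \<in> seg e'"
    using polygonal_cellD(2)[OF cell_polygonal[OF T'(1)]] by blast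
  then have "e' = e" using iso[OF edges_of_subset[OF e'(1)], of x] r by (auto simp: x_def)
  with e'(1) have "e \<in> edges_of M T'" by (simp only:)
  then show ?thesis by (rule that[OF T'(1) _ ne])
qed

text \<open>There are only two candidate normals, and no two cells at \<open>e\<close> share one.
  This makes the descriptions in \<open>plus_cell\<close> and \<open>minus_cell\<close>
  meaningful.\<close>

lemma interior_edge_cells:
  assumes T: "T \<in> cells M" and e: "e \<in> edges_of M T" and int: "e \<notin> boundary_edges \<Omega> M"
  defines "P \<equiv> plus_cell M e" and "N \<equiv> minus_cell M e"
  shows "P \<in> cells M" "N \<in> cells M" "P \<noteq> N" "e \<in> edges_of M P" "e \<in> edges_of M N"
    and "outer_normal P e = edge_normal e" "outer_normal N e = - edge_normal e"
    and "{T\<in>cells M. e \<in> edges_of M T} = {P, N}"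
proof -
  obtain T' where T': "T' \<in> cells M" "e \<in> edges_of M T'" "T' \<noteq> T"
    using second_cell[OF T e int] .
  have nz: "edge_normal e \<noteq> - edge_normal e"
    using edge_normal_nonzero[OF T e] by (metis add.right_inverse scaleR_2 scaleR_eq_0_iff zero_neq_numeral)
  have dist: "outer_normal T e \<noteq> outer_normal T' e"
    using normals_distinct[OF T e T'(1,2)] T'(3) by blast
  obtain T1 T2 where T1: "T1 \<in> cells M" "e \<in> edges_of M T1" "outer_normal T1 e = edge_normal e"
    and T2: "T2 \<in> cells M" "e \<in> edges_of M T2" "outer_normal T2 e = - edge_normal e"
    using dist outer_normal_cases[of T e] outer_normal_cases[of T' e] T e T' by metis
  have u1: "S = T1" if "S \<in> cells M" "e \<in> edges_of M S" "outer_normal S e = edge_normal e" for S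
    using normals_distinct[OF that(1,2) T1(1,2)] that(3) T1(3) by auto
  have u2: "S = T2" if "S \<in> cells M" "e \<in> edges_of M S" "outer_normal S e = - edge_normal e" for S
    using normals_distinct[OF that(1,2) T2(1,2)] that(3) T2(3) by auto
  have P: "P = T1" unfolding P_def plus_cell_def by (rule the_equality) (simp add: T1, elim conjE, rule u1)
  have N: "N = T2" unfolding N_def minus_cell_def by (rule the_equality) (simp add: T2, elim conjE, rule u2)
  show "P \<in> cells M" "N \<in> cells M" "e \<in> edges_of M P" "e \<in> edges_of M N"
    "outer_normal P e = edge_normal e" "outer_normal N e = - edge_normal e"
    using T1 T2 by (simp_all add: P N)
  show "P \<noteq> N" using T1 T2 nz by (auto simp: P N)
  show "{T\<in>cells M. e \<in> edges_of M T} = {P, N}"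
  proof (intro equalityI subsetI)
    fix S assume "S \<in> {T\<in>cells M. e \<in> edges_of M T}"
    then show "S \<in> {P, N}"
      using u1[of S] u2[of S] outer_normal_cases[of S e] by (auto simp: P N)
  qed (use T1 T2 in \<open>auto simp: P N\<close>)
qed

end

section \<open>Testing the scheme\<close>

text \<open>Both stabilizers pair the same gaps, so they merge into one form with the combined
  weights \<open>wt_grad\<close> and \<open>wt_val\<close>; the estimates never separate
  them.\<close>

definition stab_form :: "poly_mesh \<Rightarrow> real \<Rightarrow> weak_fun \<Rightarrow> weak_fun \<Rightarrow> point set \<Rightarrow> real" where
  "stab_form M \<epsilon> u v T = S1_cell M \<epsilon> u v T + S2_cell M u v T"

definition wt_grad :: "real \<Rightarrow> point set \<Rightarrow> real" where
  "wt_grad \<epsilon> T = \<epsilon>\<^sup>2 / diameter T + diameter T"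

definition wt_val :: "real \<Rightarrow> point set \<Rightarrow> real" where
  "wt_val \<epsilon> T = \<epsilon>\<^sup>2 / diameter T ^ 3 + 1 / diameter T"

abbreviation grad_gap :: "weak_fun \<Rightarrow> point set \<Rightarrow> edge \<Rightarrow> vector_field" where
  "grad_gap u T e \<equiv> \<lambda>x. dv0 u T x - vg u e x"

abbreviation val_gap :: "weak_fun \<Rightarrow> point set \<Rightarrow> edge \<Rightarrow> scalar_field" where
  "val_gap u T e \<equiv> \<lambda>x. v0 u T x - vb u e x"

lemma stab_form_eq:
  "stab_form M \<epsilon> u v T = (\<Sum>e\<in>edges_of M T.
     wt_grad \<epsilon> T * edge_ip e (grad_gap u T e) (grad_gap v T e)
   + wt_val \<epsilon> T * edge_ip e (val_gap u T e) (val_gap v T e))"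
  unfolding stab_form_def S1_cell_def S2_cell_def bdry_ip_def wt_grad_def wt_val_def
  by (simp add: sum.distrib sum_distrib_left distrib_right)

lemma edge_ip_minus_left: "edge_ip e (\<lambda>x. - v x) w = - edge_ip e v w"
  using edge_ip_scale_left[of e "- 1" v w] by simp

lemma edge_ip_minus_right: "edge_ip e v (\<lambda>x. - w x) = - edge_ip e v w"
  using edge_ip_minus_left[of e w v] by (simp add: edge_ip_sym)

lemma edge_cont_minus: "edge_cont e v \<Longrightarrow> edge_cont e (\<lambda>x. - v x)"
  using edge_cont_scale[of e v "- 1"] by simp

lemma edge_nrm2_commute: "edge_nrm2 e (\<lambda>x. v x - w x) = edge_nrm2 e (\<lambda>x. w x - v x)"
  using edge_ip_minus_left[of e "\<lambda>x. v x - w x" "\<lambda>x. w x - v x"]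
    edge_ip_minus_right[of e "\<lambda>x. v x - w x" "\<lambda>x. v x - w x"] by simp

lemma stab_form_error:
  "stab_form M \<epsilon> (wf_diff (triple_of u Du) w) (wf_diff (triple_of u Du) w) T = stab_form M \<epsilon> w w T"
proof -
  let ?d = "wf_diff (triple_of u Du) w"
  have "grad_gap ?d T e = (\<lambda>x. vg w e x - dv0 w T x)" "val_gap ?d T e = (\<lambda>x. vb w e x - v0 w T x)" for e
    by (auto simp: wf_diff_def triple_of_def)
  then show ?thesis
    unfolding stab_form_eq
    by (simp only: edge_nrm2_commute[of _ "vg w _"] edge_nrm2_commute[of _ "vb w _"])
qed

lemma edge_ip_abs_young:
  assumes "edge_cont e v" "edge_cont e w" "0 < l"
  shows "\<bar>edge_ip e v w\<bar> \<le> l / 2 * edge_ip e v v + 1 / (2 * l) * edge_ip e w w"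
  using edge_ip_young[OF assms] edge_ip_young[OF edge_cont_minus[OF assms(1)] assms(2,3)]
  unfolding edge_ip_minus_left edge_ip_minus_right abs_le_iff by simp

text \<open>Young's inequality with parameter \<open>2 * c / \<beta>\<close>. The quarter is chosen
  so that the contributions of the two cells at an edge can be absorbed together.\<close>

lemma weighted_young:
  assumes "edge_cont e v" "edge_cont e w" "0 < \<beta>" "0 < c" "0 \<le> a" "\<beta> * a \<le> c"
  shows "\<beta> * (a * \<bar>edge_ip e v w\<bar>) \<le> c * (a * edge_ip e v v) + \<beta> * edge_ip e w w / 4"
proof -
  have "\<bar>edge_ip e v w\<bar> \<le> (2 * c / \<beta>) / 2 * edge_ip e v v + 1 / (2 * (2 * c / \<beta>)) * edge_ip e w w"
    using assms by (intro edge_ip_abs_young) auto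
  then have "\<beta> * a * \<bar>edge_ip e v w\<bar>
      \<le> \<beta> * a * ((2 * c / \<beta>) / 2 * edge_ip e v v + 1 / (2 * (2 * c / \<beta>)) * edge_ip e w w)"
    using assms by (intro mult_left_mono) auto
  also have "\<dots> = c * (a * edge_ip e v v) + (\<beta> * a) * (\<beta> * edge_ip e w w / (4 * c))"
    using assms by (simp add: field_simps)
  also have "(\<beta> * a) * (\<beta> * edge_ip e w w / (4 * c)) \<le> c * (\<beta> * edge_ip e w w / (4 * c))"
    using assms edge_ip_self_nonneg[of e w] by (intro mult_right_mono) auto
  also have "c * (\<beta> * edge_ip e w w / (4 * c)) = \<beta> * edge_ip e w w / 4"
    using assms by simp
  finally show ?thesis by (simp add: mult.assoc)
qed

lemma grad_zero [simp]: "grad (\<lambda>x. 0) = (\<lambda>x. 0)"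
  by (auto simp: grad_def vec_eq_iff)

lemma edge_ip_diff_right:
  assumes "edge_cont e u" "edge_cont e v" "edge_cont e w"
  shows "edge_ip e u (\<lambda>x. v x - w x) = edge_ip e u v - edge_ip e u w"
  using edge_ip_add_left[of e v "\<lambda>x. (- 1) *\<^sub>R w x" u, OF assms(2) edge_cont_scale[OF assms(3)] assms(1)]
    edge_ip_scale_left[of e "- 1" w u]
  by (simp add: edge_ip_sym[of e u])

lemma edge_ip_scale_right: "edge_ip e v (\<lambda>x. c *\<^sub>R w x) = c * edge_ip e v w"
  using edge_ip_scale_left[of e c w v] by (simp add: edge_ip_sym)

context regular_mesh
begin

lemma wt_nonneg: "0 \<le> wt_grad \<epsilon> T" "0 \<le> wt_val \<epsilon> T" if "T \<in> cells M"
  using diameter_pos[OF that] by (simp_all add: wt_grad_def wt_val_def)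

lemma stab_edge_le:
  assumes T: "T \<in> cells M" and e: "e \<in> edges_of M T"
  shows "wt_grad \<epsilon> T * edge_nrm2 e (grad_gap w T e) + wt_val \<epsilon> T * edge_nrm2 e (val_gap w T e)
    \<le> stab_form M \<epsilon> w w T"
  unfolding stab_form_eq
  by (rule member_le_sum[OF e]) (auto intro!: add_nonneg_nonneg mult_nonneg_nonneg wt_nonneg T edge_ip_self_nonneg)

lemma stab_nonneg: "T \<in> cells M \<Longrightarrow> 0 \<le> stab_form M \<epsilon> w w T"
  unfolding stab_form_eq
  by (auto intro!: sum_nonneg add_nonneg_nonneg mult_nonneg_nonneg wt_nonneg edge_ip_self_nonneg)

lemma gap_cont:
  assumes w: "w \<in> Vh k M" and T: "T \<in> cells M" and e: "e \<in> edges_of M T"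
  shows "edge_cont e (grad_gap w T e)" "edge_cont e (val_gap w T e)"
proof -
  have "v0 w T \<in> Pol k" "dv0 w T = grad (v0 w T)" using w T by (auto simp: Vh_def)
  then show "edge_cont e (grad_gap w T e)" "edge_cont e (val_gap w T e)"
    using Vh_edge_cont[OF w edges_of_subset[OF e]]
    by (simp_all only: edge_cont_diff edge_cont_vPol[OF grad_vPol] edge_cont_Pol)
qed

lemma wg_equation:
  assumes "wg_solution k \<Omega> M \<epsilon> f w" "v \<in> Vh0 k \<Omega> M"
  shows "(\<Sum>T\<in>cells M. \<epsilon>\<^sup>2 * ip T (weak_hess k M w T) (weak_hess k M v T)
      + ip T (weak_grad k M w T) (weak_grad k M v T) + stab_form M \<epsilon> w v T - ip T f (v0 v T)) = 0"
proof -
  have "Bh k M \<epsilon> w v + Ah k M w v = (\<Sum>T\<in>cells M. ip T f (v0 v T))"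
    using assms by (auto simp: wg_solution_def)
  then show ?thesis
    by (simp add: Bh_def Ah_def stab_form_def sum.distrib sum_subtractf sum_distrib_left)
qed

lemma wg_solution_Vh: "wg_solution k \<Omega> M \<epsilon> f w \<Longrightarrow> w \<in> Vh k M"
  by (simp add: wg_solution_def Vh0_def)

section \<open>Test triples and residual identities\<close>

definition cell_test :: "point set \<Rightarrow> scalar_field \<Rightarrow> weak_fun" where
  "cell_test T p = \<lparr> v0 = (\<lambda>S. if S = T then p else (\<lambda>x. 0)),
     dv0 = (\<lambda>S. if S = T then grad p else (\<lambda>x. 0)), vb = (\<lambda>e x. 0), vg = (\<lambda>e x. 0) \<rparr>"

definition edge_val_test :: "edge \<Rightarrow> scalar_field \<Rightarrow> weak_fun" where
  "edge_val_test e g = \<lparr> v0 = (\<lambda>S x. 0), dv0 = (\<lambda>S x. 0),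
     vb = (\<lambda>e'. if e' = e then g else (\<lambda>x. 0)), vg = (\<lambda>e x. 0) \<rparr>"

definition edge_grad_test :: "edge \<Rightarrow> vector_field \<Rightarrow> weak_fun" where
  "edge_grad_test e g = \<lparr> v0 = (\<lambda>S x. 0), dv0 = (\<lambda>S x. 0),
     vb = (\<lambda>e x. 0), vg = (\<lambda>e'. if e' = e then g else (\<lambda>x. 0)) \<rparr>"

text \<open>The clamped boundary conditions constrain the edge components only: cell tests are
  always admissible, edge tests on edges off the boundary.\<close>

lemma test_in_Vh0:
  shows "p \<in> Pol k \<Longrightarrow> cell_test T p \<in> Vh0 k \<Omega> M"
    and "q \<in> Pol k \<Longrightarrow> e \<notin> boundary_edges \<Omega> M \<Longrightarrow> edge_val_test e q \<in> Vh0 k \<Omega> M"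
    and "r \<in> vPol k \<Longrightarrow> e \<notin> boundary_edges \<Omega> M \<Longrightarrow> edge_grad_test e r \<in> Vh0 k \<Omega> M"
  by (auto simp: Vh0_def Vh_def cell_test_def edge_val_test_def edge_grad_test_def vPol_def
      intro: Pol_imp_Pol_edge)

lemma Vh0_imp_Vh: "v \<in> Vh0 k \<Omega> M \<Longrightarrow> v \<in> Vh k M"
  by (simp add: Vh0_def)

lemma R_cell_Pol:
  assumes "L2 \<Omega> f" "T \<in> cells M" "w \<in> Vh k M"
  shows "R_cell k M \<epsilon> f w T \<in> Pol k"
proof -
  have "R_cell k M \<epsilon> f w T = (\<lambda>x. L2_proj k f T x - dvg (mdvg (\<lambda>y. \<epsilon>\<^sup>2 *\<^sub>R weak_hess k M w T y)) x
     + dvg (weak_grad k M w T) x)"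
    by (auto simp: R_cell_def)
  then show ?thesis
    using assms by (auto intro!: Pol_add Pol_diff L2_proj_Pol dvg_Pol mdvg_vPol mPol_scale weak_hess weak_grad)
qed

text \<open>The test triple has no edge components, so the weak operators of the test shift all
  derivatives onto those of \<open>w\<close>. What remains besides the stabilizer is the product of
  the residual with itself.\<close>

lemma residual_identity:
  assumes f: "L2 \<Omega> f" and T: "T \<in> cells M" and w: "wg_solution k \<Omega> M \<epsilon> f w"
  defines "R \<equiv> R_cell k M \<epsilon> f w T"
  shows "nrm2 T R = (\<Sum>e\<in>edges_of M T. wt_grad \<epsilon> T * edge_ip e (grad_gap w T e) (grad R)
     + wt_val \<epsilon> T * edge_ip e (val_gap w T e) R)"
proof -
  let ?v = "cell_test T R"
  let ?H = "\<lambda>S. weak_hess k M w S" and ?G = "\<lambda>S. weak_grad k M w S"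
  have wV: "w \<in> Vh k M" by (rule wg_solution_Vh[OF w])
  have R: "R \<in> Pol k" unfolding R_def by (rule R_cell_Pol[OF f T wV])
  have v0: "?v \<in> Vh0 k \<Omega> M" by (rule test_in_Vh0(1)[OF R])
  have v: "?v \<in> Vh k M" by (rule Vh0_imp_Vh[OF v0])
  define g where "g S = \<epsilon>\<^sup>2 * ip S (?H S) (weak_hess k M ?v S)
      + ip S (?G S) (weak_grad k M ?v S) + stab_form M \<epsilon> w ?v S - ip S f (v0 ?v S)" for S
  \<comment> \<open>The weak Hessian of \<open>w\<close> is itself an admissible test field in the
    identity defining the weak Hessian of the test triple; likewise for the gradient.\<close>
  have hess: "ip S (?H S) (weak_hess k M ?v S) = ip S (v0 ?v S) (dvg (mdvg (?H S)))"
    and gradv: "ip S (?G S) (weak_grad k M ?v S) = - ip S (v0 ?v S) (dvg (?G S))" if "S \<in> cells M" for S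
    using weak_hess(2)[OF v that weak_hess(1)[OF wV that]] weak_grad(2)[OF v that weak_grad(1)[OF wV that]]
    by (simp_all add: ip_sym[of S "?H S"] ip_sym[of S "?G S"] bdry_ip_def cell_test_def)
  have "g S = 0" if "S \<in> cells M" "S \<noteq> T" for S
    using that by (simp add: g_def hess gradv stab_form_eq) (simp add: cell_test_def)
  then have "(\<Sum>S\<in>cells M. g S) = g T"
    using T by (subst sum.remove[OF finite_cells T]) (auto intro!: sum.neutral)
  then have gT: "g T = 0" using wg_equation[OF w v0] by (simp add: g_def)
  have v0T: "v0 ?v T = R" by (simp add: cell_test_def)
  have H: "mdvg (?H T) \<in> vPol k" and G: "?G T \<in> vPol k"
    by (auto intro!: mdvg_vPol weak_hess weak_grad wV T)
  have P: "L2_proj k f T \<in> Pol k" by (rule L2_proj_Pol(1)[OF f T])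
  have R_eq: "R = (\<lambda>x. (L2_proj k f T x + (- \<epsilon>\<^sup>2) *\<^sub>R dvg (mdvg (?H T)) x) + dvg (?G T) x)"
    unfolding R_def by (rule ext)
      (simp add: R_cell_def mdvg_scale[OF weak_hess(1)[OF wV T]] dvg_scale[OF H])
  have c: "continuous_on T p" if "p \<in> Pol k" for p by (rule continuous_on_Pol[OF that])
  have "nrm2 T R = ip T (\<lambda>x. (L2_proj k f T x + (- \<epsilon>\<^sup>2) *\<^sub>R dvg (mdvg (?H T)) x) + dvg (?G T) x) R"
    by (rule arg_cong[OF R_eq, of "\<lambda>q. ip T q R"])
  also have "\<dots> = ip T (\<lambda>x. L2_proj k f T x + (- \<epsilon>\<^sup>2) *\<^sub>R dvg (mdvg (?H T)) x) R + ip T (dvg (?G T)) R"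
    using H G P R
    by (intro ip_add_left compact_cell T c) (auto intro!: dvg_Pol Pol_add Pol_diff Pol_scale)
  also have "ip T (\<lambda>x. L2_proj k f T x + (- \<epsilon>\<^sup>2) *\<^sub>R dvg (mdvg (?H T)) x) R
      = ip T (L2_proj k f T) R + ip T (\<lambda>x. (- \<epsilon>\<^sup>2) *\<^sub>R dvg (mdvg (?H T)) x) R"
    using H P R by (intro ip_add_left compact_cell T continuous_on_scaleR continuous_on_const c) (auto intro!: dvg_Pol)
  also have "ip T (\<lambda>x. (- \<epsilon>\<^sup>2) *\<^sub>R dvg (mdvg (?H T)) x) R = - \<epsilon>\<^sup>2 * ip T (dvg (mdvg (?H T))) R"
    by (rule ip_scale_left)
  \<comment> \<open>The projection may be exchanged for \<open>f\<close> because it is paired with a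
    polynomial of degree at most \<open>k\<close>.\<close>
  also have "ip T (L2_proj k f T) R = ip T f R" by (rule L2_proj_Pol(2)[OF f T R])
  finally have "nrm2 T R = stab_form M \<epsilon> w ?v T"
    using gT unfolding g_def hess[OF T] gradv[OF T] v0T ip_sym[of T R "dvg _"] by linarith
  then show ?thesis by (simp add: stab_form_eq) (simp add: cell_test_def)
qed

lemma sum_over_edge_cells:
  assumes "T \<in> cells M" "e \<in> edges_of M T" "e \<notin> boundary_edges \<Omega> M"
    and "\<And>S. S \<in> cells M \<Longrightarrow> e \<notin> edges_of M S \<Longrightarrow> g S = 0"
  shows "(\<Sum>S\<in>cells M. g S) = g (plus_cell M e) + (g (minus_cell M e) :: real)"
proof -
  have "(\<Sum>S\<in>cells M. g S) = (\<Sum>S\<in>{S\<in>cells M. e \<in> edges_of M S}. g S)"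
    using assms(4) by (intro sum.mono_neutral_right) auto
  also have "\<dots> = g (plus_cell M e) + g (minus_cell M e)"
    unfolding interior_edge_cells(8)[OF assms(1-3)]
    using interior_edge_cells(3)[OF assms(1-3)] by simp
  finally show ?thesis .
qed

lemma bdry_ip_single:
  "bdry_ip M S (\<lambda>e'. if e' = e then g else (\<lambda>x. 0)) h = (if e \<in> edges_of M S then edge_ip e g (h e) else 0)"
proof -
  have "bdry_ip M S (\<lambda>e'. if e' = e then g else (\<lambda>x. 0)) h
      = (\<Sum>e'\<in>edges_of M S. if e' = e then edge_ip e g (h e) else 0)"
    unfolding bdry_ip_def by (intro sum.cong) auto
  then show ?thesis by simp
qed

text \<open>The cellwise field whose normal component has the jump \<open>J1\<close>.\<close>

definition flux :: "nat \<Rightarrow> real \<Rightarrow> weak_fun \<Rightarrow> point set \<Rightarrow> vector_field" where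
  "flux k \<epsilon> w S x = mdvg (\<lambda>y. \<epsilon>\<^sup>2 *\<^sub>R weak_hess k M w S y) x - weak_grad k M w S x"

lemma flux_vPol: "w \<in> Vh k M \<Longrightarrow> S \<in> cells M \<Longrightarrow> flux k \<epsilon> w S \<in> vPol k"
  unfolding flux_def[abs_def]
  using vPol_add[OF mdvg_vPol[OF mPol_scale[OF weak_hess(1)]] vPol_scale[OF weak_grad(1), where c = "- 1"],
      of w k S w S "\<epsilon>\<^sup>2"] by simp

lemma J1_eq: "J1 k M \<epsilon> w e = (\<lambda>x. flux k \<epsilon> w (plus_cell M e) x \<bullet> edge_normal e
    - flux k \<epsilon> w (minus_cell M e) x \<bullet> edge_normal e)"
  by (auto simp: J1_def jump_def flux_def)

text \<open>Only the two cells at \<open>e\<close> contribute, and their outward normals are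
  opposite, so the boundary terms add up to the pairing of \<open>J\<close> with the jump, which is
  \<open>J\<close>. The minus sign comes from the boundary term of the weak Hessian and from the gap
  \<open>- J\<close> of the test triple.\<close>

lemma jump1_identity:
  assumes f: "L2 \<Omega> f" and T: "T \<in> cells M" and e: "e \<in> edges_of M T" "e \<notin> boundary_edges \<Omega> M"
    and w: "wg_solution k \<Omega> M \<epsilon> f w"
  defines "P \<equiv> plus_cell M e" and "N \<equiv> minus_cell M e" and "J \<equiv> J1 k M \<epsilon> w e"
  shows "J \<in> Pol k" 
    and "edge_nrm2 e J = - (wt_val \<epsilon> P * edge_ip e (val_gap w P e) J + wt_val \<epsilon> N * edge_ip e (val_gap w N e) J)"
proof -
  let ?v = "edge_val_test e J"
  let ?H = "\<lambda>S. weak_hess k M w S" and ?G = "\<lambda>S. weak_grad k M w S"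
  note cellsPN = interior_edge_cells[OF T e, folded P_def N_def]
  have wV: "w \<in> Vh k M" by (rule wg_solution_Vh[OF w])
  have fl: "(\<lambda>x. flux k \<epsilon> w S x \<bullet> n) \<in> Pol k" if "S \<in> cells M" for S n
    by (intro vPol_inner flux_vPol wV that)
  have J_eq: "J = (\<lambda>x. flux k \<epsilon> w P x \<bullet> edge_normal e - flux k \<epsilon> w N x \<bullet> edge_normal e)"
    unfolding J_def P_def N_def by (rule J1_eq)
  show J: "J \<in> Pol k"
    unfolding J_eq by (intro Pol_diff fl cellsPN)
  have v0: "?v \<in> Vh0 k \<Omega> M" by (rule test_in_Vh0(2)[OF J e(2)])
  have v: "?v \<in> Vh k M" by (rule Vh0_imp_Vh[OF v0])
  define g where "g S = \<epsilon>\<^sup>2 * ip S (?H S) (weak_hess k M ?v S)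
      + ip S (?G S) (weak_grad k M ?v S) + stab_form M \<epsilon> w ?v S - ip S f (v0 ?v S)" for S
  have hess: "ip S (?H S) (weak_hess k M ?v S)
      = (if e \<in> edges_of M S then - edge_ip e J (\<lambda>x. mdvg (?H S) x \<bullet> outer_normal S e) else 0)"
    and gradv: "ip S (?G S) (weak_grad k M ?v S)
      = (if e \<in> edges_of M S then edge_ip e J (\<lambda>x. ?G S x \<bullet> outer_normal S e) else 0)"
    if "S \<in> cells M" for S
    using weak_hess(2)[OF v that weak_hess(1)[OF wV that]] weak_grad(2)[OF v that weak_grad(1)[OF wV that]]
    by (simp_all add: ip_sym[of S "?H S"] ip_sym[of S "?G S"] edge_val_test_def bdry_ip_single)
      (simp_all add: bdry_ip_def)
  have stab: "stab_form M \<epsilon> w ?v S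
      = (if e \<in> edges_of M S then - wt_val \<epsilon> S * edge_ip e (val_gap w S e) J else 0)" for S
  proof -
    have "stab_form M \<epsilon> w ?v S
        = (\<Sum>e'\<in>edges_of M S. if e' = e then - wt_val \<epsilon> S * edge_ip e (val_gap w S e) J else 0)"
      unfolding stab_form_eq
      by (intro sum.cong) (auto simp: edge_val_test_def edge_ip_minus_right)
    then show ?thesis by simp
  qed
  have g0: "g S = 0" if "S \<in> cells M" "e \<notin> edges_of M S" for S
    using that by (simp add: g_def hess gradv stab) (simp add: edge_val_test_def)
  have g: "g S = - edge_ip e J (\<lambda>x. flux k \<epsilon> w S x \<bullet> outer_normal S e)
      - wt_val \<epsilon> S * edge_ip e (val_gap w S e) J" if S: "S \<in> cells M" "e \<in> edges_of M S" for S
  proof -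
    have "edge_ip e J (\<lambda>x. flux k \<epsilon> w S x \<bullet> outer_normal S e)
        = edge_ip e J (\<lambda>x. \<epsilon>\<^sup>2 *\<^sub>R (mdvg (?H S) x \<bullet> outer_normal S e) - ?G S x \<bullet> outer_normal S e)"
      by (simp add: flux_def mdvg_scale[OF weak_hess(1)[OF wV S(1)]] inner_diff_left)
    also have "\<dots> = edge_ip e J (\<lambda>x. \<epsilon>\<^sup>2 *\<^sub>R (mdvg (?H S) x \<bullet> outer_normal S e))
        - edge_ip e J (\<lambda>x. ?G S x \<bullet> outer_normal S e)"
      by (intro edge_ip_diff_right edge_cont_scale edge_cont_Pol[of _ k] J vPol_inner mdvg_vPol
          weak_hess(1) weak_grad(1) wV S)
    also have "\<dots> = \<epsilon>\<^sup>2 * edge_ip e J (\<lambda>x. mdvg (?H S) x \<bullet> outer_normal S e)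
        - edge_ip e J (\<lambda>x. ?G S x \<bullet> outer_normal S e)"
      by (simp only: edge_ip_scale_right)
    finally show ?thesis
      using S by (simp add: g_def hess gradv stab)
        (simp add: edge_val_test_def)
  qed
  have "g P + g N = 0"
    using sum_over_edge_cells[OF T e, of g] g0 wg_equation[OF w v0] by (simp add: g_def P_def N_def)
  moreover have "edge_nrm2 e J = edge_ip e J (\<lambda>x. flux k \<epsilon> w P x \<bullet> edge_normal e)
      - edge_ip e J (\<lambda>x. flux k \<epsilon> w N x \<bullet> edge_normal e)"
    by (subst (2) J_eq) (intro edge_ip_diff_right edge_cont_Pol[of _ k] J fl cellsPN)
  ultimately show "edge_nrm2 e J
      = - (wt_val \<epsilon> P * edge_ip e (val_gap w P e) J + wt_val \<epsilon> N * edge_ip e (val_gap w N e) J)"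
    using g[OF cellsPN(1,4)] g[OF cellsPN(2,5)]
    by (simp add: cellsPN(6,7) edge_ip_minus_right)
qed

lemma J2_eq: "J2 k M \<epsilon> w e = (\<lambda>x. \<epsilon>\<^sup>2 *\<^sub>R (weak_hess k M w (plus_cell M e) x *v edge_normal e)
    - \<epsilon>\<^sup>2 *\<^sub>R (weak_hess k M w (minus_cell M e) x *v edge_normal e))"
  by (auto simp: J2_def jump_def scaleR_matrix_vector_assoc)

lemma matrix_vector_mult_minus: "(A :: real^2^2) *v (- x) = - (A *v x)"
  by (simp add: matrix_vector_mult_def vec_eq_iff sum_negf)

text \<open>The same mechanism with the gradient component of the test. In the weak Hessian this
  component enters with a plus sign, which cancels the sign of the gap, and the weak gradient does
  not see it.\<close>

lemma jump2_identity:
  assumes f: "L2 \<Omega> f" and T: "T \<in> cells M" and e: "e \<in> edges_of M T" "e \<notin> boundary_edges \<Omega> M"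
    and w: "wg_solution k \<Omega> M \<epsilon> f w"
  defines "P \<equiv> plus_cell M e" and "N \<equiv> minus_cell M e" and "J \<equiv> J2 k M \<epsilon> w e"
  shows "J \<in> vPol k" 
    and "edge_nrm2 e J = wt_grad \<epsilon> P * edge_ip e (grad_gap w P e) J + wt_grad \<epsilon> N * edge_ip e (grad_gap w N e) J"
proof -
  let ?v = "edge_grad_test e J"
  let ?H = "\<lambda>S. weak_hess k M w S" and ?G = "\<lambda>S. weak_grad k M w S"
  note cellsPN = interior_edge_cells[OF T e, folded P_def N_def]
  have wV: "w \<in> Vh k M" by (rule wg_solution_Vh[OF w])
  have fl: "(\<lambda>x. \<epsilon>\<^sup>2 *\<^sub>R (?H S x *v n)) \<in> vPol k" if "S \<in> cells M" for S n
    by (intro vPol_scale mPol_mult_vec weak_hess(1) wV that)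
  have J_eq: "J = (\<lambda>x. \<epsilon>\<^sup>2 *\<^sub>R (?H P x *v edge_normal e) - \<epsilon>\<^sup>2 *\<^sub>R (?H N x *v edge_normal e))"
    unfolding J_def P_def N_def by (rule J2_eq)
  show J: "J \<in> vPol k"
    unfolding J_eq using vPol_add[OF fl[OF cellsPN(1)] vPol_scale[OF fl[OF cellsPN(2)], of "- 1"]] by simp
  have v0: "?v \<in> Vh0 k \<Omega> M" by (rule test_in_Vh0(3)[OF J e(2)])
  have v: "?v \<in> Vh k M" by (rule Vh0_imp_Vh[OF v0])
  define g where "g S = \<epsilon>\<^sup>2 * ip S (?H S) (weak_hess k M ?v S)
      + ip S (?G S) (weak_grad k M ?v S) + stab_form M \<epsilon> w ?v S - ip S f (v0 ?v S)" for S
  have hess: "ip S (?H S) (weak_hess k M ?v S)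
      = (if e \<in> edges_of M S then edge_ip e J (\<lambda>x. ?H S x *v outer_normal S e) else 0)"
    and gradv: "ip S (?G S) (weak_grad k M ?v S) = 0"
    if "S \<in> cells M" for S
    using weak_hess(2)[OF v that weak_hess(1)[OF wV that]] weak_grad(2)[OF v that weak_grad(1)[OF wV that]]
    by (simp_all add: ip_sym[of S "?H S"] ip_sym[of S "?G S"] edge_grad_test_def bdry_ip_single)
      (simp_all add: bdry_ip_def)
  have stab: "stab_form M \<epsilon> w ?v S
      = (if e \<in> edges_of M S then - wt_grad \<epsilon> S * edge_ip e (grad_gap w S e) J else 0)" for S
  proof -
    have "stab_form M \<epsilon> w ?v S
        = (\<Sum>e'\<in>edges_of M S. if e' = e then - wt_grad \<epsilon> S * edge_ip e (grad_gap w S e) J else 0)"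
      unfolding stab_form_eq
      by (intro sum.cong) (auto simp: edge_grad_test_def edge_ip_minus_right)
    then show ?thesis by simp
  qed
  have g0: "g S = 0" if "S \<in> cells M" "e \<notin> edges_of M S" for S
    using that by (simp add: g_def hess gradv stab) (simp add: edge_grad_test_def)
  have g: "g S = edge_ip e J (\<lambda>x. \<epsilon>\<^sup>2 *\<^sub>R (?H S x *v outer_normal S e))
      - wt_grad \<epsilon> S * edge_ip e (grad_gap w S e) J" if S: "S \<in> cells M" "e \<in> edges_of M S" for S
    using S by (simp add: g_def hess gradv stab edge_ip_scale_right)
      (simp add: edge_grad_test_def)
  have "g P + g N = 0"
    using sum_over_edge_cells[OF T e, of g] g0 wg_equation[OF w v0] by (simp add: g_def P_def N_def)
  moreover have "edge_nrm2 e J = edge_ip e J (\<lambda>x. \<epsilon>\<^sup>2 *\<^sub>R (?H P x *v edge_normal e))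
      - edge_ip e J (\<lambda>x. \<epsilon>\<^sup>2 *\<^sub>R (?H N x *v edge_normal e))"
    by (subst (2) J_eq) (intro edge_ip_diff_right edge_cont_vPol[of _ k] J fl cellsPN)
  ultimately show "edge_nrm2 e J
      = wt_grad \<epsilon> P * edge_ip e (grad_gap w P e) J + wt_grad \<epsilon> N * edge_ip e (grad_gap w N e) J"
    using g[OF cellsPN(1,4)] g[OF cellsPN(2,5)]
    by (simp add: cellsPN(6,7) edge_ip_minus_right matrix_vector_mult_minus)
qed

end

section \<open>Bounding the residuals\<close>

lemma powr_square: "0 \<le> h \<Longrightarrow> (h powr a)\<^sup>2 = h powr (2 * a)" for h :: real
  by (metis mult_2 powr_add power2_eq_square)

lemma min_square_le:
  fixes a b :: real
  assumes "0 \<le> a" "0 \<le> b"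
  shows "(min a b)\<^sup>2 \<le> a\<^sup>2" "(min a b)\<^sup>2 \<le> b\<^sup>2"
  using assms by (auto intro!: power_mono)

text \<open>Per coefficient, the first bound comes from the branch divided by \<epsilon> and is
  meant for the singular part of a stabilizer weight; the second comes from the other branch and is
  meant for the regular part.\<close>

lemma alpha_bounds:
  assumes "0 < diameter T" "0 < \<epsilon>"
  defines "h \<equiv> diameter T"
  shows "0 < (alpha \<epsilon> T)\<^sup>2" "(alpha \<epsilon> T)\<^sup>2 * \<epsilon>\<^sup>2 \<le> h^4" "(alpha \<epsilon> T)\<^sup>2 \<le> h^2"
    and "0 < (alpha_e1 \<epsilon> T)\<^sup>2" "(alpha_e1 \<epsilon> T)\<^sup>2 * \<epsilon>\<^sup>2 \<le> h^3" "(alpha_e1 \<epsilon> T)\<^sup>2 \<le> h"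
    and "0 < (alpha_e2 \<epsilon> T)\<^sup>2" "(alpha_e2 \<epsilon> T)\<^sup>2 * \<epsilon>\<^sup>2 \<le> h" "(alpha_e2 \<epsilon> T)\<^sup>2 \<le> 1 / h"
proof -
  have h: "0 < h" using assms by simp
  have "(h powr (-1/2))\<^sup>2 = h powr (2 * (-1/2))" using h by (intro powr_square) simp
  also have "\<dots> = 1 / h" using h by (simp add: powr_minus_divide)
  finally have p: "(h powr (3/2))\<^sup>2 = h^3" "(h powr (1/2))\<^sup>2 = h" "(h powr (-1/2))\<^sup>2 = 1 / h"
    using h powr_realpow[of h 3] by (simp_all only: powr_square[OF less_imp_le]) simp_all
  have *: "(min (a / \<epsilon>) b)\<^sup>2 * \<epsilon>\<^sup>2 \<le> a\<^sup>2" if "0 \<le> a" "0 \<le> b" for a b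
  proof -
    have "(min (a / \<epsilon>) b)\<^sup>2 * \<epsilon>\<^sup>2 \<le> (a / \<epsilon>)\<^sup>2 * \<epsilon>\<^sup>2"
      using that \<open>0 < \<epsilon>\<close> by (intro mult_right_mono min_square_le) auto
    then show ?thesis using \<open>0 < \<epsilon>\<close> by (simp add: power_divide)
  qed
  show "0 < (alpha \<epsilon> T)\<^sup>2" "0 < (alpha_e1 \<epsilon> T)\<^sup>2" "0 < (alpha_e2 \<epsilon> T)\<^sup>2"
    using h \<open>0 < \<epsilon>\<close> by (simp_all add: alpha_def alpha_e1_def alpha_e2_def min_def flip: h_def)
  show "(alpha \<epsilon> T)\<^sup>2 * \<epsilon>\<^sup>2 \<le> h^4" "(alpha \<epsilon> T)\<^sup>2 \<le> h^2"
    using *[of "h^2" h] min_square_le(2)[of "h^2 / \<epsilon>" h] h \<open>0 < \<epsilon>\<close>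
    by (simp_all add: alpha_def flip: h_def power_mult)
  show "(alpha_e1 \<epsilon> T)\<^sup>2 * \<epsilon>\<^sup>2 \<le> h^3" "(alpha_e1 \<epsilon> T)\<^sup>2 \<le> h"
    using *[of "h powr (3/2)" "h powr (1/2)"] min_square_le(2)[of "h powr (3/2) / \<epsilon>" "h powr (1/2)"] \<open>0 < \<epsilon>\<close>
    unfolding p alpha_e1_def h_def[symmetric] by simp_all
  show "(alpha_e2 \<epsilon> T)\<^sup>2 * \<epsilon>\<^sup>2 \<le> h" "(alpha_e2 \<epsilon> T)\<^sup>2 \<le> 1 / h"
    using *[of "h powr (1/2)" "h powr (-1/2)"] min_square_le(2)[of "h powr (1/2) / \<epsilon>" "h powr (-1/2)"] \<open>0 < \<epsilon>\<close>
    unfolding p alpha_e2_def h_def[symmetric] by simp_all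
qed

text \<open>The first summand is for the cell residuals. The second collects the constants of both
  jump residuals, times the overlap factor of \<open>sum_edge_stab\<close>. The final 1 is the
  stabilizer inside the estimator.\<close>

definition efficiency_constant :: "real \<Rightarrow> real \<Rightarrow> real" where
  "efficiency_constant \<rho> C = (8 * C * max_edges \<rho> + 1)
     + (2 * ((1 / \<rho>)^3 + 1 / \<rho>) + 2 * (2 / \<rho>)) * (2 * max_edges \<rho>) + 1"

context regular_mesh
begin

text \<open>A trace and an inverse inequality on all cells of the given mesh. The constant is a
  parameter so that one value can be supplied for all meshes.\<close>

definition edge_bound :: "nat \<Rightarrow> real \<Rightarrow> bool" where
  "edge_bound k C \<longleftrightarrow> C > 0 \<and> (\<forall>T\<in>cells M. \<forall>e\<in>edges_of M T. \<forall>p\<in>Pol k.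
     diameter T * edge_nrm2 e p \<le> C * nrm2 T p \<and> diameter T ^ 3 * edge_nrm2 e (grad p) \<le> C * nrm2 T p)"

text \<open>The residual identity has the residual on its right-hand side too; Young's inequality is
  tuned so that all edges together return at most half of it.\<close>

lemma residual_bound:
  assumes C: "edge_bound k C" and f: "L2 \<Omega> f" and T: "T \<in> cells M" and \<epsilon>: "0 < \<epsilon>"
    and w: "wg_solution k \<Omega> M \<epsilon> f w"
  shows "(alpha \<epsilon> T)\<^sup>2 * nrm2 T (R_cell k M \<epsilon> f w T)
    \<le> (8 * C * max_edges \<rho> + 1) * stab_form M \<epsilon> w w T"
proof -
  define R where "R = R_cell k M \<epsilon> f w T"
  define \<beta> where "\<beta> = (alpha \<epsilon> T)\<^sup>2"
  define h where "h = diameter T"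
  define X where "X = nrm2 T R"
  define N where "N = real (max_edges \<rho>)"
  \<comment> \<open>Chosen so that each of the two pairings on an edge costs at most
    \<open>\<beta> * X / (4 * N)\<close>: over at most \<open>N\<close> edges this is half of
    \<open>\<beta> * X\<close>, uniformly in the shape of the cell.\<close>
  define \<Lambda> where "\<Lambda> = 4 * C * N"
  have h: "0 < h" unfolding h_def by (rule diameter_pos[OF T])
  note al = alpha_bounds(1-3)[OF diameter_pos[OF T] \<epsilon>, folded h_def \<beta>_def]
  have C0: "0 < C" using C by (simp add: edge_bound_def)
  have N: "1 \<le> N" 
  proof -
    have "1 \<le> max_edges \<rho>" unfolding max_edges_def by (rule one_le_power) simp
    then show ?thesis by (simp add: N_def)
  qed
  have \<Lambda>: "0 < \<Lambda>" using C0 N by (simp add: \<Lambda>_def)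
  have wV: "w \<in> Vh k M" by (rule wg_solution_Vh[OF w])
  have R: "R \<in> Pol k" unfolding R_def by (rule R_cell_Pol[OF f T wV])
  have X0: "0 \<le> X" unfolding X_def by (rule ip_self_nonneg)
  let ?g = "wt_grad \<epsilon> T" and ?v = "wt_val \<epsilon> T"
  have wt: "0 \<le> ?g" "0 \<le> ?v" using wt_nonneg[OF T] .
  \<comment> \<open>After the balancing of both branches, the powers of \<open>h\<close> left over
    here and in \<open>bv\<close> are exactly those that \<open>edge_bound\<close> pays for.\<close>
  have bg: "\<beta> * ?g \<le> 2 * h^3"
  proof -
    have "\<beta> * ?g = \<beta> * \<epsilon>\<^sup>2 / h + \<beta> * h" by (simp add: wt_grad_def h_def distrib_left)
    also have "\<dots> \<le> h^4 / h + h^2 * h"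
      using al h by (intro add_mono divide_right_mono mult_right_mono) auto
    also have "\<dots> = 2 * h^3" using h by (simp add: power_numeral_reduce)
    finally show ?thesis .
  qed
  have bv: "\<beta> * ?v \<le> 2 * h"
  proof -
    have "\<beta> * ?v = \<beta> * \<epsilon>\<^sup>2 / h^3 + \<beta> / h" by (simp add: wt_val_def h_def distrib_left)
    also have "\<dots> \<le> h^4 / h^3 + h^2 / h"
      using al h by (intro add_mono divide_right_mono) auto
    also have "\<dots> = 2 * h" using h by (simp add: power_numeral_reduce)
    finally show ?thesis .
  qed
  have e: "\<beta> * (?g * edge_ip e (grad_gap w T e) (grad R) + ?v * edge_ip e (val_gap w T e) R)
      \<le> \<Lambda> * (?g * edge_nrm2 e (grad_gap w T e) + ?v * edge_nrm2 e (val_gap w T e)) + \<beta> * X / (2 * N)"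
    if e: "e \<in> edges_of M T" for e
  proof -
    have cont: "edge_cont e (grad R)" "edge_cont e R"
      using R by (auto intro: edge_cont_vPol grad_vPol edge_cont_Pol)
    have Cb: "h^3 * edge_nrm2 e (grad R) \<le> C * X" "h * edge_nrm2 e R \<le> C * X"
      using C T e R by (auto simp: edge_bound_def h_def X_def)
    have l: "0 < 2 * \<Lambda> / \<beta>" using \<Lambda> al by simp
    have half: "\<beta> * (a * edge_ip e x y) \<le> \<Lambda> * (a * edge_nrm2 e x) + \<beta> * X / (4 * N)"
      if "edge_cont e x" "edge_cont e y" "0 \<le> a" "\<beta> * a \<le> 2 * m" "m * edge_nrm2 e y \<le> C * X" "0 \<le> m"
      for a m and x y :: "point \<Rightarrow> 'c::real_inner"
    proof -
      have "edge_ip e x y \<le> (2 * \<Lambda> / \<beta>) / 2 * edge_nrm2 e x + 1 / (2 * (2 * \<Lambda> / \<beta>)) * edge_nrm2 e y"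
        by (rule edge_ip_young[OF that(1,2) l])
      then have "\<beta> * a * edge_ip e x y
          \<le> \<beta> * a * ((2 * \<Lambda> / \<beta>) / 2 * edge_nrm2 e x + 1 / (2 * (2 * \<Lambda> / \<beta>)) * edge_nrm2 e y)"
        using al that(3) by (intro mult_left_mono) auto
      also have "\<dots> = \<Lambda> * (a * edge_nrm2 e x) + (\<beta> * a) * edge_nrm2 e y * (\<beta> / (4 * \<Lambda>))"
        using al \<Lambda> by (simp add: field_simps)
      also have "(\<beta> * a) * edge_nrm2 e y * (\<beta> / (4 * \<Lambda>)) \<le> (2 * m) * edge_nrm2 e y * (\<beta> / (4 * \<Lambda>))"
        using al \<Lambda> that edge_ip_self_nonneg[of e y] by (intro mult_right_mono) auto
      also have "(2 * m) * edge_nrm2 e y * (\<beta> / (4 * \<Lambda>)) = 2 * (m * edge_nrm2 e y) * (\<beta> / (4 * \<Lambda>))"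
        by simp
      also have "\<dots> \<le> 2 * (C * X) * (\<beta> / (4 * \<Lambda>))"
        using al \<Lambda> that by (intro mult_right_mono mult_left_mono) auto
      also have "\<dots> \<le> \<beta> * X / (4 * N)"
        using C0 N X0 al by (simp add: \<Lambda>_def field_simps)
      finally show ?thesis by (simp add: mult.assoc)
    qed
    have "\<beta> * (?g * edge_ip e (grad_gap w T e) (grad R)) \<le> \<Lambda> * (?g * edge_nrm2 e (grad_gap w T e)) + \<beta> * X / (4 * N)"
      using h by (intro half[OF gap_cont(1)[OF wV T e] cont(1) wt(1) bg Cb(1)]) simp
    moreover have "\<beta> * (?v * edge_ip e (val_gap w T e) R) \<le> \<Lambda> * (?v * edge_nrm2 e (val_gap w T e)) + \<beta> * X / (4 * N)"
      using h by (intro half[OF gap_cont(2)[OF wV T e] cont(2) wt(2) bv Cb(2)]) simp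
    ultimately show ?thesis
      by (simp add: distrib_left)
  qed
  have "\<beta> * X = (\<Sum>e\<in>edges_of M T. \<beta> * (?g * edge_ip e (grad_gap w T e) (grad R) + ?v * edge_ip e (val_gap w T e) R))"
    unfolding X_def R_def residual_identity[OF f T w] by (rule sum_distrib_left)
  also have "\<dots> \<le> (\<Sum>e\<in>edges_of M T. \<Lambda> * (?g * edge_nrm2 e (grad_gap w T e) + ?v * edge_nrm2 e (val_gap w T e)) + \<beta> * X / (2 * N))"
    by (rule sum_mono) (rule e)
  also have "\<dots> = \<Lambda> * stab_form M \<epsilon> w w T + card (edges_of M T) * (\<beta> * X / (2 * N))"
    unfolding stab_form_eq sum_distrib_left sum.distrib[of "\<lambda>e. \<Lambda> * _ e"] by simp
  also have "card (edges_of M T) * (\<beta> * X / (2 * N)) \<le> N * (\<beta> * X / (2 * N))"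
    using card_edges_of[OF T] al X0 N by (intro mult_right_mono) (auto simp: N_def)
  also have "N * (\<beta> * X / (2 * N)) = \<beta> * X / 2" using N by simp
  finally have "\<beta> * X \<le> 2 * \<Lambda> * stab_form M \<epsilon> w w T" by simp
  also have "\<dots> \<le> (8 * C * N + 1) * stab_form M \<epsilon> w w T"
    using stab_nonneg[OF T] by (intro mult_right_mono) (auto simp: \<Lambda>_def)
  finally show ?thesis unfolding \<beta>_def X_def R_def N_def .
qed

section \<open>Jump residuals\<close>

lemma diameters_comparable:
  assumes "T \<in> cells M" "S \<in> cells M" "e \<in> edges_of M T" "e \<in> edges_of M S"
  shows "diameter T / diameter S \<le> 1 / \<rho>"
proof -
  have "\<rho> * diameter T \<le> diameter S"
    using len_ge_diameter[OF assms(1,3)] len_le_diameter[OF assms(2,4)] by simp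
  then show ?thesis
    using \<rho>_pos diameter_pos[OF assms(2)] by (simp add: field_simps)
qed

text \<open>Each of the two cells returns a quarter of the jump term, so half of it is absorbed on
  the left.\<close>

lemma jump_bound:
  assumes P: "P \<in> cells M" "e \<in> edges_of M P" and N: "N \<in> cells M" "e \<in> edges_of M N"
    and J: "edge_cont e J" and x: "edge_cont e (x P)" "edge_cont e (x N)"
    and Y: "edge_nrm2 e J \<le> a P * \<bar>edge_ip e (x P) J\<bar> + a N * \<bar>edge_ip e (x N) J\<bar>"
    and \<beta>: "0 < \<beta>" and c: "0 < c" and a: "0 \<le> a P" "0 \<le> a N" "\<beta> * a P \<le> c" "\<beta> * a N \<le> c"
    and s: "a P * edge_nrm2 e (x P) \<le> s P" "a N * edge_nrm2 e (x N) \<le> s N"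
  shows "\<beta> * edge_nrm2 e J \<le> 2 * c * (s P + s N)"
proof -
  have "\<beta> * edge_nrm2 e J \<le> \<beta> * (a P * \<bar>edge_ip e (x P) J\<bar> + a N * \<bar>edge_ip e (x N) J\<bar>)"
    using Y \<beta> by (intro mult_left_mono) auto
  also have "\<dots> = \<beta> * (a P * \<bar>edge_ip e (x P) J\<bar>) + \<beta> * (a N * \<bar>edge_ip e (x N) J\<bar>)"
    by (rule distrib_left)
  also have "\<dots> \<le> (c * (a P * edge_nrm2 e (x P)) + \<beta> * edge_nrm2 e J / 4)
      + (c * (a N * edge_nrm2 e (x N)) + \<beta> * edge_nrm2 e J / 4)"
    by (intro add_mono weighted_young assms)
  finally have "\<beta> * edge_nrm2 e J \<le> 2 * (c * (a P * edge_nrm2 e (x P)) + c * (a N * edge_nrm2 e (x N)))"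
    by simp
  also have "\<dots> \<le> 2 * (c * s P + c * s N)"
    using s c by (intro mult_left_mono add_mono) auto
  finally show ?thesis by (simp add: algebra_simps)
qed

definition edge_stab :: "real \<Rightarrow> weak_fun \<Rightarrow> edge \<Rightarrow> real" where
  "edge_stab \<epsilon> w e = (\<Sum>S\<in>{S\<in>cells M. e \<in> edges_of M S}. stab_form M \<epsilon> w w S)"

text \<open>The coefficient belongs to \<open>T\<close>, but the weights belong to both cells at the
  edge. Their diameters are comparable, each being tied to the length of the shared edge, and this
  is where the powers of \<open>1 / \<rho>\<close> come from.\<close>

lemma jump_residual_bounds:
  assumes f: "L2 \<Omega> f" and T: "T \<in> cells M" and e: "e \<in> edges_of M T" "e \<notin> boundary_edges \<Omega> M"
    and \<epsilon>: "0 < \<epsilon>" and w: "wg_solution k \<Omega> M \<epsilon> f w"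
  shows "(alpha_e1 \<epsilon> T)\<^sup>2 * edge_nrm2 e (J1 k M \<epsilon> w e) \<le> 2 * ((1 / \<rho>)^3 + 1 / \<rho>) * edge_stab \<epsilon> w e"
    and "(alpha_e2 \<epsilon> T)\<^sup>2 * edge_nrm2 e (J2 k M \<epsilon> w e) \<le> 2 * (2 / \<rho>) * edge_stab \<epsilon> w e"
proof -
  define P N where "P = plus_cell M e" and "N = minus_cell M e"
  define h where "h = diameter T"
  note PN = interior_edge_cells[OF T e, folded P_def N_def]
  have wV: "w \<in> Vh k M" by (rule wg_solution_Vh[OF w])
  have h: "0 < h" unfolding h_def by (rule diameter_pos[OF T])
  note al = alpha_bounds(4-9)[OF diameter_pos[OF T] \<epsilon>, folded h_def]
  have es: "edge_stab \<epsilon> w e = stab_form M \<epsilon> w w P + stab_form M \<epsilon> w w N"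
    unfolding edge_stab_def PN(8) using PN(3) by simp
  have cmp: "h / diameter S \<le> 1 / \<rho>" "diameter S / h \<le> 1 / \<rho>" if "S \<in> cells M" "e \<in> edges_of M S" for S
    unfolding h_def using diameters_comparable T e(1) that by blast+
  have "(alpha_e1 \<epsilon> T)\<^sup>2 * wt_val \<epsilon> S \<le> (1 / \<rho>)^3 + 1 / \<rho>" if S: "S \<in> cells M" "e \<in> edges_of M S" for S
  proof -
    let ?d = "diameter S"
    have d: "0 < ?d" by (rule diameter_pos[OF S(1)])
    have "(alpha_e1 \<epsilon> T)\<^sup>2 * wt_val \<epsilon> S = (alpha_e1 \<epsilon> T)\<^sup>2 * \<epsilon>\<^sup>2 / ?d^3 + (alpha_e1 \<epsilon> T)\<^sup>2 / ?d"
      by (simp add: wt_val_def distrib_left)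
    also have "\<dots> \<le> h^3 / ?d^3 + h / ?d"
      using al d by (intro add_mono divide_right_mono) auto
    also have "\<dots> = (h / ?d)^3 + h / ?d" by (simp add: power_divide)
    also have "\<dots> \<le> (1 / \<rho>)^3 + 1 / \<rho>"
      using cmp(1)[OF S] h d by (intro add_mono power_mono) auto
    finally show ?thesis .
  qed
  note w1 = this[OF PN(1,4)] this[OF PN(2,5)]
  have "(alpha_e2 \<epsilon> T)\<^sup>2 * wt_grad \<epsilon> S \<le> 2 / \<rho>" if S: "S \<in> cells M" "e \<in> edges_of M S" for S
  proof -
    let ?d = "diameter S"
    have d: "0 < ?d" by (rule diameter_pos[OF S(1)])
    have "(alpha_e2 \<epsilon> T)\<^sup>2 * wt_grad \<epsilon> S = (alpha_e2 \<epsilon> T)\<^sup>2 * \<epsilon>\<^sup>2 / ?d + (alpha_e2 \<epsilon> T)\<^sup>2 * ?d"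
      by (simp add: wt_grad_def distrib_left)
    also have "\<dots> \<le> h / ?d + (1 / h) * ?d"
      using al d by (intro add_mono divide_right_mono mult_right_mono) auto
    also have "\<dots> \<le> 2 / \<rho>" using cmp[OF S] by simp
    finally show ?thesis .
  qed
  note w2 = this[OF PN(1,4)] this[OF PN(2,5)]
  have s: "wt_grad \<epsilon> S * edge_nrm2 e (grad_gap w S e) \<le> stab_form M \<epsilon> w w S"
    "wt_val \<epsilon> S * edge_nrm2 e (val_gap w S e) \<le> stab_form M \<epsilon> w w S"
    if S: "S \<in> cells M" "e \<in> edges_of M S" for S
  proof -
    have "0 \<le> wt_grad \<epsilon> S * edge_nrm2 e (grad_gap w S e)" "0 \<le> wt_val \<epsilon> S * edge_nrm2 e (val_gap w S e)"
      by (intro mult_nonneg_nonneg wt_nonneg S edge_ip_self_nonneg)+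
    then show "wt_grad \<epsilon> S * edge_nrm2 e (grad_gap w S e) \<le> stab_form M \<epsilon> w w S"
      "wt_val \<epsilon> S * edge_nrm2 e (val_gap w S e) \<le> stab_form M \<epsilon> w w S"
      using stab_edge_le[OF S, of \<epsilon> w] by linarith+
  qed
  have \<rho>c: "0 < (1 / \<rho>)^3 + 1 / \<rho>" "0 < 2 / \<rho>" using \<rho>_pos by (simp_all add: add_pos_pos)
  note j1 = jump1_identity[OF f T e w, folded P_def N_def]
  have Y1: "edge_nrm2 e (J1 k M \<epsilon> w e) \<le> wt_val \<epsilon> P * \<bar>edge_ip e (val_gap w P e) (J1 k M \<epsilon> w e)\<bar>
      + wt_val \<epsilon> N * \<bar>edge_ip e (val_gap w N e) (J1 k M \<epsilon> w e)\<bar>"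
  proof -
    have "- (p * x + n * y) \<le> p * \<bar>x\<bar> + n * \<bar>y\<bar>" if "0 \<le> p" "0 \<le> n" for p n x y :: real
      using mult_left_mono[OF abs_ge_minus_self that(1), of x] mult_left_mono[OF abs_ge_minus_self that(2), of y]
      by simp
    then show ?thesis unfolding j1(2) using wt_nonneg PN(1,2) by blast
  qed
  show "(alpha_e1 \<epsilon> T)\<^sup>2 * edge_nrm2 e (J1 k M \<epsilon> w e) \<le> 2 * ((1 / \<rho>)^3 + 1 / \<rho>) * edge_stab \<epsilon> w e"
    unfolding es
    by (rule jump_bound[where a = "wt_val \<epsilon>" and x = "\<lambda>S. val_gap w S e" and s = "stab_form M \<epsilon> w w",
          OF PN(1,4) PN(2,5) edge_cont_Pol[OF j1(1)] gap_cont(2)[OF wV PN(1,4)] gap_cont(2)[OF wV PN(2,5)]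
            Y1 al(1) \<rho>c(1) wt_nonneg(2)[OF PN(1)] wt_nonneg(2)[OF PN(2)] w1 s(2)[OF PN(1,4)] s(2)[OF PN(2,5)]])
  note j2 = jump2_identity[OF f T e w, folded P_def N_def]
  have Y2: "edge_nrm2 e (J2 k M \<epsilon> w e) \<le> wt_grad \<epsilon> P * \<bar>edge_ip e (grad_gap w P e) (J2 k M \<epsilon> w e)\<bar>
      + wt_grad \<epsilon> N * \<bar>edge_ip e (grad_gap w N e) (J2 k M \<epsilon> w e)\<bar>"
    by (subst j2(2)) (intro add_mono mult_left_mono wt_nonneg PN abs_ge_self)
  show "(alpha_e2 \<epsilon> T)\<^sup>2 * edge_nrm2 e (J2 k M \<epsilon> w e) \<le> 2 * (2 / \<rho>) * edge_stab \<epsilon> w e"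
    unfolding es
    by (rule jump_bound[where a = "wt_grad \<epsilon>" and x = "\<lambda>S. grad_gap w S e" and s = "stab_form M \<epsilon> w w",
          OF PN(1,4) PN(2,5) edge_cont_vPol[OF j2(1)] gap_cont(1)[OF wV PN(1,4)] gap_cont(1)[OF wV PN(2,5)]
            Y2 al(4) \<rho>c(2) wt_nonneg(1)[OF PN(1)] wt_nonneg(1)[OF PN(2)] w2 s(1)[OF PN(1,4)] s(1)[OF PN(2,5)]])
qed

text \<open>Double counting in both directions: each edge off the boundary is visited from its two
  cells, and each cell's stabilizer is charged once for each of its edges.\<close>

lemma sum_edge_stab:
  "(\<Sum>T\<in>cells M. \<Sum>e\<in>edges_of M T - boundary_edges \<Omega> M. edge_stab \<epsilon> w e)
    \<le> 2 * max_edges \<rho> * (\<Sum>T\<in>cells M. stab_form M \<epsilon> w w T)"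
proof -
  let ?E = "edges M - boundary_edges \<Omega> M"
  have swap: "(\<Sum>T\<in>cells M. \<Sum>e\<in>{e\<in>?E. e \<in> edges_of M T}. g T e)
      = (\<Sum>e\<in>?E. \<Sum>T\<in>{T\<in>cells M. e \<in> edges_of M T}. g T e)" for g :: "point set \<Rightarrow> edge \<Rightarrow> real"
    by (rule sum.swap_restrict) auto
  have E: "edges_of M T - boundary_edges \<Omega> M = {e\<in>?E. e \<in> edges_of M T}" for T
    using edges_of_subset by auto
  have two: "card {T\<in>cells M. e \<in> edges_of M T} = 2" if e: "e \<in> ?E" for e
  proof -
    have "\<forall>e\<in>edges M. \<exists>T\<in>cells M. e \<in> edges_of M T"
      using mesh unfolding polygonal_mesh_def by (elim conjE)
    then obtain T where "T \<in> cells M" "e \<in> edges_of M T"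
      using e by blast
    then show ?thesis
      using interior_edge_cells(3,8)[of T e] e by simp
  qed
  have "(\<Sum>T\<in>cells M. \<Sum>e\<in>edges_of M T - boundary_edges \<Omega> M. edge_stab \<epsilon> w e)
      = (\<Sum>e\<in>?E. \<Sum>T\<in>{T\<in>cells M. e \<in> edges_of M T}. edge_stab \<epsilon> w e)"
    unfolding E by (rule swap)
  also have "\<dots> = 2 * (\<Sum>e\<in>?E. edge_stab \<epsilon> w e)"
    by (simp add: two sum_distrib_left)
  also have "(\<Sum>e\<in>?E. edge_stab \<epsilon> w e) = (\<Sum>T\<in>cells M. \<Sum>e\<in>{e\<in>?E. e \<in> edges_of M T}. stab_form M \<epsilon> w w T)"
    unfolding edge_stab_def by (rule swap[symmetric])
  also have "\<dots> \<le> (\<Sum>T\<in>cells M. max_edges \<rho> * stab_form M \<epsilon> w w T)"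
  proof (rule sum_mono)
    fix T assume T: "T \<in> cells M"
    have "card {e\<in>?E. e \<in> edges_of M T} \<le> card (edges_of M T)"
      by (intro card_mono) auto
    also have "\<dots> \<le> max_edges \<rho>" by (rule card_edges_of[OF T])
    finally show "(\<Sum>e\<in>{e\<in>?E. e \<in> edges_of M T}. stab_form M \<epsilon> w w T) \<le> max_edges \<rho> * stab_form M \<epsilon> w w T"
      using stab_nonneg[OF T] by (simp add: mult_right_mono)
  qed
  finally show ?thesis by (simp add: sum_distrib_left mult.assoc)
qed

section \<open>Assembling the estimate\<close>

lemma energy_ge_stab:
  fixes u :: scalar_field and Du :: vector_field and w :: weak_fun
  defines "d \<equiv> wf_diff (triple_of u Du) w"
  shows "(\<Sum>T\<in>cells M. stab_form M \<epsilon> w w T) \<le> Bh k M \<epsilon> d d + Ah k M d d"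
proof -
  have "(\<Sum>T\<in>cells M. stab_form M \<epsilon> w w T) = (\<Sum>T\<in>cells M. stab_form M \<epsilon> d d T)"
    unfolding d_def by (simp only: stab_form_error)
  \<comment> \<open>The volume terms of the error energy are squared norms, so discarding them
    leaves the stabilizer of the error, which is that of \<open>w\<close>.\<close>
  moreover have "0 \<le> \<epsilon>\<^sup>2 * (\<Sum>T\<in>cells M. nrm2 T (weak_hess k M d T))"
    "0 \<le> (\<Sum>T\<in>cells M. nrm2 T (weak_grad k M d T))"
    by (intro mult_nonneg_nonneg sum_nonneg ip_self_nonneg zero_le_power2)+
  ultimately show ?thesis by (simp add: Bh_def Ah_def stab_form_def sum.distrib)
qed

lemma wg_norm_error:
  "0 \<le> wg_norm k M \<epsilon> (wf_diff (triple_of u Du) w)"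
  "(\<Sum>T\<in>cells M. stab_form M \<epsilon> w w T) \<le> (wg_norm k M \<epsilon> (wf_diff (triple_of u Du) w))\<^sup>2"
proof -
  have "0 \<le> (\<Sum>T\<in>cells M. stab_form M \<epsilon> w w T)" by (intro sum_nonneg stab_nonneg)
  then show "0 \<le> wg_norm k M \<epsilon> (wf_diff (triple_of u Du) w)"
    "(\<Sum>T\<in>cells M. stab_form M \<epsilon> w w T) \<le> (wg_norm k M \<epsilon> (wf_diff (triple_of u Du) w))\<^sup>2"
    using energy_ge_stab[where w = w and u = u and Du = Du and \<epsilon> = \<epsilon> and k = k] by (simp_all add: wg_norm_def)
qed

lemma eta_bound:
  assumes C: "edge_bound k C" and f: "L2 \<Omega> f" and \<epsilon>: "0 < \<epsilon>" and w: "wg_solution k \<Omega> M \<epsilon> f w"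
  shows "eta k \<Omega> M \<epsilon> f w \<le> (1 + sqrt (efficiency_constant \<rho> C))
    * (wg_norm k M \<epsilon> (wf_diff (triple_of u Du) w) + sqrt (\<Sum>T\<in>cells M. osc2_cell k \<epsilon> f T))"
proof -
  let ?s = "\<lambda>T. stab_form M \<epsilon> w w T" and ?I = "\<lambda>T. edges_of M T - boundary_edges \<Omega> M"
  define Osc where "Osc = (\<Sum>T\<in>cells M. osc2_cell k \<epsilon> f T)"
  define W where "W = wg_norm k M \<epsilon> (wf_diff (triple_of u Du) w)"
  define c0 where "c0 = 8 * C * max_edges \<rho> + 1"
  define c1 where "c1 = 2 * ((1 / \<rho>)^3 + 1 / \<rho>)"
  define c2 where "c2 = 2 * (2 / \<rho>)"
  define K where "K = efficiency_constant \<rho> C"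
  have nn: "0 \<le> c0" "0 \<le> c1" "0 \<le> c2"
    using C \<rho>_pos by (auto simp: c0_def c1_def c2_def edge_bound_def)
  have K: "K = c0 + (c1 + c2) * (2 * max_edges \<rho>) + 1"
    by (simp only: K_def efficiency_constant_def c0_def c1_def c2_def)
  have K0: "0 \<le> K" using nn unfolding K by simp
  have Osc_nonneg: "0 \<le> Osc" unfolding Osc_def osc2_cell_def by (intro sum_nonneg mult_nonneg_nonneg ip_self_nonneg) simp
  have W0: "0 \<le> W" unfolding W_def by (rule wg_norm_error(1))
  have "eta2_cell k \<Omega> M \<epsilon> f w T \<le> osc2_cell k \<epsilon> f T + (c0 + 1) * ?s T + (c1 + c2) * (\<Sum>e\<in>?I T. edge_stab \<epsilon> w e)"
    if T: "T \<in> cells M" for T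
  proof -
    have "(alpha \<epsilon> T)\<^sup>2 * nrm2 T (R_cell k M \<epsilon> f w T) \<le> c0 * ?s T"
      unfolding c0_def by (rule residual_bound[OF C f T \<epsilon> w])
    moreover have "(\<Sum>e\<in>?I T. (alpha_e1 \<epsilon> T)\<^sup>2 * edge_nrm2 e (J1 k M \<epsilon> w e)) \<le> (\<Sum>e\<in>?I T. c1 * edge_stab \<epsilon> w e)"
      unfolding c1_def by (intro sum_mono jump_residual_bounds(1)[OF f T _ _ \<epsilon> w]) auto
    moreover have "(\<Sum>e\<in>?I T. (alpha_e2 \<epsilon> T)\<^sup>2 * edge_nrm2 e (J2 k M \<epsilon> w e)) \<le> (\<Sum>e\<in>?I T. c2 * edge_stab \<epsilon> w e)"
      unfolding c2_def by (intro sum_mono jump_residual_bounds(2)[OF f T _ _ \<epsilon> w]) auto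
    ultimately show ?thesis
      unfolding eta2_cell_def stab_form_def[of M \<epsilon> w w T] sum_distrib_left[symmetric]
      by (simp add: distrib_right)
  qed
  then have "(\<Sum>T\<in>cells M. eta2_cell k \<Omega> M \<epsilon> f w T)
      \<le> (\<Sum>T\<in>cells M. osc2_cell k \<epsilon> f T + (c0 + 1) * ?s T + (c1 + c2) * (\<Sum>e\<in>?I T. edge_stab \<epsilon> w e))"
    by (rule sum_mono)
  also have "\<dots> = Osc + (c0 + 1) * (\<Sum>T\<in>cells M. ?s T)
      + (c1 + c2) * (\<Sum>T\<in>cells M. \<Sum>e\<in>?I T. edge_stab \<epsilon> w e)"
    by (simp add: Osc_def sum.distrib sum_distrib_left)
  also have "\<dots> \<le> Osc + (c0 + 1) * (\<Sum>T\<in>cells M. ?s T) + (c1 + c2) * (2 * max_edges \<rho> * (\<Sum>T\<in>cells M. ?s T))"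
    using nn by (intro add_left_mono mult_left_mono sum_edge_stab) simp
  also have "\<dots> = Osc + K * (\<Sum>T\<in>cells M. ?s T)"
    unfolding K by (simp add: algebra_simps)
  also have "\<dots> \<le> Osc + K * W\<^sup>2"
    unfolding W_def by (intro add_left_mono mult_left_mono wg_norm_error(2) K0)
  finally have "eta k \<Omega> M \<epsilon> f w \<le> sqrt (Osc + K * W\<^sup>2)"
    unfolding eta_def by (rule real_sqrt_le_mono)
  also have "\<dots> \<le> sqrt Osc + sqrt (K * W\<^sup>2)"
    using Osc_nonneg K0 by (intro sqrt_add_le_add_sqrt) auto
  also have "\<dots> = sqrt Osc + sqrt K * W" using W0 by (simp add: real_sqrt_mult)
  \<comment> \<open>The product expands to the two wanted terms plus nonnegative ones, which gives a
    single constant in front of both.\<close>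
  also have "\<dots> \<le> (1 + sqrt K) * (W + sqrt Osc)"
    using W0 Osc_nonneg K0 by (simp add: distrib_left distrib_right)
  finally show ?thesis unfolding K_def W_def Osc_def .
qed

end

theorem theorem4p2:
  fixes \<Omega> :: "(real^2) set" and k :: nat and \<rho> :: real
  assumes "open \<Omega>" and "connected \<Omega>" and "bounded \<Omega>" and "\<Omega> \<noteq> {}"
    and "2 \<le> k" and "0 < \<rho>"
  shows "\<exists>C>0. \<forall>M \<epsilon> f u Du uh.
    polygonal_mesh \<Omega> M \<longrightarrow> shape_regular \<rho> M \<longrightarrow> 0 < \<epsilon> \<longrightarrow> L2 \<Omega> f \<longrightarrow>
    weak_solution \<Omega> \<epsilon> f u Du \<longrightarrow> trace_representatives M u Du \<longrightarrow>
    wg_solution k \<Omega> M \<epsilon> f uh \<longrightarrow>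
    eta k \<Omega> M \<epsilon> f uh
      \<le> C * (wg_norm k M \<epsilon> (wf_diff (triple_of u Du) uh)
              + sqrt (\<Sum>T\<in>cells M. osc2_cell k \<epsilon> f T))"
proof -
  \<comment> \<open>The constant is fixed before mesh, \<epsilon>, data and solutions are
    introduced; it depends on \<open>\<rho>\<close> and \<open>k\<close> only.\<close>
  obtain C where C: "C > 0"
    and bound: "\<And>T e A p x. compact T \<Longrightarrow> 0 < diameter T \<Longrightarrow> apex \<rho> T e A \<Longrightarrow>
       fst e \<in> T \<Longrightarrow> snd e \<in> T \<Longrightarrow> p \<in> Pol k \<Longrightarrow> x \<in> seg e \<Longrightarrow>
       diameter T ^ 2 * (p x)\<^sup>2 \<le> C * ip T p p \<and>
       diameter T ^ 4 * (grad p x \<bullet> grad p x) \<le> C * ip T p p"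
    by (rule polynomial_bounds_on_edge[OF \<open>0 < \<rho>\<close>, of k]) blast
  have "eta k \<Omega> M \<epsilon> f uh \<le> (1 + sqrt (efficiency_constant \<rho> C))
      * (wg_norm k M \<epsilon> (wf_diff (triple_of u Du) uh) + sqrt (\<Sum>T\<in>cells M. osc2_cell k \<epsilon> f T))"
    if M: "polygonal_mesh \<Omega> M" "shape_regular \<rho> M" and *: "0 < \<epsilon>" "L2 \<Omega> f" "wg_solution k \<Omega> M \<epsilon> f uh"
    for M \<epsilon> f u Du uh
  proof -
    interpret regular_mesh \<Omega> M \<rho> using assms M by unfold_locales
    have "edge_bound k C"
      unfolding edge_bound_def
    proof (intro conjI ballI C)
      fix T e p assume T: "T \<in> cells M" and e: "e \<in> edges_of M T" and p: "p \<in> Pol k"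
      define h where "h = diameter T"
      have h: "0 < h" unfolding h_def by (rule diameter_pos[OF T])
      obtain A where A: "apex \<rho> T e A" using apex_exists[OF T e] .
      have B: "h^2 * (p x)\<^sup>2 \<le> C * ip T p p" "h^4 * (grad p x \<bullet> grad p x) \<le> C * ip T p p" if "x \<in> seg e" for x
        using bound[OF compact_cell[OF T] diameter_pos[OF T] A ends_in_cell[OF T e] p that]
        by (simp_all add: h_def)
      have X: "0 \<le> C * ip T p p" using C ip_self_nonneg[of T p] by simp
      \<comment> \<open>Integrating the pointwise bound multiplies it by the edge length, at most
        \<open>h\<close>; this lowers the power of the diameter by one, here and for the
        gradient.\<close>
      have "edge_nrm2 e p \<le> len e * (C * ip T p p / h^2)"
        using B(1) h by (intro edge_ip_self_le edge_cont_Pol[OF p]) (auto simp: field_simps power2_eq_square)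
      also have "\<dots> \<le> h * (C * ip T p p / h^2)"
        using len_le_diameter[OF T e] X by (intro mult_right_mono) (auto simp: h_def)
      finally show "diameter T * edge_nrm2 e p \<le> C * nrm2 T p"
        using h by (simp add: h_def[symmetric] field_simps power2_eq_square)
      have "edge_nrm2 e (grad p) \<le> len e * (C * ip T p p / h^4)"
        using B(2) h by (intro edge_ip_self_le edge_cont_vPol[OF grad_vPol[OF p]]) (auto simp: field_simps)
      also have "\<dots> \<le> h * (C * ip T p p / h^4)"
        using len_le_diameter[OF T e] X by (intro mult_right_mono) (auto simp: h_def)
      finally show "diameter T ^ 3 * edge_nrm2 e (grad p) \<le> C * nrm2 T p"
        using h by (simp add: h_def[symmetric] field_simps power_numeral_reduce)
    qed
    then show ?thesis using eta_bound * by blast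
  qed
  moreover have "0 < 1 + sqrt (efficiency_constant \<rho> C)"
    using C assms(6) by (intro add_pos_nonneg) (auto simp: efficiency_constant_def)
  ultimately show ?thesis by blast
qed

end
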